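(* Let $M$ be an open (non-compact) Riemannian manifold of $C^\infty$-bounded geometry for which there are constants $A,C,C'>0$ such that for all $x\in M$, $r>0$, $$V(x,2r)\leq A\,V(x,r),\qquad \frac{C}{V(x,\sqrt r)}\leq p_r(x,x)\leq \frac{C'}{V(x,\sqrt r)}.$$ Then: (i) There is $\gamma>0$ such that for any $x,y\in M$, $r>0$, if $B(x,r)\cap B(y,r)\neq\emptyset$, then $$\gamma^{-1}\leq\frac{V(x,r)}{V(y,r)}\leq\gamma.$$ (ii) For $x\in M$, there is a sequence $n_k\in\mathbb N$ such that the closed balls $\{\overline{B(x,n_k)}\}$ form a regular exhaustion of $M$.
   Context: $M$ has $C^\infty$-bounded geometry if it has positive injectivity radius and the curvature tensor is bounded together with all its covariant derivatives. $B(x,r)$ is the open geodesic ball, $V(x,r):=vol(B(x,r))$, $p_t(x,y)$ is the heat kernel on $M$ (the integral kernel of $e^{-t\Delta}$, $\Delta$ the positive Laplacian on functions), and $\delta$ is the geodesic distance. A regular exhaustion is an increasing sequence $\{K_n\}$ of compact subsets of $M$ whose union is $M$ and such that for any $r>0$ $$\lim_{n\to\infty}\frac{vol(Pen^+(K_n,r))}{vol(Pen^-(K_n,r))}=1,$$ where $Pen^+(K,r):=\{x\in M:\delta(x,K)\leq r\}$ and $Pen^-(K,r)$ is the closure of $M\setminus Pen^+(M\setminus K,r)$. *)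

theory Defs
  imports "HOL-Analysis.Analysis"
begin

section \<open>Smooth functions and charts\<close>

text \<open>\<open>C\<^sup>k\<close> functions on an open subset \<open>S\<close> of a Euclidean space.\<close>

fun Ck_on :: "nat \<Rightarrow> 'e::euclidean_space set \<Rightarrow> ('e \<Rightarrow> 'b::real_normed_vector) \<Rightarrow> bool" where
  "Ck_on 0 S f \<longleftrightarrow> continuous_on S f"
| "Ck_on (Suc k) S f \<longleftrightarrow>
     (\<forall>x\<in>S. f differentiable (at x)) \<and>
     (\<forall>b\<in>Basis. Ck_on k S (\<lambda>x. frechet_derivative f (at x) b))"

definition smooth_on :: "'e::euclidean_space set \<Rightarrow> ('e \<Rightarrow> 'b::real_normed_vector) \<Rightarrow> bool" where
  "smooth_on S f \<longleftrightarrow> (\<forall>k. Ck_on k S f)"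

definition pd :: "'n \<Rightarrow> (real^'n::finite \<Rightarrow> real) \<Rightarrow> real^'n \<Rightarrow> real" where
  "pd i f x = frechet_derivative f (at x) (axis i 1)"

text \<open>A chart is its domain together with its coordinate map; the values of the coordinate map
  outside the domain are irrelevant.\<close>

type_synonym ('a, 'n) chart = "'a set \<times> ('a \<Rightarrow> real^'n)"

abbreviation cdom :: "('a, 'n::finite) chart \<Rightarrow> 'a set" where "cdom \<equiv> fst"
abbreviation cmap :: "('a, 'n::finite) chart \<Rightarrow> 'a \<Rightarrow> real^'n" where "cmap \<equiv> snd"

definition cimg :: "('a, 'n::finite) chart \<Rightarrow> (real^'n) set" where
  "cimg c = cmap c ` cdom c"

definition cinv :: "('a, 'n::finite) chart \<Rightarrow> real^'n \<Rightarrow> 'a" where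
  "cinv c = inv_into (cdom c) (cmap c)"

definition is_chart :: "('a::topological_space, 'n::finite) chart \<Rightarrow> bool" where
  "is_chart c \<longleftrightarrow> open (cdom c) \<and> open (cimg c) \<and>
     homeomorphism (cdom c) (cimg c) (cmap c) (cinv c)"


section \<open>Riemannian manifolds\<close>

text \<open>The manifold is the whole type \<open>'a\<close>, its dimension is \<open>CARD('n)\<close>. The metric
  is given by its component matrices: \<open>gmat M c x\<close> is the matrix \<open>(g\<^sub>i\<^sub>j)\<close> in the
  chart \<open>c\<close> at the point with coordinates \<open>x \<in> cimg c\<close>.\<close>

record ('a, 'n) riem =
  atlas :: "('a, 'n) chart set"
  gmat :: "('a, 'n) chart \<Rightarrow> real^'n \<Rightarrow> real^'n^'n"

definition riemannian_manifold ::
    "('a::{t2_space,second_countable_topology}, 'n::finite) riem \<Rightarrow> bool" where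
  "riemannian_manifold M \<longleftrightarrow>
     connected (UNIV :: 'a set) \<and>
     (\<forall>c\<in>atlas M. is_chart c) \<and>
     (\<Union>c\<in>atlas M. cdom c) = UNIV \<and>
     (\<forall>c\<in>atlas M. \<forall>d\<in>atlas M.
        smooth_on (cmap c ` (cdom c \<inter> cdom d)) (\<lambda>x. cmap d (cinv c x))) \<and>
     (\<forall>c\<in>atlas M. smooth_on (cimg c) (gmat M c)) \<and>
     (\<forall>c\<in>atlas M. \<forall>x\<in>cimg c.
        transpose (gmat M c x) = gmat M c x \<and>
        (\<forall>v. v \<noteq> 0 \<longrightarrow> 0 < v \<bullet> (gmat M c x *v v))) \<and>
     (\<forall>c\<in>atlas M. \<forall>d\<in>atlas M. \<forall>x \<in> cmap c ` (cdom c \<inter> cdom d). \<forall>u v.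
        let \<tau> = (\<lambda>y. cmap d (cinv c y)); D = frechet_derivative \<tau> (at x)
        in u \<bullet> (gmat M c x *v v) = D u \<bullet> (gmat M d (\<tau> x) *v D v))"

text \<open>Some chart around \<open>p\<close>. It is only used to evaluate expressions whose value does not
  depend on the chart.\<close>

definition chart_at :: "('a, 'n::finite) riem \<Rightarrow> 'a \<Rightarrow> ('a, 'n) chart" where
  "chart_at M p = (SOME c. c \<in> atlas M \<and> p \<in> cdom c)"

definition gnorm :: "('a, 'n::finite) riem \<Rightarrow> ('a, 'n) chart \<Rightarrow> real^'n \<Rightarrow> real^'n \<Rightarrow> real" where
  "gnorm M c x v = sqrt (v \<bullet> (gmat M c x *v v))"

definition smooth_fun :: "('a, 'n::finite) riem \<Rightarrow> ('a \<Rightarrow> real) \<Rightarrow> bool" where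
  "smooth_fun M f \<longleftrightarrow> (\<forall>c\<in>atlas M. smooth_on (cimg c) (\<lambda>x. f (cinv c x)))"


section \<open>Geodesic distance\<close>

text \<open>\<open>C\<^sup>1\<close> on the compact interval \<open>I\<close>, with one-sided derivatives at the end points.\<close>

definition C1_curve_on ::
    "('a::topological_space, 'n::finite) riem \<Rightarrow> real set \<Rightarrow> (real \<Rightarrow> 'a) \<Rightarrow> bool" where
  "C1_curve_on M I \<gamma> \<longleftrightarrow> continuous_on I \<gamma> \<and>
     (\<forall>c\<in>atlas M. \<exists>v. continuous_on {t\<in>I. \<gamma> t \<in> cdom c} v \<and>
        (\<forall>t\<in>I. \<gamma> t \<in> cdom c \<longrightarrow>
           ((\<lambda>s. cmap c (\<gamma> s)) has_vector_derivative v t) (at t within I)))"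

definition piecewise_C1_curve ::
    "('a::topological_space, 'n::finite) riem \<Rightarrow> (real \<Rightarrow> 'a) \<Rightarrow> bool" where
  "piecewise_C1_curve M \<gamma> \<longleftrightarrow> continuous_on {0..1} \<gamma> \<and>
     (\<exists>S. finite S \<and>
        (\<forall>a b. 0 \<le> a \<and> a < b \<and> b \<le> 1 \<and> {a<..<b} \<inter> S = {} \<longrightarrow> C1_curve_on M {a..b} \<gamma>))"

definition speed :: "('a, 'n::finite) riem \<Rightarrow> (real \<Rightarrow> 'a) \<Rightarrow> real \<Rightarrow> real" where
  "speed M \<gamma> t =
     (let c = chart_at M (\<gamma> t)
      in gnorm M c (cmap c (\<gamma> t)) (vector_derivative (\<lambda>s. cmap c (\<gamma> s)) (at t)))"

definition curve_length :: "('a, 'n::finite) riem \<Rightarrow> (real \<Rightarrow> 'a) \<Rightarrow> real" where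
  "curve_length M \<gamma> = integral {0..1} (speed M \<gamma>)"

definition geodist :: "('a::topological_space, 'n::finite) riem \<Rightarrow> 'a \<Rightarrow> 'a \<Rightarrow> real" where
  "geodist M x y = Inf {curve_length M \<gamma> | \<gamma>. piecewise_C1_curve M \<gamma> \<and> \<gamma> 0 = x \<and> \<gamma> 1 = y}"

definition gball :: "('a::topological_space, 'n::finite) riem \<Rightarrow> 'a \<Rightarrow> real \<Rightarrow> 'a set" where
  "gball M x r = {y. geodist M x y < r}"


section \<open>Curvature and its covariant derivatives\<close>

definition ginv :: "('a, 'n::finite) riem \<Rightarrow> ('a, 'n) chart \<Rightarrow> real^'n \<Rightarrow> real^'n^'n" where
  "ginv M c x = matrix_inv (gmat M c x)"

text \<open>\<open>christoffel M c k i j\<close> is \<open>\<Gamma>\<^sup>k\<^sub>i\<^sub>j\<close>.\<close>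

definition christoffel ::
    "('a, 'n::finite) riem \<Rightarrow> ('a, 'n) chart \<Rightarrow> 'n \<Rightarrow> 'n \<Rightarrow> 'n \<Rightarrow> real^'n \<Rightarrow> real" where
  "christoffel M c k i j x =
     (1/2) * (\<Sum>l\<in>UNIV. ginv M c x $ k $ l *
        (pd i (\<lambda>y. gmat M c y $ j $ l) x + pd j (\<lambda>y. gmat M c y $ i $ l) x
         - pd l (\<lambda>y. gmat M c y $ i $ j) x))"

text \<open>\<open>riemann M c l k i j\<close> is the component \<open>R\<^sup>l\<^sub>k\<^sub>i\<^sub>j\<close>, that is,
  \<open>R(\<partial>\<^sub>i, \<partial>\<^sub>j) \<partial>\<^sub>k = \<Sum>\<^sub>l R\<^sup>l\<^sub>k\<^sub>i\<^sub>j \<partial>\<^sub>l\<close>.\<close>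

definition riemann ::
    "('a, 'n::finite) riem \<Rightarrow> ('a, 'n) chart \<Rightarrow> 'n \<Rightarrow> 'n \<Rightarrow> 'n \<Rightarrow> 'n \<Rightarrow> real^'n \<Rightarrow> real" where
  "riemann M c l k i j x =
     pd i (christoffel M c l j k) x - pd j (christoffel M c l i k) x
     + (\<Sum>m\<in>UNIV. christoffel M c l i m x * christoffel M c m j k x
                  - christoffel M c l j m x * christoffel M c m i k x)"

text \<open>Covariant tensor fields are given by their components in a chart, indexed by lists whose
  length is the rank; components at lists of another length are irrelevant.\<close>

type_synonym 'n tensor = "'n list \<Rightarrow> real^'n \<Rightarrow> real"

fun curvature_tensor ::
    "('a, 'n::finite) riem \<Rightarrow> ('a, 'n) chart \<Rightarrow> 'n tensor" where
  "curvature_tensor M c [h, k, i, j] x = (\<Sum>l\<in>UNIV. gmat M c x $ h $ l * riemann M c l k i j x)"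
| "curvature_tensor M c _ x = 0"

fun cov_deriv ::
    "('a, 'n::finite) riem \<Rightarrow> ('a, 'n) chart \<Rightarrow> 'n tensor \<Rightarrow> 'n tensor" where
  "cov_deriv M c T [] x = 0"
| "cov_deriv M c T (i # js) x =
     pd i (T js) x
     - (\<Sum>a<length js. \<Sum>m\<in>UNIV. christoffel M c m i (js ! a) x * T (js[a := m]) x)"

definition tensor_norm ::
    "('a, 'n::finite) riem \<Rightarrow> ('a, 'n) chart \<Rightarrow> nat \<Rightarrow> 'n tensor \<Rightarrow> real^'n \<Rightarrow> real" where
  "tensor_norm M c q T x = sqrt
     (\<Sum>is\<in>{is. length is = q}. \<Sum>js\<in>{js. length js = q}.
        (\<Prod>a<q. ginv M c x $ (is ! a) $ (js ! a)) * T is x * T js x)"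

definition bounded_curvature :: "('a, 'n::finite) riem \<Rightarrow> bool" where
  "bounded_curvature M \<longleftrightarrow>
     (\<forall>k. \<exists>B. \<forall>c\<in>atlas M. \<forall>x\<in>cimg c.
        tensor_norm M c (4 + k) ((cov_deriv M c ^^ k) (curvature_tensor M c)) x \<le> B)"


section \<open>Exponential map and injectivity radius\<close>

definition geodesic_on ::
    "('a::topological_space, 'n::finite) riem \<Rightarrow> real set \<Rightarrow> (real \<Rightarrow> 'a) \<Rightarrow> bool" where
  "geodesic_on M I \<gamma> \<longleftrightarrow> continuous_on I \<gamma> \<and>
     (\<forall>c\<in>atlas M. \<exists>v. \<forall>t\<in>I. \<gamma> t \<in> cdom c \<longrightarrow>
        ((\<lambda>s. cmap c (\<gamma> s)) has_vector_derivative v t) (at t within I) \<and>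
        (v has_vector_derivative
          (\<chi> k. - (\<Sum>i\<in>UNIV. \<Sum>j\<in>UNIV.
                     christoffel M c k i j (cmap c (\<gamma> t)) * (v t $ i) * (v t $ j))))
          (at t within I))"

text \<open>\<open>E\<close> is the exponential map at \<open>x\<close> on the set \<open>D\<close> of tangent vectors, where the tangent
  space at \<open>x\<close> is identified with \<open>\<real>\<^sup>n\<close> by the chart \<open>c\<close>. In particular the geodesics with
  initial velocity in \<open>D\<close> exist up to time 1. Since geodesics are determined by their initial
  velocity, so is \<open>E\<close> on \<open>D\<close>.\<close>

definition exponential_on ::
    "('a::topological_space, 'n::finite) riem \<Rightarrow> ('a, 'n) chart \<Rightarrow> 'a \<Rightarrow> (real^'n) set
      \<Rightarrow> (real^'n \<Rightarrow> 'a) \<Rightarrow> bool" where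
  "exponential_on M c x D E \<longleftrightarrow>
     (\<forall>v\<in>D. \<exists>\<gamma>. geodesic_on M {0..1} \<gamma> \<and> \<gamma> 0 = x \<and>
        ((\<lambda>s. cmap c (\<gamma> s)) has_vector_derivative v) (at 0 within {0..1}) \<and> E v = \<gamma> 1)"

definition diffeo_onto_image ::
    "('a::topological_space, 'n::finite) riem \<Rightarrow> (real^'n) set \<Rightarrow> (real^'n \<Rightarrow> 'a) \<Rightarrow> bool" where
  "diffeo_onto_image M D E \<longleftrightarrow>
     open D \<and> continuous_on D E \<and> inj_on E D \<and> open (E ` D) \<and>
     (\<forall>c\<in>atlas M.
        smooth_on {v\<in>D. E v \<in> cdom c} (\<lambda>v. cmap c (E v)) \<and>
        smooth_on (cmap c ` (cdom c \<inter> E ` D)) (\<lambda>y. inv_into D E (cinv c y)))"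

definition inj_radius_at :: "('a::topological_space, 'n::finite) riem \<Rightarrow> 'a \<Rightarrow> ereal" where
  "inj_radius_at M x =
     (let c = chart_at M x; D = (\<lambda>r. {v. gnorm M c (cmap c x) v < r})
      in Sup {ereal r | r. 0 < r \<and>
           (\<exists>E. exponential_on M c x (D r) E \<and> diffeo_onto_image M (D r) E)})"

definition inj_radius :: "('a::topological_space, 'n::finite) riem \<Rightarrow> ereal" where
  "inj_radius M = (INF x. inj_radius_at M x)"

definition bounded_geometry :: "('a::topological_space, 'n::finite) riem \<Rightarrow> bool" where
  "bounded_geometry M \<longleftrightarrow> 0 < inj_radius M \<and> bounded_curvature M"


section \<open>Volume, Laplacian and heat kernel\<close>

text \<open>\<open>\<mu>\<close> is the Riemannian volume \<open>\<surd>(det g) dx\<close>. The volumes of Borel subsets of chart domains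
  determine it.\<close>

definition riemannian_volume ::
    "('a::topological_space, 'n::finite) riem \<Rightarrow> 'a measure \<Rightarrow> bool" where
  "riemannian_volume M \<mu> \<longleftrightarrow> sets \<mu> = sets borel \<and>
     (\<forall>c\<in>atlas M. \<forall>A\<in>sets borel. A \<subseteq> cdom c \<longrightarrow>
        emeasure \<mu> A =
          (\<integral>\<^sup>+x. ennreal (sqrt (det (gmat M c x))) * indicator (cmap c ` A) x \<partial>lborel))"

text \<open>The positive Laplacian
  \<open>\<Delta>f = - (det g)\<^sup>-\<^sup>1\<^sup>/\<^sup>2 \<Sum>\<^sub>i\<^sub>j \<partial>\<^sub>i ((det g)\<^sup>1\<^sup>/\<^sup>2 g\<^sup>i\<^sup>j \<partial>\<^sub>j f)\<close>.\<close>

definition laplacian :: "('a, 'n::finite) riem \<Rightarrow> ('a \<Rightarrow> real) \<Rightarrow> 'a \<Rightarrow> real" where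
  "laplacian M f p =
     (let c = chart_at M p; w = (\<lambda>y. sqrt (det (gmat M c y))); x = cmap c p
      in - (1 / w x) * (\<Sum>i\<in>UNIV. \<Sum>j\<in>UNIV.
             pd i (\<lambda>y. w y * ginv M c y $ i $ j * pd j (\<lambda>z. f (cinv c z)) y) x))"

definition test_function :: "('a::topological_space, 'n::finite) riem \<Rightarrow> ('a \<Rightarrow> real) \<Rightarrow> bool" where
  "test_function M f \<longleftrightarrow> smooth_fun M f \<and> compact (closure {p. f p \<noteq> 0})"

definition L2 :: "'a measure \<Rightarrow> ('a \<Rightarrow> real) set" where
  "L2 \<mu> = {f \<in> borel_measurable \<mu>. integrable \<mu> (\<lambda>x. (f x)\<^sup>2)}"

definition L2_norm :: "'a measure \<Rightarrow> ('a \<Rightarrow> real) \<Rightarrow> real" where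
  "L2_norm \<mu> f = sqrt (\<integral>x. (f x)\<^sup>2 \<partial>\<mu>)"

text \<open>\<open>T t\<close> is \<open>e\<^sup>-\<^sup>t\<^sup>\<Delta>\<close>: \<open>T\<close> is the strongly continuous contraction semigroup on
  \<open>L\<^sup>2\<close> whose generator is \<open>-\<Delta>\<close>, where \<open>\<Delta>\<close> is the closure of the Laplacian on smooth
  compactly supported functions. On a complete manifold this closure is the unique self-adjoint
  extension. The last clause says that the graph of the generator is the closure of the graph
  of \<open>-\<Delta>\<close> on test functions. Elements of \<open>L\<^sup>2\<close> are represented by functions.\<close>

definition heat_semigroup ::
    "('a::topological_space, 'n::finite) riem \<Rightarrow> 'a measure
      \<Rightarrow> (real \<Rightarrow> ('a \<Rightarrow> real) \<Rightarrow> 'a \<Rightarrow> real) \<Rightarrow> bool" where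
  "heat_semigroup M \<mu> T \<longleftrightarrow>
     (\<forall>t\<ge>0. \<forall>f\<in>L2 \<mu>. T t f \<in> L2 \<mu> \<and> L2_norm \<mu> (T t f) \<le> L2_norm \<mu> f) \<and>
     (\<forall>t\<ge>0. \<forall>f\<in>L2 \<mu>. \<forall>h\<in>L2 \<mu>. \<forall>a b.
        AE x in \<mu>. T t (\<lambda>y. a * f y + b * h y) x = a * T t f x + b * T t h x) \<and>
     (\<forall>f\<in>L2 \<mu>. AE x in \<mu>. T 0 f x = f x) \<and>
     (\<forall>s\<ge>0. \<forall>t\<ge>0. \<forall>f\<in>L2 \<mu>. AE x in \<mu>. T (s + t) f x = T s (T t f) x) \<and>
     (\<forall>f\<in>L2 \<mu>. ((\<lambda>t. L2_norm \<mu> (\<lambda>x. T t f x - f x)) \<longlongrightarrow> 0) (at_right 0)) \<and>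
     (\<forall>f\<in>L2 \<mu>. \<forall>h\<in>L2 \<mu>.
        ((\<lambda>t. L2_norm \<mu> (\<lambda>x. (T t f x - f x) / t - h x)) \<longlongrightarrow> 0) (at_right 0) \<longleftrightarrow>
        (\<exists>F. (\<forall>n. test_function M (F n)) \<and>
             (\<lambda>n. L2_norm \<mu> (\<lambda>x. F n x - f x)) \<longlonglongrightarrow> 0 \<and>
             (\<lambda>n. L2_norm \<mu> (\<lambda>x. - laplacian M (F n) x - h x)) \<longlonglongrightarrow> 0))"

text \<open>Continuity of \<open>p\<close> makes its values unique, in particular those on the diagonal.\<close>

definition heat_kernel ::
    "('a::topological_space, 'n::finite) riem \<Rightarrow> 'a measure \<Rightarrow> (real \<Rightarrow> 'a \<Rightarrow> 'a \<Rightarrow> real)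
      \<Rightarrow> bool" where
  "heat_kernel M \<mu> p \<longleftrightarrow>
     continuous_on ({0<..} \<times> UNIV \<times> UNIV) (\<lambda>(t, x, y). p t x y) \<and>
     (\<exists>T. heat_semigroup M \<mu> T \<and>
        (\<forall>t>0. \<forall>f\<in>L2 \<mu>. AE x in \<mu>.
           integrable \<mu> (\<lambda>y. p t x y * f y) \<and> T t f x = (\<integral>y. p t x y * f y \<partial>\<mu>)))"


section \<open>Ball volumes and regular exhaustions\<close>

definition ball_volume ::
    "('a::topological_space, 'n::finite) riem \<Rightarrow> 'a measure \<Rightarrow> 'a \<Rightarrow> real \<Rightarrow> ennreal" where
  "ball_volume M \<mu> x r = emeasure \<mu> (gball M x r)"

text \<open>The distance to a set is taken in \<open>ereal\<close>, so that the empty set has distance \<open>\<infinity>\<close>.\<close>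

definition Pen_plus :: "('a::topological_space, 'n::finite) riem \<Rightarrow> 'a set \<Rightarrow> real \<Rightarrow> 'a set" where
  "Pen_plus M K r = {x. (INF y\<in>K. ereal (geodist M x y)) \<le> ereal r}"

definition Pen_minus :: "('a::topological_space, 'n::finite) riem \<Rightarrow> 'a set \<Rightarrow> real \<Rightarrow> 'a set" where
  "Pen_minus M K r = closure (- Pen_plus M (- K) r)"

definition regular_exhaustion ::
    "('a::topological_space, 'n::finite) riem \<Rightarrow> 'a measure \<Rightarrow> (nat \<Rightarrow> 'a set) \<Rightarrow> bool" where
  "regular_exhaustion M \<mu> K \<longleftrightarrow>
     (\<forall>n. compact (K n)) \<and> incseq K \<and> (\<Union>n. K n) = UNIV \<and>
     (\<forall>r>0. (\<lambda>n. emeasure \<mu> (Pen_plus M (K n) r) / emeasure \<mu> (Pen_minus M (K n) r))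
              \<longlonglongrightarrow> 1)"

end

theory Submission
  imports Defs "HOL-Real_Asymp.Real_Asymp"
begin

text \<open>Both assertions concern the metric measure space formed by the geodesic distance and the
  Riemannian volume. Write \<open>V(x, r)\<close> for the volume of the ball \<open>B(x, r)\<close>.

  If \<open>B(x, r)\<close> and \<open>B(y, r)\<close> meet then \<open>B(x, r) \<subseteq> B(y, 4r)\<close>, and doubling twice gives
  \<open>V(x, r) \<le> A\<^sup>2 V(y, r)\<close>; so \<open>\<gamma> = A\<^sup>2\<close> works in (i). For (ii), suppose that for some \<open>q > 1\<close> and
  \<open>k\<close> the inequality \<open>V(x, n + k) \<ge> q V(x, n - k)\<close> held for all large \<open>n\<close>. Then \<open>V(x, r)\<close> would grow
  exponentially in \<open>r\<close>, whereas doubling bounds it by a power of \<open>r\<close>. Hence for each \<open>k\<close> there are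
  arbitrarily large \<open>n\<close> with \<open>V(x, n + k) < (1 + 1/k) V(x, n - k)\<close> (\<open>slow_growth\<close>), and choosing one
  such \<open>n\<^sub>k\<close> for each \<open>k\<close> gives the exhaustion: as soon as \<open>k \<ge> r + 1\<close>, the outer and the
  inner \<open>r\<close>-neighbourhood of the closed ball of radius \<open>n\<^sub>k\<close> lie between the balls of radius
  \<open>n\<^sub>k - k\<close> and \<open>n\<^sub>k + k\<close>.

  This argument presupposes that the geodesic distance is a metric for the topology of the manifold,
  that balls have positive finite volume, and that closed balls are compact. The first two points
  come from comparing the Riemannian with the Euclidean metric in a chart. Compactness is a form of
  the Hopf-Rinow theorem, and it is here that the positive injectivity radius enters. If
  \<open>\<rho>\<close> is smaller than the injectivity radius, then every ball of radius \<open>\<rho>\<close> is contained in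
  a compact set, namely in the image of a closed ball under the exponential map
  (\<open>gball_subset_compact_inj_radius\<close>). By doubling, a ball of any radius is covered by finitely many
  balls of radius \<open>\<rho>\<close> (\<open>totally_bounded_B\<close>), so its closure is compact.

  The statement about the exponential map rests on the Gauss lemma: in normal coordinates the
  speed of a curve is at least the rate of change of the distance to the origin, so a curve that
  leaves the image of the ball of radius \<open>\<rho>\<close> is at least \<open>\<rho>\<close> long (\<open>curve_length_exit\<close>). For the
  Gauss lemma it must be known that \<open>t \<mapsto> E (t v)\<close> is a geodesic, which needs the uniqueness of
  geodesics (\<open>geodesic_unique\<close>). Throughout, the geodesic equation is used in its Euler-Lagrange
  form: the momentum \<open>g(X) V\<close> of a curve \<open>X\<close> with velocity \<open>V\<close> satisfies
  \<open>w \<bullet> (g(X) V)' = 1/2 (D\<^sub>w g)(V, V)\<close> for all \<open>w\<close>. In this form no derivatives of the inverse matrix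
  of \<open>g\<close> occur.\<close>

section \<open>Second derivatives\<close>

lemma bounded_bilinear_matrix_vector_mult [bounded_bilinear]:
  "bounded_bilinear ((*v) :: real^'n^'m \<Rightarrow> real^'n \<Rightarrow> real^'m)"
  by (rule iffD1[OF bilinear_conv_bounded_bilinear])
    (auto simp: bilinear_def matrix_vector_mult_add_rdistrib matrix_vector_right_distrib
      matrix_vector_mult_def vec_eq_iff sum_distrib_left scaleR_sum_right algebra_simps
      simp flip: sum.distrib intro!: linearI sum.cong)

text \<open>Class \<open>Ck_on\<close> only speaks about derivatives in the directions of the basis; this expansion
  transfers them to arbitrary, and also to varying, directions.\<close>

lemma frechet_derivative_Basis_expand:
  fixes f :: "'e::euclidean_space \<Rightarrow> 'b::real_normed_vector"
  assumes "f differentiable at x"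
  shows "frechet_derivative f (at x) w = (\<Sum>b\<in>Basis. (w \<bullet> b) *\<^sub>R frechet_derivative f (at x) b)"
proof -
  have lin: "linear (frechet_derivative f (at x))"
    using assms by (rule linear_frechet_derivative)
  have "frechet_derivative f (at x) w = frechet_derivative f (at x) (\<Sum>b\<in>Basis. (w \<bullet> b) *\<^sub>R b)"
    by (simp add: euclidean_representation)
  also have "\<dots> = (\<Sum>b\<in>Basis. (w \<bullet> b) *\<^sub>R frechet_derivative f (at x) b)"
    by (simp add: linear_sum[OF lin] linear_scale[OF lin])
  finally show ?thesis .
qed

lemma Ck_on_continuous: "Ck_on k S f \<Longrightarrow> continuous_on S f"
  by (cases k) (auto intro!: continuous_at_imp_continuous_on dest: differentiable_imp_continuous_within)

lemma Ck_on_has_derivative: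
  "Ck_on (Suc k) S f \<Longrightarrow> x \<in> S \<Longrightarrow> (f has_derivative frechet_derivative f (at x)) (at x)"
  by (auto simp: frechet_derivative_works[symmetric])

lemma Ck_on_continuous_frechet_derivative:
  fixes f :: "'e::euclidean_space \<Rightarrow> 'b::real_normed_vector"
  assumes f: "Ck_on (Suc k) S f" and X: "continuous_on T X" "X ` T \<subseteq> S" and v: "continuous_on T v"
  shows "continuous_on T (\<lambda>t. frechet_derivative f (at (X t)) (v t))"
proof -
  have "continuous_on T (\<lambda>t. \<Sum>b\<in>Basis. (v t \<bullet> b) *\<^sub>R frechet_derivative f (at (X t)) b)"
  proof (intro continuous_intros v)
    fix b :: 'e assume "b \<in> Basis"
    then have "continuous_on S (\<lambda>x. frechet_derivative f (at x) b)"
      using f by (auto intro: Ck_on_continuous)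
    from continuous_on_compose2[OF this X]
    show "continuous_on T (\<lambda>t. frechet_derivative f (at (X t)) b)" .
  qed
  moreover have "frechet_derivative f (at (X t)) (v t)
      = (\<Sum>b\<in>Basis. (v t \<bullet> b) *\<^sub>R frechet_derivative f (at (X t)) b)" if "t \<in> T" for t
    using that f X by (intro frechet_derivative_Basis_expand) auto
  ultimately show ?thesis
    by (simp cong: continuous_on_cong)
qed

text \<open>The value at \<open>(a, w)\<close> of the second derivative as a bilinear map: the derivative in direction
  \<open>a\<close> of the derivative in direction \<open>w\<close>. It is expanded over the basis in \<open>w\<close> since \<open>Ck_on\<close>
  provides differentiability of partial derivatives only.\<close>

definition second_derivative ::
    "('e::euclidean_space \<Rightarrow> 'b::real_normed_vector) \<Rightarrow> 'e \<Rightarrow> 'e \<Rightarrow> 'e \<Rightarrow> 'b" where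
  "second_derivative f x a w =
     (\<Sum>b\<in>Basis. (w \<bullet> b) *\<^sub>R frechet_derivative (\<lambda>y. frechet_derivative f (at y) b) (at x) a)"

lemma has_derivative_frechet_derivative:
  fixes f :: "'e::euclidean_space \<Rightarrow> 'b::real_normed_vector"
  assumes f: "Ck_on (Suc (Suc k)) S f" and S: "open S"
    and X: "(X has_derivative X') (at t within T)" "X t \<in> S"
    and v: "(v has_derivative v') (at t within T)" and t: "t \<in> T"
  shows "((\<lambda>s. frechet_derivative f (at (X s)) (v s)) has_derivative
     (\<lambda>h. second_derivative f (X t) (X' h) (v t) + frechet_derivative f (at (X t)) (v' h)))
     (at t within T)"
proof -
  have "((\<lambda>s. frechet_derivative f (at (X s)) b) has_derivative
      (\<lambda>h. frechet_derivative (\<lambda>y. frechet_derivative f (at y) b) (at (X t)) (X' h))) (at t within T)"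
    if "b \<in> Basis" for b
  proof -
    have "Ck_on (Suc k) S (\<lambda>y. frechet_derivative f (at y) b)"
      using f that by auto
    from Ck_on_has_derivative[OF this X(2)]
    have "((\<lambda>y. frechet_derivative f (at y) b) has_derivative
        frechet_derivative (\<lambda>y. frechet_derivative f (at y) b) (at (X t))) (at (X t))" .
    from has_derivative_compose[OF X(1) this] show ?thesis
      by (simp add: o_def)
  qed
  note * = has_derivative_scaleR[OF has_derivative_inner_left[OF v] this]
  have "((\<lambda>s. \<Sum>b\<in>Basis. (v s \<bullet> b) *\<^sub>R frechet_derivative f (at (X s)) b) has_derivative
     (\<lambda>h. second_derivative f (X t) (X' h) (v t) + frechet_derivative f (at (X t)) (v' h)))
     (at t within T)"
  proof (rule has_derivative_eq_rhs[OF has_derivative_sum[OF *]])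
    have d: "f differentiable (at (X t))" using f X by auto
    show "(\<lambda>h. \<Sum>b\<in>Basis. (v t \<bullet> b) *\<^sub>R
             frechet_derivative (\<lambda>y. frechet_derivative f (at y) b) (at (X t)) (X' h) +
            (v' h \<bullet> b) *\<^sub>R frechet_derivative f (at (X t)) b) =
      (\<lambda>h. second_derivative f (X t) (X' h) (v t) + frechet_derivative f (at (X t)) (v' h))"
      by (subst frechet_derivative_Basis_expand[OF d])
        (simp add: second_derivative_def sum.distrib)
  qed
  moreover have "\<forall>\<^sub>F s in at t within T. X s \<in> S"
    using topological_tendstoD[OF has_derivative_continuous[OF X(1), unfolded continuous_within] S X(2)] .
  then have "\<forall>\<^sub>F s in at t within T. (\<Sum>b\<in>Basis. (v s \<bullet> b) *\<^sub>R frechet_derivative f (at (X s)) b)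
     = frechet_derivative f (at (X s)) (v s)"
    by eventually_elim
      (use f in \<open>auto intro!: frechet_derivative_Basis_expand[symmetric]\<close>)
  moreover have "(\<Sum>b\<in>Basis. (v t \<bullet> b) *\<^sub>R frechet_derivative f (at (X t)) b)
     = frechet_derivative f (at (X t)) (v t)"
    using f X by (auto intro!: frechet_derivative_Basis_expand[symmetric])
  ultimately show ?thesis
    by (rule has_derivative_transform_eventually[OF _ _ _ t])
qed

lemma Ck_on_continuous_second_derivative:
  fixes f :: "'e::euclidean_space \<Rightarrow> 'b::real_normed_vector"
  assumes f: "Ck_on (Suc (Suc k)) S f"
  shows "continuous_on S (\<lambda>x. second_derivative f x a b)"
  unfolding second_derivative_def
proof (intro continuous_intros)
  fix c :: 'e assume "c \<in> Basis"
  then have "Ck_on (Suc k) S (\<lambda>y. frechet_derivative f (at y) c)"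
    using f by auto
  from Ck_on_continuous_frechet_derivative[OF this]
  show "continuous_on S (\<lambda>x. frechet_derivative (\<lambda>y. frechet_derivative f (at y) c) (at x) a)"
    by (auto intro: continuous_intros)
qed

lemma second_derivative_scaleR:
  fixes f :: "'e::euclidean_space \<Rightarrow> 'b::real_normed_vector"
  assumes f: "Ck_on (Suc (Suc k)) S f" and x: "x \<in> S"
  shows "second_derivative f x (t *\<^sub>R a) w = t *\<^sub>R second_derivative f x a w"
proof -
  have "linear (frechet_derivative (\<lambda>y. frechet_derivative f (at y) b) (at x))" if "b \<in> Basis" for b
    using f x that by (intro linear_frechet_derivative) simp
  then show ?thesis
    by (simp add: second_derivative_def linear_scale scaleR_sum_right mult.commute)
qed

text \<open>Both sides are compared through
  \<open>D f (x + t b) a - D f x a = \<integral>\<^sub>0\<^sup>t D\<^sup>2 f (x + \<tau> b) (a, b) d\<tau>\<close>, which comes from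
  differentiating \<open>f (x + s a + t b) - f (x + s a) = \<integral>\<^sub>0\<^sup>t D f (x + s a + \<tau> b) b d\<tau>\<close> under the
  integral sign at \<open>s = 0\<close>. The two sides have the two second derivatives as their derivatives at \<open>t = 0\<close>.\<close>

lemma second_derivative_symmetric:
  fixes f :: "'e::euclidean_space \<Rightarrow> 'b::banach"
  assumes f: "Ck_on (Suc (Suc k)) S f" and S: "open S" and x: "x \<in> S"
  shows "second_derivative f x a b = second_derivative f x b a"
proof -
  obtain d where d: "d > 0" "ball x d \<subseteq> S"
    using S x openE by blast
  \<comment> \<open>The parallelogram spanned by \<open>e a\<close> and \<open>e b\<close> at \<open>x\<close> stays inside \<open>ball x d\<close>; the summand 1 covers \<open>a = b = 0\<close>.\<close>
  define e where "e = d / (2 * (norm a + norm b + 1))"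
  have pos: "norm a + norm b + 1 > 0"
    by (smt (verit) norm_ge_zero)
  have e: "e > 0" using d pos by (simp add: e_def)
  have inS: "x + s *\<^sub>R a + t *\<^sub>R b \<in> S" if "\<bar>s\<bar> \<le> e" "\<bar>t\<bar> \<le> e" for s t
  proof -
    have "norm (s *\<^sub>R a + t *\<^sub>R b) \<le> e * norm a + e * norm b"
      by (rule order_trans[OF norm_triangle_ineq])
        (use that in \<open>auto intro!: add_mono mult_right_mono\<close>)
    also have "\<dots> \<le> e * (norm a + norm b + 1)"
      using e by (simp add: algebra_simps)
    also have "\<dots> = d / 2"
      using pos by (simp add: e_def field_simps)
    also have "\<dots> < d"
      using d by simp
    finally have "x + (s *\<^sub>R a + t *\<^sub>R b) \<in> ball x d"
      by (metis add_diff_cancel_left' dist_commute dist_norm mem_ball)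
    then show ?thesis using d by (auto simp: add.assoc)
  qed
  let ?D = "\<lambda>y. frechet_derivative f (at y)"
  have lin: "linear (?D y)" if "y \<in> S" for y
    using f that by (auto intro!: linear_frechet_derivative)
  have lin2: "linear (\<lambda>a. second_derivative f y a w)" if "y \<in> S" for y w
    using has_derivative_linear[OF has_derivative_frechet_derivative[OF f S has_derivative_ident that has_derivative_const[of w] UNIV_I]]
    by (simp add: linear_0[OF lin[OF that]])
  have D2: "((\<lambda>s. ?D (X s) w) has_vector_derivative second_derivative f (X t) X' w) (at t within T)"
    if "(X has_vector_derivative X') (at t within T)" "X t \<in> S" "t \<in> T" for X X' t T w
    using has_derivative_frechet_derivative[OF f S that(1,2)[unfolded has_vector_derivative_def] has_derivative_const[of w] that(3)]
    by (simp add: linear_0[OF lin[OF that(2)]] has_vector_derivative_def linear_scale[OF lin2[OF that(2)]])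
  have D1: "((\<lambda>s. f (X s)) has_vector_derivative ?D (X t) X') (at t within T)"
    if "(X has_vector_derivative X') (at t within T)" "X t \<in> S" for X X' t T
    using has_derivative_compose[OF that(1)[unfolded has_vector_derivative_def] Ck_on_has_derivative[OF f that(2)]]
    by (simp add: has_vector_derivative_def linear_scale[OF lin[OF that(2)]])
  have eq: "?D (x + t *\<^sub>R b) a - ?D x a
      = integral {0..t} (\<lambda>\<tau>. second_derivative f (x + \<tau> *\<^sub>R b) a b)" if t: "t \<in> {0..e}" for t
  proof -
    define U where "U = {-e<..<e}"
    have "((\<lambda>s. integral (cbox 0 t) (\<lambda>\<tau>. ?D (x + s *\<^sub>R a + \<tau> *\<^sub>R b) b)) has_vector_derivative
       integral (cbox 0 t) (\<lambda>\<tau>. second_derivative f (x + 0 *\<^sub>R a + \<tau> *\<^sub>R b) a b)) (at 0 within U)"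
    proof (rule leibniz_rule_vector_derivative)
      show "((\<lambda>s. ?D (x + s *\<^sub>R a + \<tau> *\<^sub>R b) b) has_vector_derivative
          second_derivative f (x + s *\<^sub>R a + \<tau> *\<^sub>R b) a b) (at s within U)"
        if "s \<in> U" "\<tau> \<in> cbox 0 t" for s \<tau>
        using that t by (intro D2 inS) (auto simp: U_def intro!: derivative_eq_intros)
      show "(\<lambda>\<tau>. ?D (x + s *\<^sub>R a + \<tau> *\<^sub>R b) b) integrable_on cbox 0 t" if "s \<in> U" for s
        using that t
        by (intro integrable_continuous Ck_on_continuous_frechet_derivative[OF f] continuous_intros)
          (auto simp: U_def intro!: inS)
      show "continuous_on (U \<times> cbox 0 t)
          (\<lambda>(s, \<tau>). second_derivative f (x + s *\<^sub>R a + \<tau> *\<^sub>R b) a b)"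
        unfolding split_beta
        using t by (intro continuous_on_compose2[OF Ck_on_continuous_second_derivative[OF f]] continuous_intros)
          (auto simp: U_def intro!: inS)
    qed (use e in \<open>auto simp: U_def\<close>)
    moreover have "((\<lambda>s. integral (cbox 0 t) (\<lambda>\<tau>. ?D (x + s *\<^sub>R a + \<tau> *\<^sub>R b) b)) has_vector_derivative
       ?D (x + t *\<^sub>R b) a - ?D x a) (at 0 within U)"
    proof (rule has_vector_derivative_transform[where f="\<lambda>s. f (x + s *\<^sub>R a + t *\<^sub>R b) - f (x + s *\<^sub>R a)"])
      show "integral (cbox 0 t) (\<lambda>\<tau>. ?D (x + s *\<^sub>R a + \<tau> *\<^sub>R b) b)
          = f (x + s *\<^sub>R a + t *\<^sub>R b) - f (x + s *\<^sub>R a)" if "s \<in> U" for s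
      proof -
        have "((\<lambda>\<tau>. ?D (x + s *\<^sub>R a + \<tau> *\<^sub>R b) b) has_integral
           f (x + s *\<^sub>R a + t *\<^sub>R b) - f (x + s *\<^sub>R a + 0 *\<^sub>R b)) {0..t}"
          by (rule fundamental_theorem_of_calculus)
            (use that t in \<open>auto simp: U_def intro!: D1 inS derivative_eq_intros\<close>)
        then show ?thesis by (simp add: integral_unique)
      qed
      show "0 \<in> U" using e by (auto simp: U_def)
      have 0: "x + 0 *\<^sub>R a + t *\<^sub>R b \<in> S" "x + 0 *\<^sub>R a \<in> S" using inS[of 0 t] t e x by auto
      show "((\<lambda>s. f (x + s *\<^sub>R a + t *\<^sub>R b) - f (x + s *\<^sub>R a)) has_vector_derivative
         ?D (x + t *\<^sub>R b) a - ?D x a) (at 0 within U)"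
      proof (intro has_vector_derivative_diff)
        have "((\<lambda>s. x + s *\<^sub>R a + t *\<^sub>R b) has_vector_derivative a) (at 0 within U)"
          by (auto intro!: derivative_eq_intros)
        from D1[OF this 0(1)]
        show "((\<lambda>s. f (x + s *\<^sub>R a + t *\<^sub>R b)) has_vector_derivative ?D (x + t *\<^sub>R b) a) (at 0 within U)"
          by simp
        have "((\<lambda>s. x + s *\<^sub>R a) has_vector_derivative a) (at 0 within U)"
          by (auto intro!: derivative_eq_intros)
        from D1[OF this 0(2)]
        show "((\<lambda>s. f (x + s *\<^sub>R a)) has_vector_derivative ?D x a) (at 0 within U)"
          by simp
      qed
    qed
    moreover have "at (0::real) within U = at 0"
      by (rule at_within_open) (use e in \<open>auto simp: U_def\<close>)
    ultimately have "integral (cbox 0 t) (\<lambda>\<tau>. second_derivative f (x + 0 *\<^sub>R a + \<tau> *\<^sub>R b) a b)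
        = ?D (x + t *\<^sub>R b) a - ?D x a"
      by (metis vector_derivative_unique_at)
    then show ?thesis
      by simp
  qed
  have "((\<lambda>t. x + t *\<^sub>R b) has_vector_derivative b) (at 0 within {0..e})"
    by (auto intro!: derivative_eq_intros)
  from D2[OF this, of a]
  have "((\<lambda>t. ?D (x + t *\<^sub>R b) a) has_vector_derivative second_derivative f x b a)
      (at 0 within {0..e})"
    using x e by simp
  from has_vector_derivative_diff[OF this has_vector_derivative_const]
  have "((\<lambda>t. ?D (x + t *\<^sub>R b) a - ?D x a) has_vector_derivative second_derivative f x b a)
      (at 0 within {0..e})"
    by simp
  moreover have "((\<lambda>t. integral {0..t} (\<lambda>\<tau>. second_derivative f (x + \<tau> *\<^sub>R b) a b))
      has_vector_derivative second_derivative f (x + 0 *\<^sub>R b) a b) (at 0 within {0..e})"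
    using e inS[of 0]
    by (intro integral_has_vector_derivative continuous_on_compose2[OF Ck_on_continuous_second_derivative[OF f]]
        continuous_intros) auto
  then have int: "((\<lambda>t. integral {0..t} (\<lambda>\<tau>. second_derivative f (x + \<tau> *\<^sub>R b) a b))
      has_vector_derivative second_derivative f x a b) (at 0 within {0..e})"
    by simp
  have "((\<lambda>t. ?D (x + t *\<^sub>R b) a - ?D x a) has_vector_derivative second_derivative f x a b)
      (at 0 within {0..e})"
    by (rule has_vector_derivative_transform[OF _ _ int]) (use e in \<open>auto simp: eq\<close>)
  moreover have "at 0 within {0..e} \<noteq> bot"
    using e by (simp add: at_within_Icc_at_right)
  ultimately show ?thesis
    using vector_derivative_unique_within by blast
qed

section \<open>Positive definite matrices\<close>

definition posdef :: "real^'n^'n \<Rightarrow> bool" where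
  "posdef A \<longleftrightarrow> transpose A = A \<and> (\<forall>v. v \<noteq> 0 \<longrightarrow> 0 < v \<bullet> (A *v v))"

lemma posdef_inner_swap: "posdef A \<Longrightarrow> u \<bullet> (A *v v) = v \<bullet> (A *v u)"
  by (metis dot_lmul_matrix inner_commute posdef_def transpose_matrix_vector)

lemma posdef_nonneg: "posdef A \<Longrightarrow> 0 \<le> v \<bullet> (A *v v)"
  by (cases "v = 0") (auto simp: posdef_def less_imp_le)

text \<open>The quadratic form is nonnegative at \<open>u - t v\<close>, where \<open>t\<close> is chosen to minimise it.\<close>

lemma posdef_Cauchy_Schwarz:
  assumes A: "posdef A"
  shows "\<bar>u \<bullet> (A *v v)\<bar> \<le> sqrt (u \<bullet> (A *v u)) * sqrt (v \<bullet> (A *v v))"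
proof (cases "v = 0")
  case False
  define a b c where "a = v \<bullet> (A *v v)" and "b = u \<bullet> (A *v v)" and "c = u \<bullet> (A *v u)"
  have a: "a > 0" using A False by (simp add: a_def posdef_def)
  define t where "t = b / a"
  have "0 \<le> (u - t *\<^sub>R v) \<bullet> (A *v (u - t *\<^sub>R v))"
    by (rule posdef_nonneg[OF A])
  also have "\<dots> = c - 2 * t * b + t * t * a"
    using posdef_inner_swap[OF A, of u v]
    by (simp add: a_def b_def c_def algebra_simps matrix_vector_mult_diff_distrib
        matrix_vector_mult_scaleR inner_diff_left inner_diff_right)
  also have "\<dots> = c - b\<^sup>2 / a"
    using a by (simp add: t_def field_simps power2_eq_square)
  finally have "b\<^sup>2 \<le> c * a"
    using a by (simp add: field_simps)
  then have "sqrt (b\<^sup>2) \<le> sqrt (c * a)"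
    by (rule real_sqrt_le_mono)
  then show ?thesis
    by (simp add: a_def b_def c_def real_sqrt_mult)
qed simp

lemma posdef_invertible:
  assumes A: "posdef A" shows "invertible A"
proof -
  have "v = 0" if "A *v v = 0" for v
    using A that by (force simp: posdef_def)
  then have "inj ((*v) A)"
    by (simp add: linear_injective_0)
  then show ?thesis
    by (simp add: matrix_left_invertible_injective invertible_left_inverse)
qed

text \<open>The determinant is positive at the identity, and it does not vanish on the segment from the
  identity to \<open>A\<close>, which consists of positive definite matrices.\<close>

lemma posdef_det_pos:
  fixes A :: "real^'n^'n"
  assumes A: "posdef A" shows "det A > 0"
proof (rule ccontr)
  assume neg: "\<not> det A > 0"
  define B where "B = (\<lambda>t::real. (1 - t) *\<^sub>R mat 1 + t *\<^sub>R A)"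
  have pd: "posdef (B t)" if t: "0 \<le> t" "t \<le> 1" for t
    unfolding posdef_def
  proof (intro conjI allI impI)
    have "A $ i $ j = A $ j $ i" for i j
    proof -
      have "transpose A $ i $ j = A $ i $ j" using A by (simp add: posdef_def)
      then show ?thesis by (simp add: transpose_def)
    qed
    then show "transpose (B t) = B t"
      by (simp add: B_def transpose_def vec_eq_iff mat_def)
    fix v :: "real^'n" assume v: "v \<noteq> 0"
    have "v \<bullet> (B t *v v) = (1 - t) * (v \<bullet> v) + t * (v \<bullet> (A *v v))"
      by (simp add: B_def matrix_vector_mult_add_rdistrib scaleR_matrix_vector_assoc[symmetric]
          inner_add_right)
    also have "\<dots> > 0"
    proof (cases "t = 1")
      case True then show ?thesis using A v by (simp add: posdef_def)
    next
      case False
      then have "(1 - t) * (v \<bullet> v) > 0" using t v by simp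
      moreover have "t * (v \<bullet> (A *v v)) \<ge> 0" using t posdef_nonneg[OF A] by simp
      ultimately show ?thesis by linarith
    qed
    finally show "0 < v \<bullet> (B t *v v)" .
  qed
  have "continuous_on {0..1} (\<lambda>t. det (B t))"
    unfolding det_def B_def by (intro continuous_intros)
  then have "\<exists>t\<ge>0. t \<le> 1 \<and> det (B t) = 0"
    using neg by (intro IVT2') (auto simp: B_def)
  then obtain t where "0 \<le> t" "t \<le> 1" "det (B t) = 0" by auto
  then show False
    using posdef_invertible[OF pd[of t]] by (simp add: invertible_det_nz)
qed

text \<open>The quadratic forms attain a positive minimum and a maximum on the product of \<open>K\<close> with the
  unit sphere; the general case follows by homogeneity.\<close>

lemma posdef_compact_bounds:
  fixes A :: "'b::topological_space \<Rightarrow> real^'n^'n"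
  assumes K: "compact K" and cont: "continuous_on K A" and A: "\<And>x. x \<in> K \<Longrightarrow> posdef (A x)"
  obtains l L where "0 < l" "0 < L"
    "\<And>x v. x \<in> K \<Longrightarrow> l * (norm v)\<^sup>2 \<le> v \<bullet> (A x *v v)"
    "\<And>x v. x \<in> K \<Longrightarrow> v \<bullet> (A x *v v) \<le> L * (norm v)\<^sup>2"
proof (cases "K = {}")
  case True then show ?thesis by (intro that[of 1 1]) auto
next
  case False
  define S where "S = K \<times> sphere (0::real^'n) 1"
  define q where "q = (\<lambda>p. snd p \<bullet> (A (fst p) *v snd p))"
  have "S \<noteq> {}" "compact S"
    using False K by (auto simp: S_def intro!: compact_Times)
  moreover have q: "continuous_on S q"
    unfolding q_def S_def
    by (intro continuous_intros continuous_on_compose2[OF cont]) auto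
  ultimately obtain p P where p: "p \<in> S" "\<And>y. y \<in> S \<Longrightarrow> q p \<le> q y" and P: "P \<in> S" "\<And>y. y \<in> S \<Longrightarrow> q y \<le> q P"
    using continuous_attains_inf[of S q] continuous_attains_sup[of S q] by metis
  have pos: "0 < q y" if "y \<in> S" for y
  proof -
    have "snd y \<noteq> 0" using that by (auto simp: S_def)
    then show ?thesis using that A[of "fst y"] by (auto simp: S_def q_def posdef_def)
  qed
  have scale: "v \<bullet> (A x *v v) = (norm v)\<^sup>2 * q (x, v /\<^sub>R norm v)" for x v
    by (cases "v = 0") (simp_all add: q_def matrix_vector_mult_scaleR power2_eq_square field_simps)
  have mem: "(x, v /\<^sub>R norm v) \<in> S" if "x \<in> K" "v \<noteq> 0" for x v
    using that by (simp add: S_def)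
  show ?thesis
  proof (rule that[of "q p" "q P"])
    fix x and v :: "real^'n" assume "x \<in> K"
    then show "q p * (norm v)\<^sup>2 \<le> v \<bullet> (A x *v v)"
      using mem[of x v] p scale[of v x] by (cases "v = 0") (auto intro!: mult_left_mono simp: mult.commute)
  next
    fix x and v :: "real^'n" assume "x \<in> K"
    then show "v \<bullet> (A x *v v) \<le> q P * (norm v)\<^sup>2"
      using mem[of x v] P scale[of v x] by (cases "v = 0") (auto intro!: mult_left_mono simp: mult.commute)
  qed (use pos p P in auto)
qed

lemma posdef_quadratic_derivative:
  assumes G: "posdef G" and w: "(X has_vector_derivative w) (at t within T)"
  shows "((\<lambda>s. X s \<bullet> (G *v X s)) has_real_derivative 2 * (X t \<bullet> (G *v w))) (at t within T)"
proof -
  note w' = w[unfolded has_vector_derivative_def]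
  have "((\<lambda>s. X s \<bullet> (G *v X s)) has_derivative
      (\<lambda>h. X t \<bullet> (G *v (h *\<^sub>R w)) + (h *\<^sub>R w) \<bullet> (G *v X t))) (at t within T)"
    by (rule has_derivative_inner[OF w' bounded_linear.has_derivative[OF matrix_vector_mul_bounded_linear w']])
  moreover have "(\<lambda>h. X t \<bullet> (G *v (h *\<^sub>R w)) + (h *\<^sub>R w) \<bullet> (G *v X t)) = (*) (2 * (X t \<bullet> (G *v w)))"
    using posdef_inner_swap[OF G, of w "X t"] by (auto simp: fun_eq_iff matrix_vector_mult_scaleR)
  ultimately show ?thesis by (simp add: has_field_derivative_def)
qed

lemma matrix_inv_right:
  fixes A :: "real^'m^'m"
  assumes "invertible A" shows "A ** matrix_inv A = mat 1"
proof -
  obtain B where "A ** B = mat 1 \<and> B ** A = mat 1"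
    using assms by (auto simp: invertible_def)
  then have "A ** matrix_inv A = mat 1 \<and> matrix_inv A ** A = mat 1"
    unfolding matrix_inv_def by (rule someI)
  then show ?thesis ..
qed

section \<open>Charts, curves and their lengths\<close>

locale riemannian =
  fixes M :: "('a::{t2_space,second_countable_topology}, 'n::finite) riem"
  assumes manifold: "riemannian_manifold M"
begin

lemma is_chart: "c \<in> atlas M \<Longrightarrow> is_chart c"
  using manifold unfolding riemannian_manifold_def by blast

lemma chart_open: "c \<in> atlas M \<Longrightarrow> open (cdom c)"
  using is_chart[of c] by (simp add: is_chart_def)

lemma chart_image_open: "c \<in> atlas M \<Longrightarrow> open (cimg c)"
  using is_chart[of c] by (simp add: is_chart_def)

lemma chart_homeomorphism: "c \<in> atlas M \<Longrightarrow> homeomorphism (cdom c) (cimg c) (cmap c) (cinv c)"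
  using is_chart[of c] by (simp add: is_chart_def)

lemma chart_at: "chart_at M p \<in> atlas M" "p \<in> cdom (chart_at M p)"
proof -
  have "p \<in> (\<Union>c\<in>atlas M. cdom c)"
    using manifold unfolding riemannian_manifold_def by blast
  then have "\<exists>c. c \<in> atlas M \<and> p \<in> cdom c"
    by blast
  from someI_ex[OF this] show "chart_at M p \<in> atlas M" "p \<in> cdom (chart_at M p)"
    unfolding chart_at_def by blast+
qed

lemma cinv_cmap [simp]: "c \<in> atlas M \<Longrightarrow> p \<in> cdom c \<Longrightarrow> cinv c (cmap c p) = p"
  using chart_homeomorphism[of c] by (simp add: homeomorphism_def)

lemma cmap_cinv [simp]: "c \<in> atlas M \<Longrightarrow> x \<in> cimg c \<Longrightarrow> cmap c (cinv c x) = x"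
  using chart_homeomorphism[of c] by (simp add: homeomorphism_def)

lemma cinv_in_cdom: "c \<in> atlas M \<Longrightarrow> x \<in> cimg c \<Longrightarrow> cinv c x \<in> cdom c"
  using chart_homeomorphism[of c] by (auto simp: homeomorphism_def)

lemma cmap_in_cimg: "p \<in> cdom c \<Longrightarrow> cmap c p \<in> cimg c"
  by (auto simp: cimg_def)

lemma continuous_on_cmap: "c \<in> atlas M \<Longrightarrow> continuous_on (cdom c) (cmap c)"
  using chart_homeomorphism[of c] by (simp add: homeomorphism_def)

lemma continuous_on_cinv: "c \<in> atlas M \<Longrightarrow> continuous_on (cimg c) (cinv c)"
  using chart_homeomorphism[of c] by (simp add: homeomorphism_def)

lemma open_cmap_image:
  assumes c: "c \<in> atlas M" and U: "open U" "U \<subseteq> cdom c"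
  shows "open (cmap c ` U)"
proof -
  have "cmap c ` U = cinv c -` U \<inter> cimg c"
  proof (intro equalityI subsetI)
    fix x assume "x \<in> cmap c ` U" then show "x \<in> cinv c -` U \<inter> cimg c"
      using c U by (auto simp: subset_iff intro: cmap_in_cimg)
  next
    fix x assume "x \<in> cinv c -` U \<inter> cimg c"
    then show "x \<in> cmap c ` U" using cmap_cinv[OF c, of x] by (metis IntE image_eqI vimageE)
  qed
  then show ?thesis
    using continuous_on_cinv[OF c] chart_image_open[OF c] U continuous_on_open_vimage by metis
qed

lemma open_cinv_image:
  assumes c: "c \<in> atlas M" and U: "open U" "U \<subseteq> cimg c"
  shows "open (cinv c ` U)"
proof -
  have "cinv c ` U = cmap c -` U \<inter> cdom c"
  proof (intro equalityI subsetI)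
    fix p assume "p \<in> cinv c ` U" then show "p \<in> cmap c -` U \<inter> cdom c"
      using c U by (auto simp: subset_iff intro: cinv_in_cdom)
  next
    fix p assume "p \<in> cmap c -` U \<inter> cdom c"
    then show "p \<in> cinv c ` U" using cinv_cmap[OF c, of p] by (metis IntE image_eqI vimageE)
  qed
  then show ?thesis
    using continuous_on_cmap[OF c] chart_open[OF c] U continuous_on_open_vimage by metis
qed

lemma Ck_on_transition:
  "c \<in> atlas M \<Longrightarrow> d \<in> atlas M \<Longrightarrow>
     Ck_on k (cmap c ` (cdom c \<inter> cdom d)) (\<lambda>x. cmap d (cinv c x))"
  using manifold unfolding riemannian_manifold_def smooth_on_def by blast

lemma Ck_on_gmat: "c \<in> atlas M \<Longrightarrow> Ck_on k (cimg c) (gmat M c)"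
  using manifold unfolding riemannian_manifold_def smooth_on_def by blast

lemma continuous_on_gmat: "c \<in> atlas M \<Longrightarrow> continuous_on (cimg c) (gmat M c)"
  using Ck_on_gmat[of c 0] by simp

lemma posdef_gmat: "c \<in> atlas M \<Longrightarrow> x \<in> cimg c \<Longrightarrow> posdef (gmat M c x)"
  using manifold unfolding riemannian_manifold_def posdef_def by blast

lemma gnorm_nonneg: "c \<in> atlas M \<Longrightarrow> x \<in> cimg c \<Longrightarrow> 0 \<le> gnorm M c x v"
  by (auto simp: gnorm_def intro: posdef_nonneg posdef_gmat)

lemma gmat_transition:
  assumes "c \<in> atlas M" "d \<in> atlas M" "p \<in> cdom c" "p \<in> cdom d"
  shows "u \<bullet> (gmat M c (cmap c p) *v v) =
    frechet_derivative (\<lambda>y. cmap d (cinv c y)) (at (cmap c p)) u \<bullet>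
      (gmat M d (cmap d p) *v frechet_derivative (\<lambda>y. cmap d (cinv c y)) (at (cmap c p)) v)"
proof -
  have "cmap c p \<in> cmap c ` (cdom c \<inter> cdom d)"
    using assms by auto
  moreover have *: "\<forall>c\<in>atlas M. \<forall>d\<in>atlas M. \<forall>x \<in> cmap c ` (cdom c \<inter> cdom d). \<forall>u v.
        let \<tau> = (\<lambda>y. cmap d (cinv c y)); D = frechet_derivative \<tau> (at x)
        in u \<bullet> (gmat M c x *v v) = D u \<bullet> (gmat M d (\<tau> x) *v D v)"
    using manifold unfolding riemannian_manifold_def by blast
  ultimately show ?thesis
    using *[unfolded Let_def, rule_format, OF assms(1,2), of "cmap c p" u v] assms by simp
qed

lemma gnorm_scaleR: "gnorm M c x (m *\<^sub>R v) = \<bar>m\<bar> * gnorm M c x v"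
proof -
  have "(m *\<^sub>R v) \<bullet> (gmat M c x *v (m *\<^sub>R v)) = m\<^sup>2 * (v \<bullet> (gmat M c x *v v))"
    by (simp add: matrix_vector_mult_scaleR power2_eq_square)
  then show ?thesis
    by (simp add: gnorm_def real_sqrt_mult)
qed

lemma eventually_in_chart:
  assumes "c \<in> atlas M" "continuous (at t within T) \<gamma>" "\<gamma> t \<in> cdom c"
  shows "\<forall>\<^sub>F s in at t within T. \<gamma> s \<in> cdom c"
  using assms topological_tendstoD[OF _ chart_open, of \<gamma> "\<gamma> t" "at t within T" c]
  by (auto simp: continuous_within)

text \<open>Chain rule for the transition map. The curve has to be continuous as a map to the manifold:
  only then does it stay in the domain of the first chart for a short time.\<close>

lemma velocity_change_chart:
  assumes c: "c \<in> atlas M" and d: "d \<in> atlas M" and \<gamma>: "\<gamma> t \<in> cdom c" "\<gamma> t \<in> cdom d"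
    "continuous (at t within T) \<gamma>" "t \<in> T"
    and v: "((\<lambda>s. cmap c (\<gamma> s)) has_vector_derivative v) (at t within T)"
  shows "((\<lambda>s. cmap d (\<gamma> s)) has_vector_derivative
    frechet_derivative (\<lambda>y. cmap d (cinv c y)) (at (cmap c (\<gamma> t))) v) (at t within T)"
proof -
  let ?\<tau> = "\<lambda>y. cmap d (cinv c y)"
  have "cmap c (\<gamma> t) \<in> cmap c ` (cdom c \<inter> cdom d)" using \<gamma> by auto
  from Ck_on_has_derivative[OF Ck_on_transition[OF c d] this]
  have \<tau>: "(?\<tau> has_derivative frechet_derivative ?\<tau> (at (cmap c (\<gamma> t)))) (at (cmap c (\<gamma> t)))" .
  from has_derivative_compose[OF v[unfolded has_vector_derivative_def] \<tau>]
  have "((\<lambda>s. ?\<tau> (cmap c (\<gamma> s))) has_vector_derivative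
    frechet_derivative ?\<tau> (at (cmap c (\<gamma> t))) v) (at t within T)"
    by (simp add: has_vector_derivative_def linear_scale[OF has_derivative_linear[OF \<tau>]])
  moreover have "\<forall>\<^sub>F s in at t within T. ?\<tau> (cmap c (\<gamma> s)) = cmap d (\<gamma> s)"
    using eventually_in_chart[OF c \<gamma>(3,1)] by eventually_elim (simp add: c)
  ultimately show ?thesis
    unfolding has_vector_derivative_def
    by (rule has_derivative_transform_eventually) (use \<gamma> c in auto)
qed

text \<open>The points at which the speed of a curve is given by a derivative. A piecewise \<open>C\<^sup>1\<close> curve has
  only finitely many other points, which are negligible for its length.\<close>

definition regular_at :: "(real \<Rightarrow> 'a) \<Rightarrow> real \<Rightarrow> bool" where
  "regular_at \<gamma> t \<longleftrightarrow> isCont \<gamma> t \<and> (\<forall>c\<in>atlas M. \<gamma> t \<in> cdom c \<longrightarrow>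
     (\<exists>v. ((\<lambda>s. cmap c (\<gamma> s)) has_vector_derivative v) (at t)))"

lemma regular_atI:
  assumes "c \<in> atlas M" "\<gamma> t \<in> cdom c" "isCont \<gamma> t"
    "((\<lambda>s. cmap c (\<gamma> s)) has_vector_derivative v) (at t)"
  shows "regular_at \<gamma> t"
  using velocity_change_chart[of c _ \<gamma> t UNIV v] assms by (auto simp: regular_at_def)

lemma speed_eq:
  assumes c: "c \<in> atlas M" "\<gamma> t \<in> cdom c" and cont: "isCont \<gamma> t"
    and v: "((\<lambda>s. cmap c (\<gamma> s)) has_vector_derivative v) (at t)"
  shows "speed M \<gamma> t = gnorm M c (cmap c (\<gamma> t)) v"
proof -
  define d where "d = chart_at M (\<gamma> t)"
  have d: "d \<in> atlas M" "\<gamma> t \<in> cdom d" by (auto simp: d_def chart_at)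
  from velocity_change_chart[OF c(1) d(1) c(2) d(2) cont UNIV_I v]
  have "vector_derivative (\<lambda>s. cmap d (\<gamma> s)) (at t) =
      frechet_derivative (\<lambda>y. cmap d (cinv c y)) (at (cmap c (\<gamma> t))) v"
    by (rule vector_derivative_at)
  then show ?thesis
    using gmat_transition[OF c(1) d(1) c(2) d(2), of v v]
    by (simp add: speed_def gnorm_def Let_def flip: d_def)
qed

lemma speed_nonneg: "0 \<le> speed M \<gamma> t"
  by (simp add: speed_def Let_def gnorm_nonneg chart_at cmap_in_cimg)

lemma speed_affine:
  assumes reg: "regular_at \<gamma> (m * t + q)"
    and eq: "\<forall>\<^sub>F s in nhds t. \<eta> s = \<gamma> (m * s + q)"
  shows "regular_at \<eta> t" "speed M \<eta> t = \<bar>m\<bar> * speed M \<gamma> (m * t + q)"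
proof -
  define c where "c = chart_at M (\<eta> t)"
  have [simp]: "\<eta> t = \<gamma> (m * t + q)" using eventually_nhds_x_imp_x[OF eq] .
  have c: "c \<in> atlas M" "\<eta> t \<in> cdom c" by (auto simp: c_def chart_at simp del: \<open>\<eta> t = _\<close>)
  then obtain v where v: "((\<lambda>s. cmap c (\<gamma> s)) has_vector_derivative v) (at (m * t + q))"
    using reg by (auto simp: regular_at_def)
  have cont: "isCont \<gamma> (m * t + q)" using reg by (simp add: regular_at_def)
  have "isCont (\<lambda>s. \<gamma> (m * s + q)) t"
    by (rule continuous_at_compose[of t "\<lambda>s. m * s + q" \<gamma>, unfolded o_def])
      (auto intro!: continuous_intros cont)
  then have cont': "isCont \<eta> t"
    using isCont_cong[OF eq] by simp
  have "((\<lambda>s. m * s + q) has_vector_derivative m) (at t)"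
    by (auto intro!: derivative_eq_intros)
  from vector_diff_chain_at[OF this v]
  have "((\<lambda>s. cmap c (\<gamma> (m * s + q))) has_vector_derivative m *\<^sub>R v) (at t)"
    by (simp add: o_def)
  moreover have "\<forall>\<^sub>F s in nhds t. s \<in> UNIV \<longrightarrow> cmap c (\<eta> s) = cmap c (\<gamma> (m * s + q))"
    using eq by eventually_elim simp
  ultimately have v': "((\<lambda>s. cmap c (\<eta> s)) has_vector_derivative m *\<^sub>R v) (at t)"
    by (subst has_vector_derivative_cong_ev) auto
  show "regular_at \<eta> t"
    using regular_atI[OF c cont' v'] .
  show "speed M \<eta> t = \<bar>m\<bar> * speed M \<gamma> (m * t + q)"
    using speed_eq[OF c cont' v'] speed_eq[OF c[simplified] cont v]
    by (simp add: gnorm_scaleR)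
qed

lemma piecewise_C1_regular:
  assumes "piecewise_C1_curve M \<gamma>"
  obtains S where "finite S" "\<And>t. 0 < t \<Longrightarrow> t < 1 \<Longrightarrow> t \<notin> S \<Longrightarrow> regular_at \<gamma> t"
proof -
  obtain S where S: "finite S"
    "\<And>a b. 0 \<le> a \<Longrightarrow> a < b \<Longrightarrow> b \<le> 1 \<Longrightarrow> {a<..<b} \<inter> S = {} \<Longrightarrow> C1_curve_on M {a..b} \<gamma>"
    using assms by (auto simp: piecewise_C1_curve_def)
  show ?thesis
  proof (rule that[OF S(1)])
    fix t :: real assume t: "0 < t" "t < 1" "t \<notin> S"
    have "open ({0<..<1} - S)" using S(1) by (intro open_Diff finite_imp_closed) auto
    then obtain e where e: "e > 0" "cball t e \<subseteq> {0<..<1} - S"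
      using t unfolding open_contains_cball by (metis DiffI greaterThanLessThan_iff)
    have sub: "{t - e..t + e} \<subseteq> {0<..<1} - S" using e by (simp add: cball_eq_atLeastAtMost)
    have C1: "C1_curve_on M {t-e..t+e} \<gamma>"
    proof (rule S(2))
      have "t - e \<in> {0<..<1} - S" "t + e \<in> {0<..<1} - S" by (rule subsetD[OF sub], use e in simp)+
      then show "0 \<le> t - e" "t + e \<le> 1" by auto
      have "{t - e<..<t + e} \<subseteq> {t - e..t + e}" by auto
      then show "{t - e<..<t + e} \<inter> S = {}" using sub by blast
    qed (use e in auto)
    have int: "t \<in> interior {t-e..t+e}" using e by simp
    have "isCont \<gamma> t"
      using C1 int by (auto simp: C1_curve_on_def intro: continuous_on_interior)
    moreover have "\<exists>v. ((\<lambda>s. cmap c (\<gamma> s)) has_vector_derivative v) (at t)"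
      if ct: "c \<in> atlas M" "\<gamma> t \<in> cdom c" for c
    proof -
      have "t \<in> {t-e..t+e}" using e by simp
      then obtain v where "((\<lambda>s. cmap c (\<gamma> s)) has_vector_derivative v) (at t within {t-e..t+e})"
        using C1 ct unfolding C1_curve_on_def by blast
      then show ?thesis using at_within_interior[OF int] by metis
    qed
    ultimately show "regular_at \<gamma> t" by (simp add: regular_at_def)
  qed
qed

lemma speed_integrable_in_chart:
  assumes C1: "C1_curve_on M {a..b} \<gamma>" and c: "c \<in> atlas M" "\<gamma> ` {a..b} \<subseteq> cdom c"
  shows "speed M \<gamma> integrable_on {a..b}"
proof -
  obtain v where v: "continuous_on {t\<in>{a..b}. \<gamma> t \<in> cdom c} v"
    "\<And>t. t \<in> {a..b} \<Longrightarrow> \<gamma> t \<in> cdom c \<Longrightarrow>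
      ((\<lambda>s. cmap c (\<gamma> s)) has_vector_derivative v t) (at t within {a..b})"
    using C1 c unfolding C1_curve_on_def by blast
  have eq: "{t\<in>{a..b}. \<gamma> t \<in> cdom c} = {a..b}" using c by auto
  have cont: "continuous_on {a..b} \<gamma>" using C1 by (simp add: C1_curve_on_def)
  have "continuous_on {a..b} (\<lambda>t. cmap c (\<gamma> t))"
    by (rule continuous_on_compose2[OF continuous_on_cmap[OF c(1)] cont c(2)])
  moreover from this have "continuous_on {a..b} (\<lambda>t. gmat M c (cmap c (\<gamma> t)))"
    using c by (intro continuous_on_compose2[OF continuous_on_gmat[OF c(1)]]) (auto intro!: cmap_in_cimg)
  ultimately have "continuous_on {a..b} (\<lambda>t. gnorm M c (cmap c (\<gamma> t)) (v t))"
    unfolding gnorm_def using v(1)[unfolded eq] by (intro continuous_intros)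
  then have "(\<lambda>t. gnorm M c (cmap c (\<gamma> t)) (v t)) integrable_on {a..b}"
    by (rule integrable_continuous_real)
  moreover have "speed M \<gamma> t = gnorm M c (cmap c (\<gamma> t)) (v t)" if "t \<in> {a..b} - {a, b}" for t
  proof (rule speed_eq)
    have int: "t \<in> interior {a..b}" using that by auto
    then show "isCont \<gamma> t" using cont continuous_on_interior by blast
    show "((\<lambda>s. cmap c (\<gamma> s)) has_vector_derivative v t) (at t)"
      using v(2)[of t] that c(2) at_within_interior[OF int] by (simp add: image_subset_iff)
  qed (use c that in auto)
  ultimately show ?thesis
    by (intro integrable_spike_finite[of "{a,b}" _ "speed M \<gamma>"]) auto
qed

text \<open>Integrability is local, so it suffices to look at short intervals around a point \<open>t\<close>. Such an
  interval is mapped into one chart and contains no break point except possibly \<open>t\<close>; to the left and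
  to the right of \<open>t\<close> the speed extends continuously to the closed interval.\<close>

lemma speed_integrable:
  assumes \<gamma>: "piecewise_C1_curve M \<gamma>"
  shows "speed M \<gamma> integrable_on {0..1}"
  unfolding cbox_interval[symmetric]
proof (rule integrable_on_little_subintervals, intro ballI)
  fix t :: real assume t: "t \<in> cbox 0 1"
  obtain S where S: "finite S"
    "\<And>a b. 0 \<le> a \<Longrightarrow> a < b \<Longrightarrow> b \<le> 1 \<Longrightarrow> {a<..<b} \<inter> S = {} \<Longrightarrow> C1_curve_on M {a..b} \<gamma>"
    using \<gamma> by (auto simp: piecewise_C1_curve_def)
  define c where "c = chart_at M (\<gamma> t)"
  have c: "c \<in> atlas M" "\<gamma> t \<in> cdom c" by (auto simp: c_def chart_at)
  have "continuous (at t within {0..1}) \<gamma>"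
    using \<gamma> t by (auto simp: piecewise_C1_curve_def continuous_on_eq_continuous_within)
  from eventually_in_chart[OF c(1) this c(2)]
  obtain d where d: "d > 0" "\<And>s. s \<in> {0..1} \<Longrightarrow> dist s t < d \<Longrightarrow> \<gamma> s \<in> cdom c"
    using c(2) unfolding eventually_at by (metis dist_self)
  have "open (- (S - {t}))" using S(1) by (intro open_Compl finite_imp_closed) auto
  then obtain e where e: "e > 0" "ball t e \<subseteq> - (S - {t})"
    using openE by blast
  show "\<exists>d>0. \<forall>u v. t \<in> cbox u v \<and> cbox u v \<subseteq> ball t d \<and> cbox u v \<subseteq> cbox 0 1 \<longrightarrow>
            speed M \<gamma> integrable_on cbox u v"
  proof (intro exI conjI allI impI)
    show "min d e > 0" using d e by simp
    fix u v assume uv: "t \<in> cbox u v \<and> cbox u v \<subseteq> ball t (min d e) \<and> cbox u v \<subseteq> cbox 0 1"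
    then have le: "u \<le> t" "t \<le> v" and sub: "{u..v} \<subseteq> ball t (min d e)" "{u..v} \<subseteq> {0..1}" by auto
    have *: "speed M \<gamma> integrable_on {a..b}" if ab: "u \<le> a" "b \<le> v" "t \<notin> {a<..<b}" for a b
    proof (cases "a < b")
      case True
      have ab': "{a..b} \<subseteq> {u..v}" using ab by auto
      have "C1_curve_on M {a..b} \<gamma>"
      proof (rule S(2))
        have "a \<in> {0..1}" "b \<in> {0..1}" using True ab ab' sub by (meson atLeastAtMost_iff less_imp_le order_refl subsetD)+
        then show "0 \<le> a" "b \<le> 1" by auto
        have "{a<..<b} \<subseteq> {a..b}" by auto
        then have "{a<..<b} \<subseteq> ball t e" using ab' sub(1) subset_ball[of "min d e" e t]
          by (meson min.cobounded2 order_trans)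
        then show "{a<..<b} \<inter> S = {}" using e ab by blast
      qed fact
      moreover have "\<gamma> ` {a..b} \<subseteq> cdom c"
      proof safe
        fix s assume "s \<in> {a..b}"
        then have "s \<in> ball t (min d e)" "s \<in> {0..1}" using ab' sub by blast+
        then show "\<gamma> s \<in> cdom c" by (intro d(2)) (auto simp: dist_commute)
      qed
      ultimately show ?thesis using speed_integrable_in_chart c by blast
    next
      case False
      then consider "a = b" | "{a..b} = {}" by force
      then show ?thesis using integrable_on_refl[of "speed M \<gamma>" a] by cases auto
    qed
    have "speed M \<gamma> integrable_on {u..t}" "speed M \<gamma> integrable_on {t..v}"
      using le by (auto intro!: *)
    then show "speed M \<gamma> integrable_on cbox u v"
      using Henstock_Kurzweil_Integration.integrable_combine[OF le] by simp
  qed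
qed

subsection \<open>Reversing and joining curves\<close>

lemma C1_curve_on_affine:
  assumes C1: "C1_curve_on M I \<gamma>" and m: "m \<noteq> 0"
    and eq: "\<And>s. s \<in> J \<Longrightarrow> m * s + q \<in> I \<and> \<eta> s = \<gamma> (m * s + q)"
  shows "C1_curve_on M J \<eta>"
proof -
  let ?\<phi> = "\<lambda>s. m * s + q"
  have \<phi>: "continuous_on A ?\<phi>" for A by (intro continuous_intros)
  have img: "?\<phi> ` J \<subseteq> I" using eq by auto
  have "continuous_on J (\<lambda>s. \<gamma> (?\<phi> s))"
    using C1 by (intro continuous_on_compose2[OF _ \<phi> img]) (simp add: C1_curve_on_def)
  then have cont: "continuous_on J \<eta>" using eq by (simp cong: continuous_on_cong)
  have "\<exists>v. continuous_on {t\<in>J. \<eta> t \<in> cdom c} v \<and>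
        (\<forall>t\<in>J. \<eta> t \<in> cdom c \<longrightarrow>
           ((\<lambda>s. cmap c (\<eta> s)) has_vector_derivative v t) (at t within J))" if c: "c \<in> atlas M" for c
  proof -
    obtain v where v: "continuous_on {t\<in>I. \<gamma> t \<in> cdom c} v"
      "\<And>t. t \<in> I \<Longrightarrow> \<gamma> t \<in> cdom c \<Longrightarrow>
        ((\<lambda>s. cmap c (\<gamma> s)) has_vector_derivative v t) (at t within I)"
      using C1 c unfolding C1_curve_on_def by blast
    show ?thesis
    proof (intro exI[of _ "\<lambda>t. m *\<^sub>R v (?\<phi> t)"] conjI ballI impI)
      show "continuous_on {t\<in>J. \<eta> t \<in> cdom c} (\<lambda>t. m *\<^sub>R v (?\<phi> t))"
        using eq by (intro continuous_intros continuous_on_compose2[OF v(1) \<phi>]) auto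
    next
      fix t assume t: "t \<in> J" "\<eta> t \<in> cdom c"
      have 1: "(?\<phi> has_vector_derivative m) (at t within J)"
        by (auto intro!: derivative_eq_intros)
      have 2: "((\<lambda>s. cmap c (\<gamma> s)) has_vector_derivative v (?\<phi> t)) (at (?\<phi> t) within ?\<phi> ` J)"
        by (rule has_vector_derivative_within_subset[OF v(2) img]) (use eq t in auto)
      from vector_diff_chain_within[OF 1 2]
      have 3: "((\<lambda>s. cmap c (\<gamma> (?\<phi> s))) has_vector_derivative m *\<^sub>R v (?\<phi> t)) (at t within J)"
        by (simp add: o_def)
      show "((\<lambda>s. cmap c (\<eta> s)) has_vector_derivative m *\<^sub>R v (?\<phi> t)) (at t within J)"
        by (rule has_vector_derivative_transform[OF t(1) _ 3]) (use eq in auto)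
    qed
  qed
  with cont show ?thesis by (simp add: C1_curve_on_def)
qed

lemma piecewise_C1_reversepath:
  assumes \<gamma>: "piecewise_C1_curve M \<gamma>"
  shows "piecewise_C1_curve M (reversepath \<gamma>)"
    and "curve_length M (reversepath \<gamma>) = curve_length M \<gamma>"
proof -
  obtain S where S: "finite S"
    "\<And>a b. 0 \<le> a \<Longrightarrow> a < b \<Longrightarrow> b \<le> 1 \<Longrightarrow> {a<..<b} \<inter> S = {} \<Longrightarrow> C1_curve_on M {a..b} \<gamma>"
    using \<gamma> by (auto simp: piecewise_C1_curve_def)
  have r: "reversepath \<gamma> s = \<gamma> ((-1) * s + 1)" for s by (simp add: reversepath_def)
  show "piecewise_C1_curve M (reversepath \<gamma>)"
    unfolding piecewise_C1_curve_def
  proof (intro conjI exI[of _ "(\<lambda>s. 1 - s) ` S"] allI impI)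
    have "path \<gamma>" using \<gamma> by (simp add: piecewise_C1_curve_def path_def)
    then show "continuous_on {0..1} (reversepath \<gamma>)" by (simp add: path_def[symmetric])
    show "finite ((\<lambda>s. 1 - s) ` S)" using S by simp
    fix a b :: real assume ab: "0 \<le> a \<and> a < b \<and> b \<le> 1 \<and> {a<..<b} \<inter> (\<lambda>s. 1 - s) ` S = {}"
    have "C1_curve_on M {1-b..1-a} \<gamma>"
    proof (rule S(2))
      show "{1 - b<..<1 - a} \<inter> S = {}"
      proof (rule ccontr)
        assume "{1 - b<..<1 - a} \<inter> S \<noteq> {}"
        then obtain s where "s \<in> S" "1 - b < s" "s < 1 - a" by auto
        then have "1 - s \<in> {a<..<b} \<inter> (\<lambda>s. 1 - s) ` S" by auto
        then show False using ab by auto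
      qed
    qed (use ab in auto)
    then show "C1_curve_on M {a..b} (reversepath \<gamma>)"
      by (rule C1_curve_on_affine[where m="-1" and q=1]) (auto simp: reversepath_def)
  qed
  obtain N where N: "finite N" "\<And>t. 0 < t \<Longrightarrow> t < 1 \<Longrightarrow> t \<notin> N \<Longrightarrow> regular_at \<gamma> t"
    by (rule piecewise_C1_regular[OF \<gamma>]) blast
  have "(speed M \<gamma> has_integral curve_length M \<gamma>) (cbox 0 1)"
    using speed_integrable[OF \<gamma>] by (simp add: curve_length_def integrable_integral)
  from has_integral_affinity[OF this, of "-1" 1]
  have "((\<lambda>s. speed M \<gamma> (1 - s)) has_integral curve_length M \<gamma>) {0..1}"
    by (simp add: image_def) (smt (verit) Collect_cong atLeastAtMost_iff Collect_mem_eq has_integral_cong)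
  then have "(speed M (reversepath \<gamma>) has_integral curve_length M \<gamma>) {0..1}"
  proof (rule has_integral_spike_finite[rotated 2])
    show "finite ({0,1} \<union> (\<lambda>s. 1 - s) ` N)" using N by simp
    fix t assume t: "t \<in> {0..1} - ({0,1} \<union> (\<lambda>s. 1 - s) ` N)"
    have "regular_at \<gamma> ((-1) * t + 1)"
    proof (rule N)
      show "-1 * t + 1 \<notin> N" using t by (force simp: image_iff)
    qed (use t in auto)
    from speed_affine(2)[OF this, of "reversepath \<gamma>"]
    show "speed M (reversepath \<gamma>) t = speed M \<gamma> (1 - t)" by (simp add: r)
  qed
  then show "curve_length M (reversepath \<gamma>) = curve_length M \<gamma>"
    by (simp add: curve_length_def integral_unique)
qed

lemma piecewise_C1_joinpaths:
  assumes \<gamma>: "piecewise_C1_curve M \<gamma>" and \<eta>: "piecewise_C1_curve M \<eta>" and ends: "\<gamma> 1 = \<eta> 0"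
  shows "piecewise_C1_curve M (\<gamma> +++ \<eta>)"
    and "curve_length M (\<gamma> +++ \<eta>) = curve_length M \<gamma> + curve_length M \<eta>"
proof -
  obtain S where S: "finite S"
    "\<And>a b. 0 \<le> a \<Longrightarrow> a < b \<Longrightarrow> b \<le> 1 \<Longrightarrow> {a<..<b} \<inter> S = {} \<Longrightarrow> C1_curve_on M {a..b} \<gamma>"
    using \<gamma> by (auto simp: piecewise_C1_curve_def)
  obtain T where T: "finite T"
    "\<And>a b. 0 \<le> a \<Longrightarrow> a < b \<Longrightarrow> b \<le> 1 \<Longrightarrow> {a<..<b} \<inter> T = {} \<Longrightarrow> C1_curve_on M {a..b} \<eta>"
    using \<eta> by (auto simp: piecewise_C1_curve_def)
  define N where "N = (\<lambda>s. s / 2) ` S \<union> (\<lambda>s. (s + 1) / 2) ` T \<union> {1/2}"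
  show "piecewise_C1_curve M (\<gamma> +++ \<eta>)"
    unfolding piecewise_C1_curve_def
  proof (intro conjI exI[of _ N] allI impI)
    have "path (\<gamma> +++ \<eta>)"
      using \<gamma> \<eta> ends by (intro path_join_imp) (auto simp: piecewise_C1_curve_def path_def pathfinish_def pathstart_def)
    then show "continuous_on {0..1} (\<gamma> +++ \<eta>)" by (simp add: path_def)
    show "finite N" using S T by (simp add: N_def)
    fix a b :: real assume ab: "0 \<le> a \<and> a < b \<and> b \<le> 1 \<and> {a<..<b} \<inter> N = {}"
    then have "1/2 \<notin> {a<..<b}" by (auto simp: N_def)
    then consider "b \<le> 1/2" | "1/2 \<le> a" by force
    then show "C1_curve_on M {a..b} (\<gamma> +++ \<eta>)"
    proof cases
      case 1
      have "C1_curve_on M {2*a..2*b} \<gamma>"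
      proof (rule S(2))
        show "{2*a<..<2*b} \<inter> S = {}"
        proof (rule ccontr)
          assume "{2*a<..<2*b} \<inter> S \<noteq> {}"
          then obtain s where "s \<in> S" "2*a < s" "s < 2*b" by auto
          then have "s / 2 \<in> {a<..<b} \<inter> N" by (auto simp: N_def)
          then show False using ab by auto
        qed
      qed (use ab 1 in auto)
      then show ?thesis
        by (rule C1_curve_on_affine[where m=2 and q=0]) (use 1 in \<open>auto simp: joinpaths_def\<close>)
    next
      case 2
      have "C1_curve_on M {2*a-1..2*b-1} \<eta>"
      proof (rule T(2))
        show "{2*a-1<..<2*b-1} \<inter> T = {}"
        proof (rule ccontr)
          assume "{2*a-1<..<2*b-1} \<inter> T \<noteq> {}"
          then obtain s where "s \<in> T" "2*a-1 < s" "s < 2*b-1" by auto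
          then have "(s + 1) / 2 \<in> {a<..<b} \<inter> N" by (auto simp: N_def)
          then show False using ab by auto
        qed
      qed (use ab 2 in auto)
      then show ?thesis
      proof (rule C1_curve_on_affine[where m=2 and q="-1"])
        fix s assume s: "s \<in> {a..b}"
        have "(\<gamma> +++ \<eta>) (1/2) = \<eta> (2 * (1/2) + - 1)"
          using ends by (simp add: joinpaths_def)
        moreover have "s = 1/2" if "s \<le> 1/2"
          using that s 2 by auto
        moreover have "(\<gamma> +++ \<eta>) s = \<eta> (2 * s + - 1)" if "\<not> s \<le> 1/2"
          using that by (simp add: joinpaths_def)
        ultimately have "(\<gamma> +++ \<eta>) s = \<eta> (2 * s + - 1)"
          by metis
        with s show "2 * s + -1 \<in> {2 * a - 1..2 * b - 1} \<and> (\<gamma> +++ \<eta>) s = \<eta> (2 * s + - 1)"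
          by auto
      qed simp
    qed
  qed
  obtain S' where S': "finite S'" "\<And>t. 0 < t \<Longrightarrow> t < 1 \<Longrightarrow> t \<notin> S' \<Longrightarrow> regular_at \<gamma> t"
    by (rule piecewise_C1_regular[OF \<gamma>]) blast
  obtain T' where T': "finite T'" "\<And>t. 0 < t \<Longrightarrow> t < 1 \<Longrightarrow> t \<notin> T' \<Longrightarrow> regular_at \<eta> t"
    by (rule piecewise_C1_regular[OF \<eta>]) blast
  have "((\<lambda>s. 2 * speed M \<gamma> (2 * s)) has_integral curve_length M \<gamma>) {0..1/2}"
  proof -
    have "(speed M \<gamma> has_integral curve_length M \<gamma>) (cbox 0 1)"
      using speed_integrable[OF \<gamma>] by (simp add: curve_length_def integrable_integral)
    from has_integral_mult_right[OF has_integral_affinity'[OF this, of 2 0], of 2]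
    show ?thesis by simp
  qed
  then have 1: "(speed M (\<gamma> +++ \<eta>) has_integral curve_length M \<gamma>) {0..1/2}"
  proof (rule has_integral_spike_finite[rotated 2])
    show "finite ({0,1/2} \<union> (\<lambda>s. s / 2) ` S')" using S' by simp
    fix t assume t: "t \<in> {0..1/2} - ({0,1/2} \<union> (\<lambda>s. s / 2) ` S')"
    have "regular_at \<gamma> (2 * t + 0)"
    proof (rule S')
      show "2 * t + 0 \<notin> S'"
      proof
        assume "2 * t + 0 \<in> S'"
        then have "(2 * t + 0) / 2 \<in> (\<lambda>s. s / 2) ` S'" by (rule imageI)
        then show False using t by simp
      qed
    qed (use t in auto)
    moreover have "\<forall>\<^sub>F s in nhds t. (\<gamma> +++ \<eta>) s = \<gamma> (2 * s + 0)"
    proof -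
      have "\<forall>\<^sub>F s in nhds t. s \<in> {..<1/2}" using t by (intro eventually_nhds_in_open) auto
      then show ?thesis by eventually_elim (simp add: joinpaths_def)
    qed
    ultimately show "speed M (\<gamma> +++ \<eta>) t = 2 * speed M \<gamma> (2 * t)"
      using speed_affine(2)[of \<gamma> 2 t 0 "\<gamma> +++ \<eta>"] by simp
  qed
  have "((\<lambda>s. 2 * speed M \<eta> (2 * s - 1)) has_integral curve_length M \<eta>) {1/2..1}"
  proof -
    have "(speed M \<eta> has_integral curve_length M \<eta>) (cbox 0 1)"
      using speed_integrable[OF \<eta>] by (simp add: curve_length_def integrable_integral)
    from has_integral_mult_right[OF has_integral_affinity'[OF this, of 2 "-1"], of 2]
    show ?thesis by simp
  qed
  then have 2: "(speed M (\<gamma> +++ \<eta>) has_integral curve_length M \<eta>) {1/2..1}"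
  proof (rule has_integral_spike_finite[rotated 2])
    show "finite ({1/2,1} \<union> (\<lambda>s. (s + 1) / 2) ` T')" using T' by simp
    fix t assume t: "t \<in> {1/2..1} - ({1/2,1} \<union> (\<lambda>s. (s + 1) / 2) ` T')"
    have "regular_at \<eta> (2 * t + - 1)"
    proof (rule T')
      show "2 * t + - 1 \<notin> T'"
      proof
        assume "2 * t + - 1 \<in> T'"
        then have "((2 * t + - 1) + 1) / 2 \<in> (\<lambda>s. (s + 1) / 2) ` T'" by (rule imageI)
        then show False using t by simp
      qed
    qed (use t in auto)
    moreover have "\<forall>\<^sub>F s in nhds t. (\<gamma> +++ \<eta>) s = \<eta> (2 * s + - 1)"
    proof -
      have "\<forall>\<^sub>F s in nhds t. s \<in> {1/2<..}" using t by (intro eventually_nhds_in_open) auto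
      then show ?thesis by eventually_elim (simp add: joinpaths_def)
    qed
    ultimately show "speed M (\<gamma> +++ \<eta>) t = 2 * speed M \<eta> (2 * t - 1)"
      using speed_affine(2)[of \<eta> 2 t "-1" "\<gamma> +++ \<eta>"] by simp
  qed
  have "(speed M (\<gamma> +++ \<eta>) has_integral (curve_length M \<gamma> + curve_length M \<eta>)) {0..1}"
    by (rule has_integral_combine[OF _ _ 1 2]) auto
  then show "curve_length M (\<gamma> +++ \<eta>) = curve_length M \<gamma> + curve_length M \<eta>"
    by (simp add: curve_length_def[of M "\<gamma> +++ \<eta>"] integral_unique)
qed

text \<open>Straight segments in a chart yield the upper bounds for the geodesic distance, and with them its
  continuity.\<close>

lemma segment_curve:
  assumes c: "c \<in> atlas M" and seg: "closed_segment a b \<subseteq> cimg c"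
    and L: "\<And>x v. x \<in> closed_segment a b \<Longrightarrow> gnorm M c x v \<le> L * norm v"
  obtains \<gamma> where "piecewise_C1_curve M \<gamma>" "\<gamma> 0 = cinv c a" "\<gamma> 1 = cinv c b"
    "curve_length M \<gamma> \<le> L * norm (b - a)"
proof -
  define X where "X = (\<lambda>t. a + t *\<^sub>R (b - a))"
  define \<gamma> where "\<gamma> = (\<lambda>t. cinv c (X t))"
  have X: "X t \<in> closed_segment a b" if "t \<in> {0..1}" for t
    using that by (auto simp: X_def in_segment algebra_simps intro!: exI[of _ t])
  then have Xc: "X t \<in> cimg c" if "t \<in> {0..1}" for t using seg that by blast
  have [simp]: "cmap c (\<gamma> t) = X t" "\<gamma> t \<in> cdom c" if "t \<in> {0..1}" for t
    using Xc[OF that] c by (auto simp: \<gamma>_def cinv_in_cdom)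
  have contX: "continuous_on I X" for I unfolding X_def by (intro continuous_intros)
  have derX: "(X has_vector_derivative b - a) (at t within I)" for t I
    unfolding X_def by (auto intro!: derivative_eq_intros)
  have cont: "continuous_on {0..1} \<gamma>"
    unfolding \<gamma>_def using Xc by (intro continuous_on_compose2[OF continuous_on_cinv[OF c] contX]) auto
  have C1: "C1_curve_on M {s..t} \<gamma>" if st: "0 \<le> s" "t \<le> 1" for s t
  proof -
    have sub: "{s..t} \<subseteq> {0..1}" using st by auto
    show ?thesis
      unfolding C1_curve_on_def
    proof (intro conjI ballI)
      show cont': "continuous_on {s..t} \<gamma>" using cont sub by (rule continuous_on_subset)
      fix d assume d: "d \<in> atlas M"
      let ?v = "\<lambda>r. frechet_derivative (\<lambda>y. cmap d (cinv c y)) (at (X r)) (b - a)"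
      show "\<exists>v. continuous_on {r \<in> {s..t}. \<gamma> r \<in> cdom d} v \<and>
         (\<forall>r\<in>{s..t}. \<gamma> r \<in> cdom d \<longrightarrow>
            ((\<lambda>s. cmap d (\<gamma> s)) has_vector_derivative v r) (at r within {s..t}))"
      proof (intro exI[of _ ?v] conjI ballI impI)
        have "X r \<in> cmap c ` (cdom c \<inter> cdom d)" if "r \<in> {s..t}" "\<gamma> r \<in> cdom d" for r
        proof (rule image_eqI[of _ _ "\<gamma> r"])
          show "X r = cmap c (\<gamma> r)" "\<gamma> r \<in> cdom c \<inter> cdom d"
            using that sub by (auto simp: subset_iff)
        qed
        then show "continuous_on {r \<in> {s..t}. \<gamma> r \<in> cdom d} ?v"
          by (intro Ck_on_continuous_frechet_derivative[OF Ck_on_transition[OF c d]] contX continuous_intros) auto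
        fix r assume r: "r \<in> {s..t}" "\<gamma> r \<in> cdom d"
        have r1: "r \<in> {0..1}" using r sub by auto
        have "((\<lambda>s. cmap c (\<gamma> s)) has_vector_derivative b - a) (at r within {s..t})"
          by (rule has_vector_derivative_transform[OF r(1) _ derX]) (use sub in \<open>auto simp: subset_iff\<close>)
        moreover have "continuous (at r within {s..t}) \<gamma>"
          using cont' r(1) by (simp add: continuous_on_eq_continuous_within)
        ultimately show "((\<lambda>s. cmap d (\<gamma> s)) has_vector_derivative ?v r) (at r within {s..t})"
          using velocity_change_chart[where \<gamma>=\<gamma> and t=r and T="{s..t}" and v="b - a", OF c d _ r(2) _ r(1)] r1 by simp
      qed
    qed
  qed
  have \<gamma>: "piecewise_C1_curve M \<gamma>"
    unfolding piecewise_C1_curve_def using cont by (auto intro!: exI[of _ "{}"] C1)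
  have speed: "speed M \<gamma> t \<le> L * norm (b - a)" if t: "t \<in> {0<..<1}" for t
  proof -
    have "isCont \<gamma> t"
      using cont t by (intro continuous_on_interior) auto
    moreover have "((\<lambda>s. cmap c (\<gamma> s)) has_vector_derivative b - a) (at t)"
      by (rule has_vector_derivative_transform_within_open[OF derX _ t]) auto
    ultimately have "speed M \<gamma> t = gnorm M c (X t) (b - a)"
      using speed_eq[OF c, of \<gamma> t "b - a"] t by simp
    then show ?thesis using L X[of t] t by simp
  qed
  have "0 \<le> L * norm (b - a)"
    using speed[of "1/2"] speed_nonneg[of \<gamma> "1/2"] by simp
  have "(speed M \<gamma> has_integral curve_length M \<gamma>) {0..1}"
    using speed_integrable[OF \<gamma>] by (simp add: curve_length_def integrable_integral)
  then have "((\<lambda>t. if t \<in> {0<..<1} then speed M \<gamma> t else 0) has_integral curve_length M \<gamma>) {0..1}"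
    by (rule has_integral_spike_finite[rotated 2, of _ _ _ "{0,1}"]) auto
  moreover have "((\<lambda>t. L * norm (b - a)) has_integral (1 - 0) *\<^sub>R (L * norm (b - a))) {0..1::real}"
    using has_integral_const_real[of "L * norm (b - a)" 0 1] by simp
  ultimately have "curve_length M \<gamma> \<le> (1 - 0) *\<^sub>R (L * norm (b - a))"
    by (rule has_integral_le) (use speed \<open>0 \<le> L * norm (b - a)\<close> in auto)
  then show ?thesis
    using that[OF \<gamma>] by (simp add: \<gamma>_def X_def)
qed

text \<open>The source of all lower bounds for lengths of curves. The map \<open>h\<close> provides coordinates around
  \<open>\<gamma> 0\<close> in which the norm given by \<open>G\<close> does not increase faster than the length of the curve.
  Up to the first time \<open>T\<close> at which the curve leaves the \<open>\<rho>\<close>-ball of that norm it stays in \<open>U\<close>,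
  because the closed \<open>\<rho>\<close>-ball is closed in the whole manifold; at time \<open>T\<close> the norm equals \<open>\<rho>\<close>.
  The lemma is applied to charts and to normal coordinates.\<close>

lemma curve_length_exit:
  fixes h :: "'a \<Rightarrow> real^'n"
  assumes \<gamma>: "piecewise_C1_curve M \<gamma>" and U: "open U" "\<gamma> 0 \<in> U" and h: "continuous_on U h" "h (\<gamma> 0) = 0"
    and G: "posdef G" and \<rho>: "0 < \<rho>"
    and K: "closed {y \<in> U. sqrt (h y \<bullet> (G *v h y)) \<le> \<rho>}"
    and ex: "\<gamma> 1 \<notin> {y \<in> U. sqrt (h y \<bullet> (G *v h y)) < \<rho>}"
    and der: "\<And>t. regular_at \<gamma> t \<Longrightarrow> \<gamma> t \<in> U \<Longrightarrow>
      \<exists>w. ((\<lambda>s. h (\<gamma> s)) has_vector_derivative w) (at t) \<and>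
          \<bar>h (\<gamma> t) \<bullet> (G *v w)\<bar> \<le> sqrt (h (\<gamma> t) \<bullet> (G *v h (\<gamma> t))) * speed M \<gamma> t"
  shows "\<rho> \<le> curve_length M \<gamma>"
proof -
  let ?N = "\<lambda>y. sqrt (h y \<bullet> (G *v h y))"
  define B where "B = {y \<in> U. ?N y < \<rho>}"
  define K where "K = {y \<in> U. ?N y \<le> \<rho>}"
  have N: "continuous_on U ?N"
    using h by (intro continuous_intros)
  have cont: "continuous_on {0..1} \<gamma>" using \<gamma> by (simp add: piecewise_C1_curve_def)
  have "B = ?N -` {..<\<rho>} \<inter> U" by (auto simp: B_def)
  then have "open B"
    using N U(1) continuous_on_open_vimage open_lessThan by metis
  define Z where "Z = {0..1} \<inter> \<gamma> -` (- B)"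
  have "closed Z"
    unfolding Z_def by (rule continuous_closed_preimage) (use cont \<open>open B\<close> in auto)
  have "1 \<in> Z" using ex by (auto simp: Z_def B_def)
  define T where "T = Inf Z"
  have bdd: "bdd_below Z" by (rule bdd_belowI[of _ 0]) (auto simp: Z_def)
  have T: "T \<in> Z"
    unfolding T_def using closed_contains_Inf[OF _ bdd \<open>closed Z\<close>] \<open>1 \<in> Z\<close> by auto
  have T01: "0 \<le> T" "T \<le> 1" using T by (auto simp: Z_def)
  have "\<gamma> 0 \<in> B" using U h \<rho> by (simp add: B_def)
  then have T0: "0 < T" using T T01 by (cases "T = 0") (auto simp: Z_def)
  have inB: "\<gamma> t \<in> B" if "0 \<le> t" "t < T" for t
  proof (rule ccontr)
    assume "\<gamma> t \<notin> B"
    then have "t \<in> Z" using that T01 by (auto simp: Z_def)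
    then show False using cInf_lower[OF _ bdd, of t] that by (simp add: T_def)
  qed
  have "closed ({0..1} \<inter> \<gamma> -` K)"
    by (rule continuous_closed_preimage) (use cont K in \<open>auto simp: K_def\<close>)
  moreover have "{0..<T} \<subseteq> {0..1} \<inter> \<gamma> -` K"
    using inB T01 by (force simp: B_def K_def)
  ultimately have "closure {0..<T} \<subseteq> {0..1} \<inter> \<gamma> -` K"
    by (intro closure_minimal)
  then have sub: "{0..T} \<subseteq> {0..1} \<inter> \<gamma> -` K" using T0 by simp
  then have inU: "\<gamma> t \<in> U" if "t \<in> {0..T}" for t using that by (auto simp: K_def)
  have NT: "?N (\<gamma> T) = \<rho>"
  proof -
    have "T \<in> {0..T}" using T0 by simp
    then have "\<gamma> T \<in> K" "\<gamma> T \<notin> B" using T sub by (blast, simp add: Z_def)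
    then show ?thesis by (auto simp: B_def K_def)
  qed
  obtain S where S: "finite S" "\<And>t. 0 < t \<Longrightarrow> t < 1 \<Longrightarrow> t \<notin> S \<Longrightarrow> regular_at \<gamma> t"
    by (rule piecewise_C1_regular[OF \<gamma>]) blast
  have int: "speed M \<gamma> integrable_on {0..1}" by (rule speed_integrable[OF \<gamma>])
  have bound: "sqrt (\<delta>\<^sup>2 + \<rho>\<^sup>2) - \<delta> \<le> curve_length M \<gamma>" if \<delta>: "\<delta> > 0" for \<delta>
  proof -
    \<comment> \<open>A smooth substitute for the norm of \<open>h (\<gamma> t)\<close>, which need not be differentiable at its zeros.\<close>
    define f where "f = (\<lambda>t. sqrt (\<delta>\<^sup>2 + h (\<gamma> t) \<bullet> (G *v h (\<gamma> t))))"
    have fder: "\<exists>f'. (f has_vector_derivative f') (at t) \<and> f' \<le> speed M \<gamma> t"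
      if t: "t \<in> {0<..<T} - S" for t
    proof -
      have "regular_at \<gamma> t" "\<gamma> t \<in> U" using t T01 S inU[of t] by auto
      from der[OF this] obtain w where w: "((\<lambda>s. h (\<gamma> s)) has_vector_derivative w) (at t)"
        and le: "\<bar>h (\<gamma> t) \<bullet> (G *v w)\<bar> \<le> ?N (\<gamma> t) * speed M \<gamma> t" by blast
      let ?q = "h (\<gamma> t) \<bullet> (G *v h (\<gamma> t))"
      have q: "?q \<ge> 0" by (rule posdef_nonneg[OF G])
      have pos: "\<delta>\<^sup>2 + ?q > 0" using q \<delta> by (simp add: add_pos_nonneg)
      have "((\<lambda>s. \<delta>\<^sup>2 + h (\<gamma> s) \<bullet> (G *v h (\<gamma> s))) has_real_derivative 2 * (h (\<gamma> t) \<bullet> (G *v w))) (at t)"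
        using DERIV_add[OF DERIV_const posdef_quadratic_derivative[OF G w], of "\<delta>\<^sup>2"] by simp
      from DERIV_chain2[OF DERIV_real_sqrt[OF pos] this]
      have "(f has_real_derivative (h (\<gamma> t) \<bullet> (G *v w)) / f t) (at t)"
        by (simp add: f_def field_simps)
      moreover have "(h (\<gamma> t) \<bullet> (G *v w)) / f t \<le> speed M \<gamma> t"
      proof -
        have "h (\<gamma> t) \<bullet> (G *v w) \<le> ?N (\<gamma> t) * speed M \<gamma> t" using le by simp
        also have "\<dots> \<le> f t * speed M \<gamma> t"
          by (intro mult_right_mono speed_nonneg) (simp add: f_def)
        finally show ?thesis using pos by (simp add: f_def field_simps)
      qed
      ultimately show ?thesis
        by (auto simp: has_real_derivative_iff_has_vector_derivative)
    qed
    then obtain f' where f': "\<And>t. t \<in> {0<..<T} - S \<Longrightarrow> (f has_vector_derivative f' t) (at t) \<and> f' t \<le> speed M \<gamma> t"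
      by metis
    define f'' where "f'' = (\<lambda>t. if t \<in> {0<..<T} - S then f' t else 0)"
    have "(f'' has_integral f T - f 0) {0..T}"
    proof (rule fundamental_theorem_of_calculus_interior_strong[OF S(1)])
      have "continuous_on {0..T} (\<lambda>t. h (\<gamma> t))"
        using inU T01 by (intro continuous_on_compose2[OF h(1) continuous_on_subset[OF cont]]) auto
      then show "continuous_on {0..T} f"
        unfolding f_def by (intro continuous_intros)
    qed (use T0 f' in \<open>auto simp: f''_def\<close>)
    moreover have "speed M \<gamma> integrable_on {0..T}"
      using integrable_on_subinterval[of "speed M \<gamma>" "{0..1}" 0 T] int T01 by simp
    then have "(speed M \<gamma> has_integral integral {0..T} (speed M \<gamma>)) {0..T}"
      by (rule integrable_integral)
    ultimately have "f T - f 0 \<le> integral {0..T} (speed M \<gamma>)"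
    proof (rule has_integral_le)
      show "f'' t \<le> speed M \<gamma> t" if "t \<in> {0..T}" for t
        using f' by (auto simp: f''_def speed_nonneg)
    qed
    also have "\<dots> \<le> integral {0..1} (speed M \<gamma>)"
      using int T01 \<open>speed M \<gamma> integrable_on {0..T}\<close>
      by (intro integral_subset_le) (auto simp: speed_nonneg)
    also have "f T = sqrt (\<delta>\<^sup>2 + \<rho>\<^sup>2)"
      unfolding f_def NT[symmetric] using posdef_nonneg[OF G] by simp
    also have "f 0 = \<delta>"
      using \<delta> h by (simp add: f_def)
    finally show ?thesis by (simp add: curve_length_def)
  qed
  show ?thesis
  proof (rule field_le_epsilon)
    fix \<delta> :: real assume \<delta>: "\<delta> > 0"
    have "\<rho> \<le> sqrt (\<delta>\<^sup>2 + \<rho>\<^sup>2)" by (rule real_le_rsqrt) simp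
    also have "\<dots> \<le> curve_length M \<gamma> + \<delta>" using bound[OF \<delta>] by simp
    finally show "\<rho> \<le> curve_length M \<gamma> + \<delta>" .
  qed
qed

text \<open>In a compact coordinate ball the Riemannian norm is at least \<open>sqrt l\<close> times the Euclidean norm.
  Therefore \<open>curve_length_exit\<close> applies with \<open>G = l\<close> times the identity.\<close>

lemma curve_length_exit_open:
  assumes W: "open W" "x \<in> W"
  obtains \<epsilon> where "0 < \<epsilon>"
    "\<And>\<gamma>. piecewise_C1_curve M \<gamma> \<Longrightarrow> \<gamma> 0 = x \<Longrightarrow> \<gamma> 1 \<notin> W \<Longrightarrow> \<epsilon> \<le> curve_length M \<gamma>"
proof -
  define c where "c = chart_at M x"
  have c: "c \<in> atlas M" "x \<in> cdom c" by (auto simp: c_def chart_at)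
  have "open (cmap c ` (W \<inter> cdom c))" "cmap c x \<in> cmap c ` (W \<inter> cdom c)"
    using c W chart_open[OF c(1)] by (auto intro!: open_cmap_image)
  then obtain r where r: "r > 0" "cball (cmap c x) r \<subseteq> cmap c ` (W \<inter> cdom c)"
    by (metis open_contains_cball)
  have img: "cmap c ` (W \<inter> cdom c) \<subseteq> cimg c" by (auto simp: cimg_def)
  obtain l L where l: "0 < l" "\<And>y v. y \<in> cball (cmap c x) r \<Longrightarrow> l * (norm v)\<^sup>2 \<le> v \<bullet> (gmat M c y *v v)"
  proof (rule posdef_compact_bounds[of "cball (cmap c x) r" "gmat M c"])
    show "continuous_on (cball (cmap c x) r) (gmat M c)"
      using continuous_on_gmat[OF c(1)] by (rule continuous_on_subset) (use r img in blast)
    show "posdef (gmat M c y)" if "y \<in> cball (cmap c x) r" for y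
      using that r img by (intro posdef_gmat c) blast
  qed auto
  define U where "U = cinv c ` ball (cmap c x) r"
  define G where "G = l *\<^sub>R (mat 1 :: real^'n^'n)"
  have Gv: "u \<bullet> (G *v v) = l * (u \<bullet> v)" for u v
    by (simp add: G_def scaleR_matrix_vector_assoc[symmetric])
  have G: "posdef G"
    unfolding posdef_def Gv using l(1) by (auto simp: G_def transpose_def vec_eq_iff mat_def)
  define h where "h = (\<lambda>y. cmap c y - cmap c x)"
  have ball: "ball (cmap c x) r \<subseteq> cimg c" using r img by (meson ball_subset_cball order_trans)
  have UW: "U \<subseteq> W \<inter> cdom c"
  proof
    fix y assume "y \<in> U"
    then obtain z where "z \<in> ball (cmap c x) r" "y = cinv c z" by (auto simp: U_def)
    moreover from this obtain w where "w \<in> W \<inter> cdom c" "z = cmap c w" using r by (metis ball_subset_cball imageE subsetD)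
    ultimately show "y \<in> W \<inter> cdom c" using c by auto
  qed
  have U: "open U" "x \<in> U"
    unfolding U_def using ball c r(1) by (auto intro!: open_cinv_image image_eqI[of _ _ "cmap c x"])
  have hU: "y \<in> U \<longleftrightarrow> y \<in> cdom c \<and> norm (h y) < r" for y
  proof
    assume "y \<in> U" then show "y \<in> cdom c \<and> norm (h y) < r"
      using UW ball c by (auto simp: U_def h_def dist_norm norm_minus_commute subset_iff)
  next
    assume "y \<in> cdom c \<and> norm (h y) < r" then show "y \<in> U"
      using c by (auto simp: U_def h_def dist_norm norm_minus_commute intro!: image_eqI[of _ _ "cmap c y"])
  qed
  define \<rho> where "\<rho> = sqrt l * (r / 2)"
  have \<rho>: "\<rho> > 0" using l r by (simp add: \<rho>_def)
  have N: "sqrt (h y \<bullet> (G *v h y)) = sqrt l * norm (h y)" for y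
    by (simp add: Gv real_sqrt_mult norm_eq_sqrt_inner)
  show ?thesis
  proof (rule that[OF \<rho>])
    fix \<gamma> assume \<gamma>: "piecewise_C1_curve M \<gamma>" "\<gamma> 0 = x" "\<gamma> 1 \<notin> W"
    show "\<rho> \<le> curve_length M \<gamma>"
    proof (rule curve_length_exit[OF \<gamma>(1) U(1) _ _ _ G \<rho>, where h=h])
      show "\<gamma> 0 \<in> U" "h (\<gamma> 0) = 0" using U \<gamma> by (auto simp: h_def)
      show "continuous_on U h"
        unfolding h_def using UW
        by (intro continuous_intros continuous_on_subset[OF continuous_on_cmap[OF c(1)]]) auto
      have "{y \<in> U. sqrt (h y \<bullet> (G *v h y)) \<le> \<rho>} = cinv c ` cball (cmap c x) (r/2)"
      proof (intro equalityI subsetI)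
        fix y assume "y \<in> {y \<in> U. sqrt (h y \<bullet> (G *v h y)) \<le> \<rho>}"
        then have "y \<in> cdom c" "norm (h y) \<le> r / 2" using hU l(1) by (auto simp: N \<rho>_def)
        then show "y \<in> cinv c ` cball (cmap c x) (r/2)"
          using c by (auto simp: h_def dist_norm norm_minus_commute intro!: image_eqI[of _ _ "cmap c y"])
      next
        fix y assume "y \<in> cinv c ` cball (cmap c x) (r/2)"
        then obtain z where z: "y = cinv c z" "norm (z - cmap c x) \<le> r / 2"
          by (auto simp: dist_norm norm_minus_commute)
        then have "z \<in> ball (cmap c x) r" using r(1) by (simp add: dist_norm norm_minus_commute)
        then have "y \<in> U" "cmap c y = z" using z ball c by (auto simp: U_def)
        then show "y \<in> {y \<in> U. sqrt (h y \<bullet> (G *v h y)) \<le> \<rho>}"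
          unfolding N using z l(1) by (simp add: \<rho>_def h_def)
      qed
      moreover have "compact (cinv c ` cball (cmap c x) (r/2))"
      proof (rule compact_continuous_image)
        have "cball (cmap c x) (r/2) \<subseteq> cball (cmap c x) r" using r(1) by (intro subset_cball) simp
        then have "cball (cmap c x) (r/2) \<subseteq> cimg c" using r img by blast
        then show "continuous_on (cball (cmap c x) (r/2)) (cinv c)"
          using continuous_on_cinv[OF c(1)] continuous_on_subset by blast
      qed simp
      ultimately show "closed {y \<in> U. sqrt (h y \<bullet> (G *v h y)) \<le> \<rho>}"
        by (simp add: compact_imp_closed)
      show "\<gamma> 1 \<notin> {y \<in> U. sqrt (h y \<bullet> (G *v h y)) < \<rho>}" using \<gamma>(3) UW by auto
      fix t assume t: "regular_at \<gamma> t" "\<gamma> t \<in> U"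
      then have tc: "\<gamma> t \<in> cdom c" "isCont \<gamma> t" using UW by (auto simp: regular_at_def)
      then obtain w where w: "((\<lambda>s. cmap c (\<gamma> s)) has_vector_derivative w) (at t)"
        using t c by (auto simp: regular_at_def)
      have speed: "speed M \<gamma> t = gnorm M c (cmap c (\<gamma> t)) w"
        by (rule speed_eq[OF c(1) tc w])
      have "((\<lambda>s. h (\<gamma> s)) has_vector_derivative w) (at t)"
        unfolding h_def using has_vector_derivative_diff[OF w has_vector_derivative_const] by simp
      moreover have "\<bar>h (\<gamma> t) \<bullet> (G *v w)\<bar> \<le> sqrt (h (\<gamma> t) \<bullet> (G *v h (\<gamma> t))) * speed M \<gamma> t"
      proof -
        have "cmap c (\<gamma> t) \<in> cball (cmap c x) r"
          using t(2) hU[of "\<gamma> t"] by (simp add: h_def dist_norm norm_minus_commute)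
        then have "sqrt (l * (norm w)\<^sup>2) \<le> speed M \<gamma> t"
          unfolding speed gnorm_def by (intro real_sqrt_le_mono l)
        then have le: "sqrt l * norm w \<le> speed M \<gamma> t" by (simp add: real_sqrt_mult)
        have "\<bar>h (\<gamma> t) \<bullet> (G *v w)\<bar> \<le> l * (norm (h (\<gamma> t)) * norm w)"
          using l(1) Cauchy_Schwarz_ineq2[of "h (\<gamma> t)" w] by (simp add: Gv abs_mult)
        also have "\<dots> = (sqrt l * norm (h (\<gamma> t))) * (sqrt l * norm w)"
          using l(1) by simp
        also have "\<dots> \<le> (sqrt l * norm (h (\<gamma> t))) * speed M \<gamma> t"
          by (intro mult_left_mono le) (use l(1) in simp)
        finally show ?thesis by (simp add: N)
      qed
      ultimately show "\<exists>w. ((\<lambda>s. h (\<gamma> s)) has_vector_derivative w) (at t) \<and>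
          \<bar>h (\<gamma> t) \<bullet> (G *v w)\<bar> \<le> sqrt (h (\<gamma> t) \<bullet> (G *v h (\<gamma> t))) * speed M \<gamma> t"
        by blast
    qed
  qed
qed

text \<open>Shows that balls are open, and, together with connectedness, that any two points are joined by a
  curve.\<close>

lemma short_curves:
  fixes x :: 'a
  assumes e: "0 < e"
  obtains V where "open V" "x \<in> V"
    "\<And>y. y \<in> V \<Longrightarrow> \<exists>\<gamma>. piecewise_C1_curve M \<gamma> \<and> \<gamma> 0 = x \<and> \<gamma> 1 = y \<and> curve_length M \<gamma> < e"
proof -
  define c where "c = chart_at M x"
  have c: "c \<in> atlas M" "x \<in> cdom c" by (auto simp: c_def chart_at)
  obtain r where r: "r > 0" "cball (cmap c x) r \<subseteq> cimg c"
    using chart_image_open[OF c(1)] c(2) by (metis open_contains_cball cmap_in_cimg)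
  obtain l L where L: "0 < L" "\<And>y v. y \<in> cball (cmap c x) r \<Longrightarrow> v \<bullet> (gmat M c y *v v) \<le> L * (norm v)\<^sup>2"
  proof (rule posdef_compact_bounds[of "cball (cmap c x) r" "gmat M c"])
    show "continuous_on (cball (cmap c x) r) (gmat M c)"
      using continuous_on_gmat[OF c(1)] r(2) by (rule continuous_on_subset)
    show "posdef (gmat M c y)" if "y \<in> cball (cmap c x) r" for y
      using that r by (intro posdef_gmat c) blast
  qed auto
  \<comment> \<open>Segments shorter than \<open>e / sqrt L\<close> have Riemannian length below \<open>e\<close>.\<close>
  define s where "s = min r (e / sqrt L)"
  have s: "s > 0" using r e L by (simp add: s_def)
  have "ball (cmap c x) s \<subseteq> cball (cmap c x) r" by (auto simp: s_def)
  then have sr: "ball (cmap c x) s \<subseteq> cimg c" using r(2) by blast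
  show ?thesis
  proof (rule that[of "cinv c ` ball (cmap c x) s"])
    show "open (cinv c ` ball (cmap c x) s)" using sr c by (intro open_cinv_image) auto
    show "x \<in> cinv c ` ball (cmap c x) s" using c s by (intro image_eqI[of _ _ "cmap c x"]) auto
    fix y assume "y \<in> cinv c ` ball (cmap c x) s"
    then obtain z where z: "z \<in> ball (cmap c x) s" "y = cinv c z" by auto
    have "closed_segment (cmap c x) z \<subseteq> ball (cmap c x) s"
      using z s by (intro closed_segment_subset) auto
    then have seg: "closed_segment (cmap c x) z \<subseteq> cball (cmap c x) r"
      using \<open>ball (cmap c x) s \<subseteq> cball (cmap c x) r\<close> by blast
    obtain \<gamma> where \<gamma>: "piecewise_C1_curve M \<gamma>" "\<gamma> 0 = cinv c (cmap c x)" "\<gamma> 1 = cinv c z"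
      "curve_length M \<gamma> \<le> sqrt L * norm (z - cmap c x)"
    proof (rule segment_curve[OF c(1)])
      show "closed_segment (cmap c x) z \<subseteq> cimg c" using seg r by blast
      fix u v assume "u \<in> closed_segment (cmap c x) z"
      then have "sqrt (v \<bullet> (gmat M c u *v v)) \<le> sqrt (L * (norm v)\<^sup>2)"
        using seg by (intro real_sqrt_le_mono L) blast
      then show "gnorm M c u v \<le> sqrt L * norm v" by (simp add: gnorm_def real_sqrt_mult)
    qed
    have "sqrt L * norm (z - cmap c x) < sqrt L * s"
      using z L by (simp add: dist_norm norm_minus_commute)
    also have "\<dots> \<le> e" using L by (simp add: s_def min_def field_simps)
    finally show "\<exists>\<gamma>. piecewise_C1_curve M \<gamma> \<and> \<gamma> 0 = x \<and> \<gamma> 1 = y \<and> curve_length M \<gamma> < e"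
      using \<gamma> c z by auto
  qed
qed

section \<open>The geodesic distance\<close>

lemma curve_length_nonneg: "piecewise_C1_curve M \<gamma> \<Longrightarrow> 0 \<le> curve_length M \<gamma>"
  unfolding curve_length_def by (intro integral_nonneg speed_integrable speed_nonneg)

lemma reverse_curve:
  assumes "piecewise_C1_curve M \<gamma>"
  obtains \<eta> where "piecewise_C1_curve M \<eta>" "\<eta> 0 = \<gamma> 1" "\<eta> 1 = \<gamma> 0" "curve_length M \<eta> = curve_length M \<gamma>"
  using that[of "reversepath \<gamma>"] piecewise_C1_reversepath[OF assms] by (simp add: reversepath_def)

lemma join_curves:
  assumes "piecewise_C1_curve M \<gamma>" "piecewise_C1_curve M \<eta>" "\<gamma> 1 = \<eta> 0"
  obtains \<zeta> where "piecewise_C1_curve M \<zeta>" "\<zeta> 0 = \<gamma> 0" "\<zeta> 1 = \<eta> 1"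
    "curve_length M \<zeta> = curve_length M \<gamma> + curve_length M \<eta>"
  using that[of "\<gamma> +++ \<eta>"] piecewise_C1_joinpaths[OF assms] by (auto simp: joinpaths_def)

text \<open>Being joined by a curve is an equivalence relation with open classes on a connected space.\<close>

lemma curve_exists: "\<exists>\<gamma>. piecewise_C1_curve M \<gamma> \<and> \<gamma> 0 = x \<and> \<gamma> 1 = y"
proof -
  let ?R = "\<lambda>x y. \<exists>\<gamma>. piecewise_C1_curve M \<gamma> \<and> \<gamma> 0 = x \<and> \<gamma> 1 = y"
  have "connected (UNIV :: 'a set)"
    using manifold unfolding riemannian_manifold_def by blast
  then show "?R x y"
  proof (rule connected_equivalence_relation)
    show "?R z y" if "?R y z" for y z
      using that reverse_curve by metis
    show "?R u w" if "?R u v" "?R v w" for u v w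
      using that join_curves by metis
    fix z
    obtain V where "open V" "z \<in> V" "\<And>y. y \<in> V \<Longrightarrow> \<exists>\<gamma>. piecewise_C1_curve M \<gamma> \<and> \<gamma> 0 = z \<and> \<gamma> 1 = y \<and> curve_length M \<gamma> < 1"
      using short_curves[of 1 z] by auto
    then show "\<exists>T. openin (top_of_set UNIV) T \<and> z \<in> T \<and> (\<forall>y\<in>T. ?R z y)"
      by (intro exI[of _ V]) auto
  qed auto
qed

lemma geodist_less_iff:
  "geodist M x y < r \<longleftrightarrow> (\<exists>\<gamma>. piecewise_C1_curve M \<gamma> \<and> \<gamma> 0 = x \<and> \<gamma> 1 = y \<and> curve_length M \<gamma> < r)"
proof -
  let ?A = "{curve_length M \<gamma> | \<gamma>. piecewise_C1_curve M \<gamma> \<and> \<gamma> 0 = x \<and> \<gamma> 1 = y}"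
  have "?A \<noteq> {}" using curve_exists[of x y] by auto
  moreover have "bdd_below ?A" by (rule bdd_belowI[of _ 0]) (auto simp: curve_length_nonneg)
  ultimately show ?thesis unfolding geodist_def by (subst cInf_less_iff) auto
qed

lemma geodist_nonneg: "0 \<le> geodist M x y"
  using geodist_less_iff[of x y 0] curve_length_nonneg by (metis linorder_not_less)

lemma geodist_sym: "geodist M x y = geodist M y x"
proof -
  have "geodist M y x < r" if "geodist M x y < r" for x y r
    using that unfolding geodist_less_iff by (metis reverse_curve)
  from this[of x y] this[of y x] show ?thesis by (metis linorder_neqE_linordered_idom order_less_irrefl)
qed

lemma geodist_triangle: "geodist M x z \<le> geodist M x y + geodist M y z"
proof (rule field_le_epsilon)
  fix e :: real assume e: "e > 0"
  obtain \<gamma> where \<gamma>: "piecewise_C1_curve M \<gamma>" "\<gamma> 0 = x" "\<gamma> 1 = y" "curve_length M \<gamma> < geodist M x y + e/2"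
    using geodist_less_iff[of x y "geodist M x y + e/2"] e by auto
  obtain \<eta> where \<eta>: "piecewise_C1_curve M \<eta>" "\<eta> 0 = y" "\<eta> 1 = z" "curve_length M \<eta> < geodist M y z + e/2"
    using geodist_less_iff[of y z "geodist M y z + e/2"] e by auto
  obtain \<zeta> where \<zeta>: "piecewise_C1_curve M \<zeta>" "\<zeta> 0 = x" "\<zeta> 1 = z"
    "curve_length M \<zeta> = curve_length M \<gamma> + curve_length M \<eta>"
    using join_curves[OF \<gamma>(1) \<eta>(1)] \<gamma> \<eta> by metis
  have "geodist M x z < geodist M x y + geodist M y z + e"
    unfolding geodist_less_iff[of x z] using \<gamma> \<eta> \<zeta> by (intro exI[of _ \<zeta>]) auto
  then show "geodist M x z \<le> geodist M x y + geodist M y z + e" by simp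
qed

lemma geodist_refl [simp]: "geodist M x x = 0"
proof -
  have "geodist M x x < e" if "e > 0" for e
    unfolding geodist_less_iff using short_curves[OF that, of x] by metis
  then show ?thesis using geodist_nonneg[of x x] by (metis less_eq_real_def order_less_irrefl)
qed

lemma open_gball: "open (gball M x r)"
proof (subst open_subopen, intro ballI)
  fix y assume "y \<in> gball M x r"
  then have e: "0 < r - geodist M x y" by (simp add: gball_def)
  obtain V where V: "open V" "y \<in> V"
    "\<And>z. z \<in> V \<Longrightarrow> \<exists>\<gamma>. piecewise_C1_curve M \<gamma> \<and> \<gamma> 0 = y \<and> \<gamma> 1 = z \<and> curve_length M \<gamma> < r - geodist M x y"
    using short_curves[OF e, of y] by metis
  have "V \<subseteq> gball M x r"
  proof
    fix z assume "z \<in> V"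
    then have "geodist M y z < r - geodist M x y" using V(3) by (simp add: geodist_less_iff)
    then show "z \<in> gball M x r" using geodist_triangle[of x z y] by (simp add: gball_def)
  qed
  then show "\<exists>T. open T \<and> y \<in> T \<and> T \<subseteq> gball M x r" using V by blast
qed

lemma gball_subset_open:
  assumes "open W" "x \<in> W"
  obtains e where "0 < e" "gball M x e \<subseteq> W"
proof -
  obtain e where e: "0 < e"
    "\<And>\<gamma>. piecewise_C1_curve M \<gamma> \<Longrightarrow> \<gamma> 0 = x \<Longrightarrow> \<gamma> 1 \<notin> W \<Longrightarrow> e \<le> curve_length M \<gamma>"
    using curve_length_exit_open[OF assms] by metis
  have "gball M x e \<subseteq> W"
    using e(2) by (force simp: gball_def geodist_less_iff)
  with e that show ?thesis by blast
qed

end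

section \<open>The Euler-Lagrange equation\<close>

text \<open>Mean value theorem, with a uniform bound for the derivative on the compact convex set.\<close>

lemma Ck_on_Lipschitz:
  fixes f :: "'e::euclidean_space \<Rightarrow> 'b::real_normed_vector"
  assumes f: "Ck_on (Suc k) S f" and K: "compact K" "convex K" "K \<subseteq> S"
  obtains B where "0 \<le> B" "\<And>x y. x \<in> K \<Longrightarrow> y \<in> K \<Longrightarrow> norm (f x - f y) \<le> B * norm (x - y)"
proof -
  define m where "m = (\<lambda>x. \<Sum>b\<in>Basis. norm (frechet_derivative f (at x) b))"
  have "continuous_on K m"
    unfolding m_def using K
    by (intro continuous_intros Ck_on_continuous_frechet_derivative[OF f]) auto
  then have "bounded (m ` K)"
    by (intro compact_imp_bounded compact_continuous_image K)
  then obtain B where B: "\<And>x. x \<in> K \<Longrightarrow> norm (m x) \<le> B" "0 < B"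
    by (auto simp: bounded_pos)
  show ?thesis
  proof (rule that[of B])
    fix x y assume xy: "x \<in> K" "y \<in> K"
    show "norm (f x - f y) \<le> B * norm (x - y)"
    proof (rule differentiable_bound[OF K(2) _ _ xy])
      fix z assume z: "z \<in> K"
      then have d: "f differentiable (at z)" using f K by auto
      show "(f has_derivative frechet_derivative f (at z)) (at z within K)"
        by (rule has_derivative_at_withinI) (use d in \<open>simp add: frechet_derivative_works[symmetric]\<close>)
      show "onorm (frechet_derivative f (at z)) \<le> B"
      proof (rule onorm_le)
        fix w :: 'e
        have "norm (frechet_derivative f (at z) w)
            \<le> (\<Sum>b\<in>Basis. norm ((w \<bullet> b) *\<^sub>R frechet_derivative f (at z) b))"
          unfolding frechet_derivative_Basis_expand[OF d, of w] by (rule norm_sum)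
        also have "\<dots> \<le> (\<Sum>b\<in>Basis. norm w * norm (frechet_derivative f (at z) b))"
          by (intro sum_mono) (auto intro!: mult_right_mono Basis_le_norm)
        also have "\<dots> = norm w * m z" by (simp add: m_def sum_distrib_left)
        also have "\<dots> \<le> norm w * B" using B(1)[OF z] by (intro mult_left_mono) auto
        finally show "norm (frechet_derivative f (at z) w) \<le> B * norm w" by (simp add: mult.commute)
      qed
    qed
  qed (use B in auto)
qed

text \<open>For \<open>t \<ge> t0\<close> the function \<open>exp (- L (s - t0)) Z s\<close> is nonincreasing, and for \<open>t \<le> t0\<close> the
  function \<open>exp (L (s - t0)) Z s\<close> is nondecreasing; both vanish at \<open>t0\<close>.\<close>

lemma Gronwall_zero:
  fixes Z :: "real \<Rightarrow> real"
  assumes J: "convex J" "t0 \<in> J" "t \<in> J" and Z: "\<And>s. s \<in> J \<Longrightarrow> (Z has_real_derivative Z' s) (at s within J)"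
    and le: "\<And>s. s \<in> J \<Longrightarrow> \<bar>Z' s\<bar> \<le> L * Z s" and Z0: "Z t0 = 0"
  shows "Z t \<le> 0"
proof -
  define E where "E = (\<lambda>m s. exp (m * (s - t0)) * Z s)"
  have E: "(E m has_real_derivative exp (m * (s - t0)) * (m * Z s + Z' s)) (at s within J)" if "s \<in> J" for m s
    unfolding E_def using that
    by (auto intro!: derivative_eq_intros Z simp: algebra_simps)
  have cont: "continuous_on J (E m)" for m
    by (rule DERIV_continuous_on[OF E])
  have sub: "{min t t0..max t t0} \<subseteq> J"
  proof
    fix s assume "s \<in> {min t t0..max t t0}"
    then have "s \<in> closed_segment t t0" by (auto simp: closed_segment_eq_real_ivl min_def max_def split: if_splits)
    then show "s \<in> J" using J closed_segment_subset by blast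
  qed
  show ?thesis
  proof (cases "t0 \<le> t")
    case True
    have "E (-L) t \<le> E (-L) t0"
    proof (rule DERIV_nonpos_imp_decreasing_open[OF True])
      show "continuous_on {t0..t} (E (-L))"
        by (rule continuous_on_subset[OF cont]) (use True sub in auto)
      fix s assume s: "t0 < s" "s < t"
      have "at s within {t0<..<t} = at s" using s by (intro at_within_open) auto
      moreover have "(E (-L) has_real_derivative exp (-L * (s - t0)) * (-L * Z s + Z' s)) (at s within {t0<..<t})"
        by (rule DERIV_subset[OF E]) (use s True sub in auto)
      moreover have "s \<in> J" using s sub True by auto
      from le[OF this] have "-L * Z s + Z' s \<le> 0" by linarith
      ultimately show "\<exists>y. (E (-L) has_real_derivative y) (at s) \<and> y \<le> 0"
        by (auto intro!: exI mult_nonneg_nonpos)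
    qed
    then show ?thesis using Z0 by (simp add: E_def mult_le_0_iff)
  next
    case False
    then have lt: "t \<le> t0" by simp
    have "E L t \<le> E L t0"
    proof (rule DERIV_nonneg_imp_increasing_open[OF lt])
      show "continuous_on {t..t0} (E L)"
        by (rule continuous_on_subset[OF cont]) (use lt sub in auto)
      fix s assume s: "t < s" "s < t0"
      have "at s within {t<..<t0} = at s" using s by (intro at_within_open) auto
      moreover have "(E L has_real_derivative exp (L * (s - t0)) * (L * Z s + Z' s)) (at s within {t<..<t0})"
        by (rule DERIV_subset[OF E]) (use s lt sub in auto)
      moreover have "s \<in> J" using s sub lt by auto
      from le[OF this] have "L * Z s + Z' s \<ge> 0" by linarith
      ultimately show "\<exists>y. (E L has_real_derivative y) (at s) \<and> y \<ge> 0"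
        by (auto intro!: exI mult_nonneg_nonneg)
    qed
    then show ?thesis using Z0 by (simp add: E_def mult_le_0_iff)
  qed
qed

text \<open>The Euler-Lagrange equation at time \<open>t\<close> for the kinetic energy \<open>1/2 (V \<bullet> g V)\<close>. The function
  \<open>F\<close> is the rate of change of the momentum \<open>g V\<close>.\<close>

definition Euler_Lagrange ::
    "(real^'n \<Rightarrow> real^'n^'n) \<Rightarrow> (real \<Rightarrow> real^'n) \<Rightarrow> (real \<Rightarrow> real^'n) \<Rightarrow> (real \<Rightarrow> real^'n)
      \<Rightarrow> real \<Rightarrow> real set \<Rightarrow> bool" where
  "Euler_Lagrange g X V F t J \<longleftrightarrow>
     (X has_vector_derivative V t) (at t within J) \<and>
     ((\<lambda>s. g (X s) *v V s) has_vector_derivative F t) (at t within J) \<and>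
     (\<forall>w. w \<bullet> F t = (1/2) * (V t \<bullet> (frechet_derivative g (at (X t)) w *v V t)))"

text \<open>Gronwall's inequality for the squared distance of the positions plus the squared distance of the
  momenta \<open>P\<close> and \<open>Q\<close>. The equation controls the derivatives of the momenta, and because \<open>g\<close> is positive
  definite the velocities are Lipschitz functions of positions and momenta.\<close>

lemma Euler_Lagrange_unique_local:
  fixes g :: "real^'n \<Rightarrow> real^'n^'n"
  assumes g: "Ck_on (Suc (Suc k)) S g" and K: "compact K" "convex K" "K \<subseteq> S"
    and pd: "\<And>x. x \<in> K \<Longrightarrow> posdef (g x)"
    and J: "convex J" "t0 \<in> J"
    and X: "\<And>t. t \<in> J \<Longrightarrow> X t \<in> K" "\<And>t. t \<in> J \<Longrightarrow> norm (V t) \<le> R"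
      "\<And>t. t \<in> J \<Longrightarrow> Euler_Lagrange g X V F t J"
    and Y: "\<And>t. t \<in> J \<Longrightarrow> Y t \<in> K" "\<And>t. t \<in> J \<Longrightarrow> norm (W t) \<le> R"
      "\<And>t. t \<in> J \<Longrightarrow> Euler_Lagrange g Y W H t J"
    and init: "X t0 = Y t0" "V t0 = W t0" and t: "t \<in> J"
  shows "X t = Y t \<and> V t = W t"
proof -
  let ?D = "\<lambda>l x. frechet_derivative g (at x) (axis l (1::real))"
  obtain \<kappa> where \<kappa>: "0 \<le> \<kappa>" "\<And>(A::real^'n^'n) v. norm (A *v v) \<le> norm A * norm v * \<kappa>"
    using bounded_bilinear.nonneg_bounded[OF bounded_bilinear_matrix_vector_mult] by metis
  have R: "0 \<le> R" using X(2)[OF J(2)] norm_ge_zero order_trans by blast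
  obtain l where l: "0 < l" "\<And>x v. x \<in> K \<Longrightarrow> l * (norm v)\<^sup>2 \<le> v \<bullet> (g x *v v)"
  proof (rule posdef_compact_bounds[of K g])
    show "continuous_on K g" using Ck_on_continuous[OF g] K(3) continuous_on_subset by blast
  qed (use K pd in auto)
  obtain B where B: "0 \<le> B" "\<And>x y. x \<in> K \<Longrightarrow> y \<in> K \<Longrightarrow> norm (g x - g y) \<le> B * norm (x - y)"
    using Ck_on_Lipschitz[OF g K] by metis
  have D: "Ck_on (Suc k) S (?D j)" for j
    using g by (auto simp: axis_in_Basis_iff)
  have "\<exists>B\<ge>0. \<forall>x\<in>K. \<forall>y\<in>K. norm (?D j x - ?D j y) \<le> B * norm (x - y)" for j
    using Ck_on_Lipschitz[OF D K] by metis
  then obtain C where C: "\<And>j. 0 \<le> C j"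
      "\<And>j x y. x \<in> K \<Longrightarrow> y \<in> K \<Longrightarrow> norm (?D j x - ?D j y) \<le> C j * norm (x - y)"
    by metis
  have "\<exists>m\<ge>0. \<forall>x\<in>K. norm (?D j x) \<le> m" for j
  proof -
    have "continuous_on K (?D j)" using Ck_on_continuous[OF D] K(3) continuous_on_subset by blast
    then have "bounded (?D j ` K)" by (intro compact_imp_bounded compact_continuous_image K)
    then show ?thesis by (auto simp: bounded_pos intro: less_imp_le)
  qed
  then obtain m where m: "\<And>j. 0 \<le> m j" "\<And>j x. x \<in> K \<Longrightarrow> norm (?D j x) \<le> m j" by metis
  \<comment> \<open>\<open>C1\<close> bounds velocities by positions and momenta, \<open>C2\<close> bounds the forces.\<close>
  define C1 where "C1 = (1 + \<kappa> * B * R) / l"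
  define C2 where "C2 = (\<Sum>j\<in>UNIV. \<kappa> * m j * R + \<kappa> * C j * R * R)"
  have C1: "0 \<le> C1" using l \<kappa> B R by (simp add: C1_def)
  have C2: "0 \<le> C2" using \<kappa> m C R by (auto simp: C2_def intro!: sum_nonneg)
  define P where "P = (\<lambda>s. g (X s) *v V s)"
  define Q where "Q = (\<lambda>s. g (Y s) *v W s)"
  have VW: "norm (V s - W s) \<le> C1 * (norm (P s - Q s) + norm (X s - Y s))" if s: "s \<in> J" for s
  proof -
    let ?a = "norm (X s - Y s)" and ?b = "norm (V s - W s)" and ?p = "norm (P s - Q s)"
    have "l * ?b\<^sup>2 \<le> (V s - W s) \<bullet> (g (X s) *v (V s - W s))"
      using l X s by blast
    also have "g (X s) *v (V s - W s) = (P s - Q s) - (g (X s) - g (Y s)) *v W s"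
      by (simp add: P_def Q_def matrix_vector_mult_diff_distrib matrix_vector_mult_diff_rdistrib)
    also have "(V s - W s) \<bullet> \<dots> \<le> ?b * norm ((P s - Q s) - (g (X s) - g (Y s)) *v W s)"
      by (rule norm_cauchy_schwarz)
    also have "\<dots> \<le> ?b * (?p + B * ?a * R * \<kappa>)"
    proof (intro mult_left_mono norm_triangle_le_diff)
      have "norm ((g (X s) - g (Y s)) *v W s) \<le> norm (g (X s) - g (Y s)) * norm (W s) * \<kappa>" by (rule \<kappa>)
      also have "\<dots> \<le> (B * ?a) * R * \<kappa>"
        using \<kappa> B X Y s by (intro mult_right_mono mult_mono) auto
      finally show "norm (P s - Q s) + norm ((g (X s) - g (Y s)) *v W s) \<le> ?p + B * ?a * R * \<kappa>" by simp
    qed auto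
    finally have "?b * (l * ?b) \<le> ?b * (?p + B * ?a * R * \<kappa>)"
      by (simp add: power2_eq_square mult_ac)
    then have "l * ?b \<le> ?p + B * ?a * R * \<kappa>"
      using \<kappa> B R by (cases "?b = 0") (auto simp: mult_le_cancel_left)
    also have "\<dots> \<le> (1 + \<kappa> * B * R) * (?p + ?a)"
      using \<kappa> B R by (simp add: algebra_simps)
    finally show ?thesis using l by (simp add: C1_def field_simps)
  qed
  have FH: "norm (F s - H s) \<le> C2 * (norm (X s - Y s) + norm (V s - W s))" if s: "s \<in> J" for s
  proof -
    let ?a = "norm (X s - Y s)" and ?b = "norm (V s - W s)"
    have comp: "\<bar>(F s - H s) $ j\<bar> \<le> (\<kappa> * m j * R + \<kappa> * C j * R * R) * (?a + ?b)" for j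
    proof -
      let ?A = "?D j (X s)" and ?B = "?D j (Y s)"
      have "(F s - H s) $ j = axis j 1 \<bullet> F s - axis j 1 \<bullet> H s"
        by (simp add: inner_axis' )
      also have "\<dots> = (1/2) * (V s \<bullet> (?A *v V s) - W s \<bullet> (?B *v W s))"
        using X(3)[OF s] Y(3)[OF s] unfolding Euler_Lagrange_def by (simp add: algebra_simps)
      also have "V s \<bullet> (?A *v V s) - W s \<bullet> (?B *v W s) =
          (V s - W s) \<bullet> (?A *v V s) + W s \<bullet> ((?A - ?B) *v V s) + W s \<bullet> (?B *v (V s - W s))"
        by (simp add: inner_diff_left inner_diff_right matrix_vector_mult_diff_distrib matrix_vector_mult_diff_rdistrib)
      finally have eq: "(F s - H s) $ j = (1/2) * ((V s - W s) \<bullet> (?A *v V s) + W s \<bullet> ((?A - ?B) *v V s) + W s \<bullet> (?B *v (V s - W s)))" .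
      have i: "\<bar>u \<bullet> (A *v v)\<bar> \<le> u' * (a' * v' * \<kappa>)"
        if "norm u \<le> u'" "norm A \<le> a'" "norm v \<le> v'" for u v :: "real^'n" and A u' a' v'
      proof -
        have "\<bar>u \<bullet> (A *v v)\<bar> \<le> norm u * norm (A *v v)" by (rule Cauchy_Schwarz_ineq2)
        also have "\<dots> \<le> norm u * (norm A * norm v * \<kappa>)" by (intro mult_left_mono \<kappa>) auto
        also have "\<dots> \<le> u' * (a' * v' * \<kappa>)"
          using that \<kappa> norm_ge_zero[of u] norm_ge_zero[of A] norm_ge_zero[of v]
          by (intro mult_mono mult_nonneg_nonneg) (auto intro: order_trans simp del: norm_ge_zero)
        finally show ?thesis .
      qed
      have 1: "\<bar>(V s - W s) \<bullet> (?A *v V s)\<bar> \<le> ?b * (m j * R * \<kappa>)"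
        using m X s by (intro i) auto
      have 2: "\<bar>W s \<bullet> ((?A - ?B) *v V s)\<bar> \<le> R * ((C j * ?a) * R * \<kappa>)"
        using C X Y s by (intro i) auto
      have 3: "\<bar>W s \<bullet> (?B *v (V s - W s))\<bar> \<le> R * (m j * ?b * \<kappa>)"
        using m Y s by (intro i) auto
      have "\<bar>(F s - H s) $ j\<bar> \<le> (1/2) * (?b * (m j * R * \<kappa>) + R * ((C j * ?a) * R * \<kappa>) + R * (m j * ?b * \<kappa>))"
      proof -
        have "\<bar>(1/2) * (x + y + z)\<bar> \<le> (1/2) * (x' + y' + z')"
          if "\<bar>x\<bar> \<le> x'" "\<bar>y\<bar> \<le> y'" "\<bar>z\<bar> \<le> z'" for x y z x' y' z' :: real
        proof -
          have "\<bar>x + y + z\<bar> \<le> x' + y' + z'" using that by linarith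
          then show ?thesis by (simp add: abs_mult)
        qed
        from this[OF 1 2 3] show ?thesis unfolding eq .
      qed
      also have "\<dots> \<le> \<kappa> * m j * R * ?b + \<kappa> * C j * R * R * ?a"
        using \<kappa> C R by (simp add: algebra_simps)
      also have "\<dots> \<le> (\<kappa> * m j * R + \<kappa> * C j * R * R) * (?a + ?b)"
        using \<kappa> C m R by (simp add: algebra_simps)
      finally show ?thesis .
    qed
    have "norm (F s - H s) \<le> (\<Sum>j\<in>UNIV. \<bar>(F s - H s) $ j\<bar>)" by (rule norm_le_l1_cart)
    also have "\<dots> \<le> (\<Sum>j\<in>UNIV. (\<kappa> * m j * R + \<kappa> * C j * R * R) * (?a + ?b))"
      by (intro sum_mono comp)
    also have "\<dots> = C2 * (?a + ?b)" by (simp add: C2_def sum_distrib_right)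
    finally show ?thesis .
  qed
  \<comment> \<open>The Gronwall quantity and its derivative.\<close>
  define Z where "Z = (\<lambda>s. (norm (X s - Y s))\<^sup>2 + (norm (P s - Q s))\<^sup>2)"
  define Z' where "Z' = (\<lambda>s. 2 * ((X s - Y s) \<bullet> (V s - W s)) + 2 * ((P s - Q s) \<bullet> (F s - H s)))"
  define L where "L = 4 * (C1 + C2 * (1 + C1))"
  have "Z t \<le> 0"
  proof (rule Gronwall_zero[OF J t])
    show "Z t0 = 0" using init by (simp add: Z_def P_def Q_def)
    fix s assume s: "s \<in> J"
    have "((\<lambda>s. X s - Y s) has_vector_derivative V s - W s) (at s within J)"
      "((\<lambda>s. P s - Q s) has_vector_derivative F s - H s) (at s within J)"
      using X(3)[OF s] Y(3)[OF s] unfolding Euler_Lagrange_def P_def Q_def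
      by (auto intro!: has_vector_derivative_diff)
    moreover have "posdef (mat 1 :: real^'n^'n)"
      by (simp add: posdef_def transpose_mat)
    ultimately show "(Z has_real_derivative Z' s) (at s within J)"
      unfolding Z_def Z'_def power2_norm_eq_inner
      using DERIV_add[OF posdef_quadratic_derivative[of "mat 1" "\<lambda>s. X s - Y s"]
          posdef_quadratic_derivative[of "mat 1" "\<lambda>s. P s - Q s"]]
      by simp
    let ?a = "norm (X s - Y s)" and ?b = "norm (V s - W s)" and ?p = "norm (P s - Q s)"
    have "\<bar>Z' s\<bar> \<le> 2 * (?a * ?b) + 2 * (?p * norm (F s - H s))"
      unfolding Z'_def
      using Cauchy_Schwarz_ineq2[of "X s - Y s" "V s - W s"] Cauchy_Schwarz_ineq2[of "P s - Q s" "F s - H s"]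
      by linarith
    also have "\<dots> \<le> 2 * (?a * (C1 * (?p + ?a))) + 2 * (?p * (C2 * ((1 + C1) * (?p + ?a))))"
    proof (intro add_mono mult_left_mono)
      show "?b \<le> C1 * (?p + ?a)" by (rule VW[OF s])
      have "norm (F s - H s) \<le> C2 * (?a + ?b)" by (rule FH[OF s])
      also have "\<dots> \<le> C2 * ((1 + C1) * (?p + ?a))"
      proof (rule mult_left_mono[OF _ C2])
        show "?a + ?b \<le> (1 + C1) * (?p + ?a)"
        proof -
          have "?a + ?b \<le> (?p + ?a) + C1 * (?p + ?a)"
            by (intro add_mono VW[OF s]) simp
          then show ?thesis by (simp only: distrib_right mult_1)
        qed
      qed
      finally show "norm (F s - H s) \<le> C2 * ((1 + C1) * (?p + ?a))" .
    qed auto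
    also have "\<dots> \<le> 2 * (C1 + C2 * (1 + C1)) * (?p + ?a)\<^sup>2"
    proof -
      have "?a * (C1 * (?p + ?a)) \<le> C1 * (?p + ?a)\<^sup>2"
        using C1 by (simp add: power2_eq_square algebra_simps)
      moreover have "?p * (C2 * ((1 + C1) * (?p + ?a))) \<le> C2 * (1 + C1) * (?p + ?a)\<^sup>2"
        using C1 C2 by (simp add: power2_eq_square algebra_simps)
      ultimately show ?thesis by (simp add: algebra_simps)
    qed
    also have "\<dots> \<le> 2 * (C1 + C2 * (1 + C1)) * (2 * (?a\<^sup>2 + ?p\<^sup>2))"
    proof (rule mult_left_mono)
      have "0 \<le> (?a - ?p)\<^sup>2" by simp
      then show "(?p + ?a)\<^sup>2 \<le> 2 * (?a\<^sup>2 + ?p\<^sup>2)" by (simp add: power2_eq_square algebra_simps)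
    qed (use C1 C2 in simp)
    finally show "\<bar>Z' s\<bar> \<le> L * Z s" by (simp add: L_def Z_def algebra_simps)
  qed
  then have "(norm (X t - Y t))\<^sup>2 + (norm (P t - Q t))\<^sup>2 = 0"
    unfolding Z_def by (smt (verit) zero_le_power2)
  then have "X t = Y t" "P t = Q t" by (simp_all add: add_nonneg_eq_0_iff)
  with VW[OF t] show ?thesis by simp
qed

context riemannian
begin

section \<open>Geodesics\<close>

lemma sum_rotate:
  "(\<Sum>k\<in>A. \<Sum>i\<in>B. \<Sum>j\<in>C. f k i j) = (\<Sum>i\<in>B. \<Sum>j\<in>C. \<Sum>k\<in>A. f k i j)"
  by (subst sum.swap) (intro sum.cong refl sum.swap)

text \<open>Christoffel symbols of the first kind: lowering the index removes the inverse of the metric.\<close>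

lemma gmat_mult_christoffel:
  assumes c: "c \<in> atlas M" and x: "x \<in> cimg c"
  shows "(\<Sum>k\<in>UNIV. gmat M c x $ l $ k * christoffel M c k i j x) =
    (1/2) * (pd i (\<lambda>y. gmat M c y $ j $ l) x + pd j (\<lambda>y. gmat M c y $ i $ l) x
         - pd l (\<lambda>y. gmat M c y $ i $ j) x)"
proof -
  define T where "T = (\<lambda>m. (1/2) * (pd i (\<lambda>y. gmat M c y $ j $ m) x + pd j (\<lambda>y. gmat M c y $ i $ m) x
         - pd m (\<lambda>y. gmat M c y $ i $ j) x))"
  have "gmat M c x ** ginv M c x = mat 1"
    unfolding ginv_def by (intro matrix_inv_right posdef_invertible posdef_gmat c x)
  then have inv: "(\<Sum>k\<in>UNIV. gmat M c x $ l $ k * ginv M c x $ k $ m) = (if l = m then 1 else 0)" for m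
    by (simp add: matrix_matrix_mult_def mat_def vec_eq_iff)
  have "(\<Sum>k\<in>UNIV. gmat M c x $ l $ k * christoffel M c k i j x)
      = (\<Sum>k\<in>UNIV. \<Sum>m\<in>UNIV. gmat M c x $ l $ k * ginv M c x $ k $ m * T m)"
    by (simp add: christoffel_def T_def sum_distrib_left mult.assoc mult.left_commute)
  also have "\<dots> = (\<Sum>m\<in>UNIV. (\<Sum>k\<in>UNIV. gmat M c x $ l $ k * ginv M c x $ k $ m) * T m)"
    by (subst sum.swap) (simp add: sum_distrib_right)
  also have "\<dots> = T l"
    by (simp add: inv if_distrib[of "\<lambda>z. z * _"] cong: if_cong)
  finally show ?thesis by (simp add: T_def)
qed

lemma pd_gmat:
  assumes c: "c \<in> atlas M" and x: "x \<in> cimg c"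
  shows "pd k (\<lambda>y. gmat M c y $ i $ j) x = frechet_derivative (gmat M c) (at x) (axis k 1) $ i $ j"
proof -
  have "(gmat M c has_derivative frechet_derivative (gmat M c) (at x)) (at x)"
    using Ck_on_has_derivative[OF Ck_on_gmat[OF c, of "Suc 0"] x] .
  then have "((\<lambda>y. gmat M c y $ i $ j) has_derivative
      (\<lambda>w. frechet_derivative (gmat M c) (at x) w $ i $ j)) (at x)"
    by (intro bounded_linear.has_derivative[OF bounded_linear_vec_nth])
  from fun_cong[OF frechet_derivative_at[OF this], of "axis k 1"]
  show ?thesis by (simp add: pd_def)
qed

lemma pd_gmat_sym:
  assumes c: "c \<in> atlas M" and x: "x \<in> cimg c"
  shows "pd k (\<lambda>y. gmat M c y $ i $ j) x = pd k (\<lambda>y. gmat M c y $ j $ i) x"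
proof -
  have sym: "gmat M c y $ i $ j = gmat M c y $ j $ i" if "y \<in> cimg c" for y
  proof -
    have "transpose (gmat M c y) $ j $ i = gmat M c y $ j $ i"
      using posdef_gmat[OF c that] by (simp add: posdef_def)
    then show ?thesis by (simp add: transpose_def)
  qed
  have "(gmat M c has_derivative frechet_derivative (gmat M c) (at x)) (at x)"
    using Ck_on_has_derivative[OF Ck_on_gmat[OF c, of "Suc 0"] x] .
  then have 1: "((\<lambda>y. gmat M c y $ i $ j) has_derivative
      (\<lambda>w. frechet_derivative (gmat M c) (at x) w $ i $ j)) (at x)" for i j
    by (intro bounded_linear.has_derivative[OF bounded_linear_vec_nth])
  have "((\<lambda>y. gmat M c y $ j $ i) has_derivative
      (\<lambda>w. frechet_derivative (gmat M c) (at x) w $ i $ j)) (at x)"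
    by (rule has_derivative_transform_within_open[OF 1[of i j] chart_image_open[OF c] x]) (simp add: sym)
  from fun_cong[OF frechet_derivative_at[OF this], of "axis k 1"]
    fun_cong[OF frechet_derivative_at[OF 1[of i j]], of "axis k 1"]
  show ?thesis unfolding pd_def by metis
qed

lemma frechet_derivative_gmat_nth:
  assumes c: "c \<in> atlas M" and x: "x \<in> cimg c"
  shows "frechet_derivative (gmat M c) (at x) w $ i $ j = (\<Sum>k\<in>UNIV. w $ k * pd k (\<lambda>y. gmat M c y $ i $ j) x)"
proof -
  have "gmat M c differentiable (at x)"
    using Ck_on_gmat[OF c, of "Suc 0"] x by simp
  then have lin: "linear (frechet_derivative (gmat M c) (at x))" by (rule linear_frechet_derivative)
  have "frechet_derivative (gmat M c) (at x) w
      = frechet_derivative (gmat M c) (at x) (\<Sum>k\<in>UNIV. w $ k *\<^sub>R axis k 1)"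
    using basis_expansion[of w] by (simp add: scalar_mult_eq_scaleR)
  also have "\<dots> = (\<Sum>k\<in>UNIV. w $ k *\<^sub>R frechet_derivative (gmat M c) (at x) (axis k 1))"
    by (simp add: linear_sum[OF lin] linear_scale[OF lin])
  finally show ?thesis by (simp add: pd_gmat[OF c x])
qed

text \<open>The acceleration that the geodesic equation prescribes in a chart.\<close>

definition christoffel_force :: "('a, 'n) chart \<Rightarrow> real^'n \<Rightarrow> real^'n \<Rightarrow> real^'n" where
  "christoffel_force c x v =
    (\<chi> k. - (\<Sum>i\<in>UNIV. \<Sum>j\<in>UNIV. christoffel M c k i j x * (v $ i) * (v $ j)))"

text \<open>Of the three terms in the Christoffel symbol of the first kind, two agree after summation against
  \<open>v\<^sub>i v\<^sub>j\<close>. They give the second term on the right, which is the change of the metric along the curve.\<close>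

lemma inner_gmat_christoffel_force:
  assumes c: "c \<in> atlas M" and x: "x \<in> cimg c"
  shows "w \<bullet> (gmat M c x *v christoffel_force c x v) =
    (1/2) * (v \<bullet> (frechet_derivative (gmat M c) (at x) w *v v))
     - w \<bullet> (frechet_derivative (gmat M c) (at x) v *v v)"
proof -
  define P where "P = (\<lambda>k i j. pd k (\<lambda>y. gmat M c y $ i $ j) x)"
  have P: "P k i j = P k j i" for k i j unfolding P_def by (rule pd_gmat_sym[OF c x])
  have "(gmat M c x *v christoffel_force c x v) $ l =
      - (\<Sum>k\<in>UNIV. \<Sum>i\<in>UNIV. \<Sum>j\<in>UNIV. gmat M c x $ l $ k * christoffel M c k i j x * (v $ i * v $ j))" for l
    by (simp add: matrix_vector_mult_def christoffel_force_def sum_distrib_left mult_ac sum_negf)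
  also have "\<dots> l = - (\<Sum>i\<in>UNIV. \<Sum>j\<in>UNIV. (\<Sum>k\<in>UNIV. gmat M c x $ l $ k * christoffel M c k i j x) * (v $ i * v $ j))" for l
    unfolding sum_distrib_right by (subst sum_rotate) (rule refl)
  also have "\<dots> l = - (\<Sum>i\<in>UNIV. \<Sum>j\<in>UNIV. (1/2) * (P i j l + P j i l - P l i j) * (v $ i * v $ j))" for l
    by (simp add: gmat_mult_christoffel[OF c x] P_def)
  also have "\<dots> l = (1/2) * (\<Sum>i\<in>UNIV. \<Sum>j\<in>UNIV. P l i j * (v $ i * v $ j))
     - (\<Sum>i\<in>UNIV. \<Sum>j\<in>UNIV. P i j l * (v $ i * v $ j))" for l
  proof -
    have sw: "(\<Sum>i\<in>UNIV. \<Sum>j\<in>UNIV. P j i l * (v $ i * v $ j)) = (\<Sum>i\<in>UNIV. \<Sum>j\<in>UNIV. P i j l * (v $ i * v $ j))"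
      by (subst sum.swap) (simp add: mult_ac)
    have "(\<Sum>i\<in>UNIV. \<Sum>j\<in>UNIV. (1/2) * (P i j l + P j i l - P l i j) * (v $ i * v $ j))
       = (1/2) * ((\<Sum>i\<in>UNIV. \<Sum>j\<in>UNIV. P i j l * (v $ i * v $ j)) + (\<Sum>i\<in>UNIV. \<Sum>j\<in>UNIV. P j i l * (v $ i * v $ j))
          - (\<Sum>i\<in>UNIV. \<Sum>j\<in>UNIV. P l i j * (v $ i * v $ j)))"
      by (simp add: sum_distrib_left sum.distrib sum_subtractf algebra_simps)
    then show ?thesis unfolding sw by (simp add: algebra_simps)
  qed
  finally have comp: "(gmat M c x *v christoffel_force c x v) $ l =
     (1/2) * (\<Sum>i\<in>UNIV. \<Sum>j\<in>UNIV. P l i j * (v $ i * v $ j))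
     - (\<Sum>i\<in>UNIV. \<Sum>j\<in>UNIV. P i j l * (v $ i * v $ j))" for l .
  have D: "a \<bullet> (frechet_derivative (gmat M c) (at x) b *v d)
      = (\<Sum>l\<in>UNIV. \<Sum>i\<in>UNIV. \<Sum>j\<in>UNIV. b $ l * P l i j * (a $ i * d $ j))" for a b d
  proof -
    have "a \<bullet> (frechet_derivative (gmat M c) (at x) b *v d)
      = (\<Sum>i\<in>UNIV. \<Sum>j\<in>UNIV. \<Sum>l\<in>UNIV. b $ l * P l i j * (a $ i * d $ j))"
      by (simp add: inner_vec_def matrix_vector_mult_def frechet_derivative_gmat_nth[OF c x] P_def
          sum_distrib_left sum_distrib_right mult_ac)
    also have "\<dots> = (\<Sum>i\<in>UNIV. \<Sum>l\<in>UNIV. \<Sum>j\<in>UNIV. b $ l * P l i j * (a $ i * d $ j))"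
      by (intro sum.cong refl sum.swap)
    also have "\<dots> = (\<Sum>l\<in>UNIV. \<Sum>i\<in>UNIV. \<Sum>j\<in>UNIV. b $ l * P l i j * (a $ i * d $ j))"
      by (rule sum.swap)
    finally show ?thesis .
  qed
  have "w \<bullet> (gmat M c x *v christoffel_force c x v) =
     (1/2) * (\<Sum>l\<in>UNIV. \<Sum>i\<in>UNIV. \<Sum>j\<in>UNIV. w $ l * P l i j * (v $ i * v $ j))
     - (\<Sum>l\<in>UNIV. \<Sum>i\<in>UNIV. \<Sum>j\<in>UNIV. w $ l * P i j l * (v $ i * v $ j))"
    unfolding inner_vec_def comp
    by (simp add: sum_distrib_left right_diff_distrib sum_subtractf mult_ac)
  also have "(\<Sum>l\<in>UNIV. \<Sum>i\<in>UNIV. \<Sum>j\<in>UNIV. w $ l * P i j l * (v $ i * v $ j))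
      = w \<bullet> (frechet_derivative (gmat M c) (at x) v *v v)"
  proof -
    have "(\<Sum>l\<in>UNIV. \<Sum>i\<in>UNIV. \<Sum>j\<in>UNIV. w $ l * P i j l * (v $ i * v $ j))
      = (\<Sum>i\<in>UNIV. \<Sum>l\<in>UNIV. \<Sum>j\<in>UNIV. v $ i * P i l j * (w $ l * v $ j))"
      by (subst sum.swap) (intro sum.cong refl, subst P, simp add: mult_ac)
    then show ?thesis unfolding D .
  qed
  finally show ?thesis unfolding D[of v w v] .
qed

definition geodesic_velocity :: "(real \<Rightarrow> 'a) \<Rightarrow> real set \<Rightarrow> (('a, 'n) chart \<Rightarrow> real \<Rightarrow> real^'n) \<Rightarrow> bool" where
  "geodesic_velocity \<gamma> I v \<longleftrightarrow> (\<forall>c\<in>atlas M. \<forall>t\<in>I. \<gamma> t \<in> cdom c \<longrightarrow>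
     ((\<lambda>s. cmap c (\<gamma> s)) has_vector_derivative v c t) (at t within I) \<and>
     (v c has_vector_derivative christoffel_force c (cmap c (\<gamma> t)) (v c t)) (at t within I))"

lemma geodesic_velocity_exists:
  assumes "geodesic_on M I \<gamma>"
  obtains v where "geodesic_velocity \<gamma> I v"
proof -
  have "\<forall>c\<in>atlas M. \<exists>v. \<forall>t\<in>I. \<gamma> t \<in> cdom c \<longrightarrow>
        ((\<lambda>s. cmap c (\<gamma> s)) has_vector_derivative v t) (at t within I) \<and>
        (v has_vector_derivative christoffel_force c (cmap c (\<gamma> t)) (v t)) (at t within I)"
    using assms unfolding geodesic_on_def christoffel_force_def by blast
  then show ?thesis using that unfolding geodesic_velocity_def by metis
qed

text \<open>The derivative of the momentum \<open>g(X) v\<close> of a geodesic by the product rule.\<close>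

definition momentum_rate :: "('a, 'n) chart \<Rightarrow> real^'n \<Rightarrow> real^'n \<Rightarrow> real^'n" where
  "momentum_rate c x v = frechet_derivative (gmat M c) (at x) v *v v + gmat M c x *v christoffel_force c x v"

text \<open>The geodesic equation, multiplied by the metric.\<close>

lemma geodesic_Euler_Lagrange:
  assumes v: "geodesic_velocity \<gamma> I v" and c: "c \<in> atlas M" and t: "t \<in> I" "\<gamma> t \<in> cdom c"
  shows "Euler_Lagrange (gmat M c) (\<lambda>s. cmap c (\<gamma> s)) (v c)
     (\<lambda>t. momentum_rate c (cmap c (\<gamma> t)) (v c t)) t I"
  unfolding Euler_Lagrange_def
proof (intro conjI allI)
  have x: "cmap c (\<gamma> t) \<in> cimg c" using t by (simp add: cmap_in_cimg)
  have X: "((\<lambda>s. cmap c (\<gamma> s)) has_vector_derivative v c t) (at t within I)"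
    and V: "(v c has_vector_derivative christoffel_force c (cmap c (\<gamma> t)) (v c t)) (at t within I)"
    using v c t by (auto simp: geodesic_velocity_def)
  show "((\<lambda>s. cmap c (\<gamma> s)) has_vector_derivative v c t) (at t within I)" by (fact X)
  have g: "(gmat M c has_derivative frechet_derivative (gmat M c) (at (cmap c (\<gamma> t)))) (at (cmap c (\<gamma> t)))"
    using Ck_on_has_derivative[OF Ck_on_gmat[OF c, of "Suc 0"] x] .
  from has_derivative_compose[OF X[unfolded has_vector_derivative_def] g]
  have "((\<lambda>s. gmat M c (cmap c (\<gamma> s))) has_vector_derivative
     frechet_derivative (gmat M c) (at (cmap c (\<gamma> t))) (v c t)) (at t within I)"
    by (simp add: has_vector_derivative_def linear_scale[OF has_derivative_linear[OF g]])
  from bounded_bilinear.has_vector_derivative[OF bounded_bilinear_matrix_vector_mult this V]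
  show "((\<lambda>s. gmat M c (cmap c (\<gamma> s)) *v v c s) has_vector_derivative
     momentum_rate c (cmap c (\<gamma> t)) (v c t)) (at t within I)"
    by (simp add: momentum_rate_def add.commute)
  show "w \<bullet> momentum_rate c (cmap c (\<gamma> t)) (v c t)
     = (1/2) * (v c t \<bullet> (frechet_derivative (gmat M c) (at (cmap c (\<gamma> t))) w *v v c t))" for w
    by (simp add: momentum_rate_def inner_add_right inner_gmat_christoffel_force[OF c x])
qed

lemma at_within_unit_interval: "t \<in> {0..1} \<Longrightarrow> at t within {0..1::real} \<noteq> bot"
proof -
  assume t: "t \<in> {0..1}"
  have "\<not> (\<exists>a. {0..1::real} = {a})"
    by (metis atLeastAtMost_singleton_iff zero_neq_one)
  then have "t islimpt {0..1}" using t by (intro connected_imp_perfect) auto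
  then show ?thesis by (simp add: trivial_limit_within)
qed

lemma geodesic_velocity_change_chart:
  assumes \<gamma>: "geodesic_on M {0..1} \<gamma>" and v: "geodesic_velocity \<gamma> {0..1} v"
    and cd: "c \<in> atlas M" "d \<in> atlas M" and t: "t \<in> {0..1}" "\<gamma> t \<in> cdom c" "\<gamma> t \<in> cdom d"
  shows "v d t = frechet_derivative (\<lambda>y. cmap d (cinv c y)) (at (cmap c (\<gamma> t))) (v c t)"
proof (rule vector_derivative_unique_within)
  show "at t within {0..1} \<noteq> bot" by (rule at_within_unit_interval[OF t(1)])
  show "((\<lambda>s. cmap d (\<gamma> s)) has_vector_derivative v d t) (at t within {0..1})"
    using v cd t by (auto simp: geodesic_velocity_def)
  have "continuous (at t within {0..1}) \<gamma>"
    using \<gamma> t by (auto simp: geodesic_on_def continuous_on_eq_continuous_within)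
  moreover have "((\<lambda>s. cmap c (\<gamma> s)) has_vector_derivative v c t) (at t within {0..1})"
    using v cd t by (auto simp: geodesic_velocity_def)
  ultimately show "((\<lambda>s. cmap d (\<gamma> s)) has_vector_derivative
      frechet_derivative (\<lambda>y. cmap d (cinv c y)) (at (cmap c (\<gamma> t))) (v c t)) (at t within {0..1})"
    using velocity_change_chart[where \<gamma>=\<gamma> and t=t and T="{0..1}" and v="v c t"] cd t by blast
qed

text \<open>In a chart the derivative of \<open>v \<bullet> g v\<close> is the sum of \<open>v \<bullet> (g v)'\<close> and \<open>v' \<bullet> (g v)\<close>. These are
  \<open>1/2 (D\<^sub>v g)(v, v)\<close> and its negative. The function \<open>f\<close> patches the charts together.\<close>

lemma geodesic_constant_speed:
  assumes \<gamma>: "geodesic_on M {0..1} \<gamma>" and v: "geodesic_velocity \<gamma> {0..1} v"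
    and c: "c \<in> atlas M" "\<gamma> 0 \<in> cdom c" and d: "d \<in> atlas M" "\<gamma> t \<in> cdom d" and t: "t \<in> {0..1}"
  shows "v d t \<bullet> (gmat M d (cmap d (\<gamma> t)) *v v d t) = v c 0 \<bullet> (gmat M c (cmap c (\<gamma> 0)) *v v c 0)"
proof -
  define q where "q = (\<lambda>c t. v c t \<bullet> (gmat M c (cmap c (\<gamma> t)) *v v c t))"
  have q: "q c t = q d t" if "c \<in> atlas M" "d \<in> atlas M" "t \<in> {0..1}" "\<gamma> t \<in> cdom c" "\<gamma> t \<in> cdom d" for c d t
    unfolding q_def using gmat_transition[OF that(1,2,4,5)] geodesic_velocity_change_chart[OF \<gamma> v that] by simp
  define f where "f = (\<lambda>t. q (chart_at M (\<gamma> t)) t)"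
  have f: "f t = q c t" if "c \<in> atlas M" "t \<in> {0..1}" "\<gamma> t \<in> cdom c" for c t
    unfolding f_def using that by (intro q chart_at)
  have "(f has_vector_derivative 0) (at t within {0..1})" if t: "t \<in> {0..1}" for t
  proof -
    define c where "c = chart_at M (\<gamma> t)"
    have c: "c \<in> atlas M" "\<gamma> t \<in> cdom c" by (auto simp: c_def chart_at)
    have x: "cmap c (\<gamma> t) \<in> cimg c" using c by (simp add: cmap_in_cimg)
    have EL: "Euler_Lagrange (gmat M c) (\<lambda>s. cmap c (\<gamma> s)) (v c)
       (\<lambda>t. momentum_rate c (cmap c (\<gamma> t)) (v c t)) t {0..1}"
      by (rule geodesic_Euler_Lagrange[OF v c(1) t c(2)])
    let ?x = "cmap c (\<gamma> t)" and ?v = "v c t"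
    let ?a = "christoffel_force c ?x ?v" and ?D = "frechet_derivative (gmat M c) (at ?x) ?v"
    have V: "(v c has_vector_derivative ?a) (at t within {0..1})"
      using v c t by (auto simp: geodesic_velocity_def)
    have P: "((\<lambda>s. gmat M c (cmap c (\<gamma> s)) *v v c s) has_vector_derivative momentum_rate c ?x ?v) (at t within {0..1})"
      using EL by (simp add: Euler_Lagrange_def)
    have "(q c has_vector_derivative ?v \<bullet> momentum_rate c ?x ?v + ?a \<bullet> (gmat M c ?x *v ?v)) (at t within {0..1})"
      unfolding q_def by (rule bounded_bilinear.has_vector_derivative[OF bounded_bilinear_inner V P])
    moreover have "?v \<bullet> momentum_rate c ?x ?v + ?a \<bullet> (gmat M c ?x *v ?v) = 0"
      using posdef_inner_swap[OF posdef_gmat[OF c(1) x], of ?a ?v]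
      by (simp add: momentum_rate_def inner_add_right inner_gmat_christoffel_force[OF c(1) x])
    ultimately have "(q c has_vector_derivative 0) (at t within {0..1})" by simp
    moreover have "continuous (at t within {0..1}) \<gamma>"
      using \<gamma> t by (auto simp: geodesic_on_def continuous_on_eq_continuous_within)
    from eventually_in_chart[OF c(1) this c(2)]
    have "\<forall>\<^sub>F s in at t within {0..1}. q c s = f s"
      using eventually_at_topological[of "\<lambda>_. True" t "{0..1}"]
      by (auto simp: eventually_at_filter f[OF c(1)] elim!: eventually_mono)
    ultimately show ?thesis
      unfolding has_vector_derivative_def
      by (rule has_derivative_transform_eventually) (use t in \<open>auto simp: f[OF c(1) t c(2)]\<close>)
  qed
  then obtain k where "\<And>t. t \<in> {0..1} \<Longrightarrow> f t = k"
    using has_vector_derivative_zero_constant[of "{0..1::real}" f] by blast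
  from this[OF t] this[of 0] have "f t = f 0" by simp
  then show ?thesis
    using f[OF d(1) t d(2)] f[OF c(1) _ c(2)] by (simp add: q_def)
qed

text \<open>The set of times at which positions and velocities agree is nonempty, closed and open in the unit
  interval. It is closed by continuity and open by \<open>Euler_Lagrange_unique_local\<close>. Agreement of
  the velocities in one chart implies agreement in all charts.\<close>

lemma geodesic_unique:
  assumes \<gamma>: "geodesic_on M {0..1} \<gamma>" and \<eta>: "geodesic_on M {0..1} \<eta>" and init: "\<gamma> 0 = \<eta> 0"
    and c0: "c0 \<in> atlas M" "\<gamma> 0 \<in> cdom c0"
    and der: "((\<lambda>s. cmap c0 (\<gamma> s)) has_vector_derivative w) (at 0 within {0..1})"
      "((\<lambda>s. cmap c0 (\<eta> s)) has_vector_derivative w) (at 0 within {0..1})"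
    and t: "t \<in> {0..1}"
  shows "\<gamma> t = \<eta> t"
proof -
  obtain v where v: "geodesic_velocity \<gamma> {0..1} v" by (rule geodesic_velocity_exists[OF \<gamma>])
  obtain u where u: "geodesic_velocity \<eta> {0..1} u" by (rule geodesic_velocity_exists[OF \<eta>])
  define A where "A = {t\<in>{0..1}. \<gamma> t = \<eta> t \<and> (\<forall>c\<in>atlas M. \<gamma> t \<in> cdom c \<longrightarrow> v c t = u c t)}"
  have cont: "continuous (at t within {0..1}) \<gamma>" "continuous (at t within {0..1}) \<eta>" if "t \<in> {0..1}" for t
    using \<gamma> \<eta> that by (auto simp: geodesic_on_def continuous_on_eq_continuous_within)
  have contv: "continuous (at t within {0..1}) (v c)" if "t \<in> {0..1}" "c \<in> atlas M" "\<gamma> t \<in> cdom c" for c t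
    using v that unfolding geodesic_velocity_def by (blast intro: has_vector_derivative_continuous)
  have contu: "continuous (at t within {0..1}) (u c)" if "t \<in> {0..1}" "c \<in> atlas M" "\<eta> t \<in> cdom c" for c t
    using u that unfolding geodesic_velocity_def by (blast intro: has_vector_derivative_continuous)
  have one_chart: "t \<in> A" if "t \<in> {0..1}" "\<gamma> t = \<eta> t" "c \<in> atlas M" "\<gamma> t \<in> cdom c" "v c t = u c t" for c t
    unfolding A_def
  proof (intro CollectI conjI ballI impI that)
    fix d assume d: "d \<in> atlas M" "\<gamma> t \<in> cdom d"
    show "v d t = u d t"
      using geodesic_velocity_change_chart[OF \<gamma> v that(3) d(1) that(1,4) d(2)]
        geodesic_velocity_change_chart[OF \<eta> u that(3) d(1) that(1)] that d by simp
  qed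
  have "0 \<in> A"
  proof (rule one_chart[OF _ init c0])
    have "at (0::real) within {0..1} \<noteq> bot" by (rule at_within_unit_interval) simp
    moreover have "((\<lambda>s. cmap c0 (\<gamma> s)) has_vector_derivative v c0 0) (at 0 within {0..1})"
      "((\<lambda>s. cmap c0 (\<eta> s)) has_vector_derivative u c0 0) (at 0 within {0..1})"
      using v u c0 init by (auto simp: geodesic_velocity_def)
    ultimately have "v c0 0 = w" "u c0 0 = w"
      using der vector_derivative_unique_within by blast+
    then show "v c0 0 = u c0 0" by simp
  qed simp
  have nhd: "\<exists>T. open T \<and> t \<in> T \<and> (\<forall>s\<in>T \<inter> {0..1}. P s)"
    if "\<forall>\<^sub>F s in at t within {0..1}. P s" "P t" for P and t :: real
    using that unfolding eventually_at_topological by (metis IntD1 IntD2)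
  have ev: "\<exists>T. open T \<and> t \<in> T \<and> (\<forall>s\<in>T \<inter> {0..1}. s \<in> A)" if t: "t \<in> A" for t
  proof -
    define c where "c = chart_at M (\<gamma> t)"
    have c: "c \<in> atlas M" "\<gamma> t \<in> cdom c" by (auto simp: c_def chart_at)
    have t1: "t \<in> {0..1}" and eq: "\<gamma> t = \<eta> t" "v c t = u c t" using t c by (auto simp: A_def)
    have c': "\<eta> t \<in> cdom c" using c eq by simp
    let ?x = "cmap c (\<gamma> t)"
    have x: "?x \<in> cimg c" using c by (simp add: cmap_in_cimg)
    obtain r where r: "r > 0" "cball ?x r \<subseteq> cimg c"
      using chart_image_open[OF c(1)] x by (metis open_contains_cball)
    define R where "R = norm (v c t) + 1"
    define ok where "ok = (\<lambda>s. \<gamma> s \<in> cdom c \<and> \<eta> s \<in> cdom c \<and> cmap c (\<gamma> s) \<in> ball ?x r \<and> cmap c (\<eta> s) \<in> ball ?x r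
        \<and> norm (v c s) < R \<and> norm (u c s) < R)"
    have near: "\<forall>\<^sub>F s in at t within {0..1}. f s \<in> W"
      if "continuous (at t within {0..1}) f" "open W" "f t \<in> W" for f :: "real \<Rightarrow> real^'n" and W
      using that topological_tendstoD[of f "f t"] by (auto simp: continuous_within)
    have cX: "continuous (at t within {0..1}) (\<lambda>s. cmap c (\<gamma> s))" "continuous (at t within {0..1}) (\<lambda>s. cmap c (\<eta> s))"
      using v u t1 c c' unfolding geodesic_velocity_def by (blast intro: has_vector_derivative_continuous)+
    have "\<forall>\<^sub>F s in at t within {0..1}. \<gamma> s \<in> cdom c" "\<forall>\<^sub>F s in at t within {0..1}. \<eta> s \<in> cdom c"
      using eventually_in_chart[OF c(1) cont(1)[OF t1] c(2)] eventually_in_chart[OF c(1) cont(2)[OF t1] c'] by auto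
    moreover have "\<forall>\<^sub>F s in at t within {0..1}. cmap c (\<gamma> s) \<in> ball ?x r"
      by (rule near[OF cX(1)]) (use r in auto)
    moreover have "\<forall>\<^sub>F s in at t within {0..1}. cmap c (\<eta> s) \<in> ball ?x r"
      by (rule near[OF cX(2)]) (use r eq in auto)
    moreover have "\<forall>\<^sub>F s in at t within {0..1}. v c s \<in> ball 0 R"
      by (rule near[OF contv[OF t1 c]]) (auto simp: R_def)
    moreover have "\<forall>\<^sub>F s in at t within {0..1}. u c s \<in> ball 0 R"
      by (rule near[OF contu[OF t1 c(1) c']]) (auto simp: R_def eq)
    ultimately have "\<forall>\<^sub>F s in at t within {0..1}. ok s"
      by eventually_elim (auto simp: ok_def)
    moreover have "ok t" using c c' r eq by (auto simp: ok_def R_def)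
    ultimately obtain T where T: "open T" "t \<in> T" "\<forall>s\<in>T \<inter> {0..1}. ok s" using nhd by metis
    then obtain e where e: "e > 0" "ball t e \<subseteq> T" using openE by blast
    define J where "J = ball t e \<inter> {0..1}"
    have J: "convex J" "t \<in> J" "J \<subseteq> {0..1}" using e t1 by (auto simp: J_def intro: convex_Int)
    have okJ: "ok s" if "s \<in> J" for s using that T e by (auto simp: J_def)
    have "s \<in> A" if s: "s \<in> J" for s
    proof -
      have EL: "Euler_Lagrange g X V F s J" if "Euler_Lagrange g X V F s {0..1}" "s \<in> J" for g X V F s
        using that J(3) unfolding Euler_Lagrange_def by (meson has_vector_derivative_within_subset)
      have "cmap c (\<gamma> s) = cmap c (\<eta> s) \<and> v c s = u c s"
      proof (rule Euler_Lagrange_unique_local[OF Ck_on_gmat[OF c(1)] compact_cball convex_cball r(2) _ J(1,2)])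
        show "posdef (gmat M c y)" if "y \<in> cball ?x r" for y
          using that r c by (intro posdef_gmat) auto
        fix s assume s: "s \<in> J"
        then have s1: "s \<in> {0..1}" using J by auto
        show "cmap c (\<gamma> s) \<in> cball ?x r" "cmap c (\<eta> s) \<in> cball ?x r"
          "norm (v c s) \<le> R" "norm (u c s) \<le> R" using okJ[OF s] by (auto simp: ok_def)
        show "Euler_Lagrange (gmat M c) (\<lambda>s. cmap c (\<gamma> s)) (v c)
            (\<lambda>t. momentum_rate c (cmap c (\<gamma> t)) (v c t)) s J"
          using okJ[OF s] by (intro EL geodesic_Euler_Lagrange[OF v c(1) s1] s) (auto simp: ok_def)
        show "Euler_Lagrange (gmat M c) (\<lambda>s. cmap c (\<eta> s)) (u c)
            (\<lambda>t. momentum_rate c (cmap c (\<eta> t)) (u c t)) s J"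
          using okJ[OF s] by (intro EL geodesic_Euler_Lagrange[OF u c(1) s1] s) (auto simp: ok_def)
      qed (use eq s in auto)
      moreover from this have "\<gamma> s = \<eta> s"
        using okJ[OF s] cinv_cmap[OF c(1)] by (metis ok_def)
      ultimately show "s \<in> A"
        using okJ[OF s] s J by (intro one_chart[OF _ _ c(1)]) (auto simp: ok_def)
    qed
    then show ?thesis
      using e by (intro exI[of _ "ball t e"]) (auto simp: J_def)
  qed
  have evc: "\<exists>T. open T \<and> t \<in> T \<and> (\<forall>s\<in>T \<inter> {0..1}. s \<notin> A)" if t: "t \<in> {0..1} - A" for t
  proof (cases "\<gamma> t = \<eta> t")
    case False
    then obtain U V where UV: "open U" "open V" "\<gamma> t \<in> U" "\<eta> t \<in> V" "U \<inter> V = {}"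
      using hausdorff by metis
    have "\<forall>\<^sub>F s in at t within {0..1}. \<gamma> s \<in> U" "\<forall>\<^sub>F s in at t within {0..1}. \<eta> s \<in> V"
      using cont[of t] t UV by (auto simp: continuous_within dest: topological_tendstoD)
    then have "\<forall>\<^sub>F s in at t within {0..1}. s \<notin> A"
      by eventually_elim (use UV in \<open>auto simp: A_def\<close>)
    then show ?thesis using t by (intro nhd) auto
  next
    case True
    define c where "c = chart_at M (\<gamma> t)"
    have c: "c \<in> atlas M" "\<gamma> t \<in> cdom c" by (auto simp: c_def chart_at)
    have "v c t \<noteq> u c t" using one_chart[OF _ True c] t by auto
    then obtain U V where UV: "open U" "open V" "v c t \<in> U" "u c t \<in> V" "U \<inter> V = {}"
      using hausdorff by metis
    have "continuous (at t within {0..1}) (v c)" "continuous (at t within {0..1}) (u c)"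
      using contv contu t c True by auto
    then have "\<forall>\<^sub>F s in at t within {0..1}. v c s \<in> U" "\<forall>\<^sub>F s in at t within {0..1}. u c s \<in> V"
      using UV by (auto simp: continuous_within dest: topological_tendstoD)
    moreover have "\<forall>\<^sub>F s in at t within {0..1}. \<gamma> s \<in> cdom c"
      using eventually_in_chart[OF c(1) cont(1) c(2)] t by auto
    ultimately have "\<forall>\<^sub>F s in at t within {0..1}. s \<notin> A"
      by eventually_elim (use UV c in \<open>auto simp: A_def\<close>)
    then show ?thesis using t by (intro nhd) auto
  qed
  have op: "openin (top_of_set {0..1}) B"
    if "B \<subseteq> {0..1}" "\<And>t. t \<in> B \<Longrightarrow> \<exists>T. open T \<and> t \<in> T \<and> (\<forall>s\<in>T \<inter> {0..1}. s \<in> B)" for B :: "real set"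
  proof -
    define W where "W = \<Union>{T. open T \<and> T \<inter> {0..1} \<subseteq> B}"
    have "open W" unfolding W_def by (rule open_Union) blast
    moreover have "B = {0..1} \<inter> W"
    proof
      show "B \<subseteq> {0..1} \<inter> W"
      proof
        fix t assume "t \<in> B"
        with that(2)[OF this] that(1) show "t \<in> {0..1} \<inter> W" unfolding W_def by blast
      qed
    qed (auto simp: W_def)
    ultimately show ?thesis unfolding openin_open by blast
  qed
  have A1: "A \<subseteq> {0..1}" by (auto simp: A_def)
  have "openin (top_of_set {0..1}) A"
    using ev A1 by (intro op) blast+
  moreover have "openin (top_of_set {0..1}) ({0..1} - A)"
  proof (rule op)
    fix t assume "t \<in> {0..1} - A"
    from evc[OF this] show "\<exists>T. open T \<and> t \<in> T \<and> (\<forall>s\<in>T \<inter> {0..1}. s \<in> {0..1} - A)" by blast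
  qed blast
  then have "closedin (top_of_set {0..1}) A"
    using A1 by (simp add: closedin_def)
  ultimately have "A = {} \<or> A = {0..1}"
    using connected_clopen[of "{0..1::real}"] by (metis connected_Icc)
  then have "A = {0..1}" using \<open>0 \<in> A\<close> by blast
  then show ?thesis using t by (auto simp: A_def)
qed

end

section \<open>The Gauss lemma\<close>

context riemannian
begin

lemma christoffel_force_scaleR: "christoffel_force c x (s *\<^sub>R v) = (s * s) *\<^sub>R christoffel_force c x v"
  by (simp add: christoffel_force_def vec_eq_iff sum_distrib_left mult_ac)

text \<open>Scaling time by \<open>s\<close> multiplies the velocity by \<open>s\<close> and the acceleration by \<open>s\<^sup>2\<close>, in accordance
  with \<open>christoffel_force_scaleR\<close>.\<close>

lemma geodesic_on_rescale:
  assumes \<gamma>: "geodesic_on M {0..1} \<gamma>" and s: "0 \<le> s" "s \<le> 1"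
  shows "geodesic_on M {0..1} (\<lambda>t. \<gamma> (s * t))"
proof -
  have img: "(*) s ` {0..1} \<subseteq> {0..1}" using s by (auto simp: mult_le_one)
  obtain v where v: "geodesic_velocity \<gamma> {0..1} v" by (rule geodesic_velocity_exists[OF \<gamma>])
  show ?thesis
    unfolding geodesic_on_def
  proof (intro conjI ballI)
    have "continuous_on {0..1} \<gamma>" using \<gamma> by (simp add: geodesic_on_def)
    moreover have "continuous_on {0..1} ((*) s)" by (intro continuous_intros)
    ultimately show "continuous_on {0..1} (\<lambda>t. \<gamma> (s * t))"
      using img by (rule continuous_on_compose2)
    fix c assume c: "c \<in> atlas M"
    show "\<exists>u. \<forall>t\<in>{0..1}. \<gamma> (s * t) \<in> cdom c \<longrightarrow>
        ((\<lambda>r. cmap c (\<gamma> (s * r))) has_vector_derivative u t) (at t within {0..1}) \<and>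
        (u has_vector_derivative
          (\<chi> k. - (\<Sum>i\<in>UNIV. \<Sum>j\<in>UNIV. christoffel M c k i j (cmap c (\<gamma> (s * t))) * (u t $ i) * (u t $ j))))
          (at t within {0..1})"
      unfolding christoffel_force_def[symmetric]
    proof (intro exI[of _ "\<lambda>t. s *\<^sub>R v c (s * t)"] ballI impI)
      fix t :: real assume t: "t \<in> {0..1}" "\<gamma> (s * t) \<in> cdom c"
      have st: "s * t \<in> {0..1}" using img t(1) by blast
      have d: "((*) s has_vector_derivative s) (at t within {0..1})"
        by (auto intro!: derivative_eq_intros)
      let ?a = "christoffel_force c (cmap c (\<gamma> (s * t)))"
      have "((\<lambda>r. cmap c (\<gamma> r)) has_vector_derivative v c (s * t)) (at (s * t) within {0..1})"
        "(v c has_vector_derivative ?a (v c (s * t))) (at (s * t) within {0..1})"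
        using v c t st unfolding geodesic_velocity_def by blast+
      note this[THEN has_vector_derivative_within_subset, OF img]
      note this[THEN vector_diff_chain_within[OF d], unfolded o_def]
      moreover from bounded_linear.has_vector_derivative[OF bounded_linear_scaleR_right[of s] this(2)]
      have "((\<lambda>t. s *\<^sub>R v c (s * t)) has_vector_derivative ?a (s *\<^sub>R v c (s * t))) (at t within {0..1})"
        by (simp add: christoffel_force_scaleR)
      ultimately show "((\<lambda>r. cmap c (\<gamma> (s * r))) has_vector_derivative s *\<^sub>R v c (s * t)) (at t within {0..1}) \<and>
        ((\<lambda>t. s *\<^sub>R v c (s * t)) has_vector_derivative ?a (s *\<^sub>R v c (s * t))) (at t within {0..1})"
        by blast
    qed
  qed
qed

end

text \<open>Normal coordinates around \<open>x\<close>. The injectivity radius at \<open>x\<close> is by definition the supremum of the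
  radii \<open>r\<close> for which this setting is available.\<close>

locale exponential_ball = riemannian M for M :: "('a::{t2_space,second_countable_topology}, 'n::finite) riem" +
  fixes x :: 'a and c :: "('a, 'n) chart" and r :: real and E :: "real^'n \<Rightarrow> 'a"
  assumes c: "c \<in> atlas M" "x \<in> cdom c" and r: "0 < r"
    and exp: "exponential_on M c x {v. gnorm M c (cmap c x) v < r} E"
    and diffeo: "diffeo_onto_image M {v. gnorm M c (cmap c x) v < r} E"
begin

abbreviation D where "D \<equiv> {v. gnorm M c (cmap c x) v < r}"
abbreviation G where "G \<equiv> gmat M c (cmap c x)"

lemma posdef_G: "posdef G"
  using c by (intro posdef_gmat cmap_in_cimg)

lemma open_D: "open D"
  using diffeo by (simp add: diffeo_onto_image_def)

lemma zero_in_D: "0 \<in> D"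
  using r by (simp add: gnorm_def)

lemma scaleR_in_D: "v \<in> D \<Longrightarrow> 0 \<le> t \<Longrightarrow> t \<le> 1 \<Longrightarrow> t *\<^sub>R v \<in> D"
  using mult_right_mono[of t 1 "gnorm M c (cmap c x) v"] gnorm_nonneg[of c "cmap c x" v] c
  by (simp add: gnorm_scaleR cmap_in_cimg)

text \<open>By definition \<open>E (t v)\<close> is the end point of the geodesic with initial velocity \<open>t v\<close>. By uniqueness
  this geodesic is the one with initial velocity \<open>v\<close>, run through at speed \<open>t\<close>.\<close>

lemma radial_geodesic:
  assumes v: "v \<in> D"
  obtains \<gamma> u where "geodesic_on M {0..1} \<gamma>" "geodesic_velocity \<gamma> {0..1} u"
    "\<gamma> 0 = x" "u c 0 = v" "\<And>t. t \<in> {0..1} \<Longrightarrow> \<gamma> t = E (t *\<^sub>R v)"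
proof -
  have ex: "\<exists>\<gamma>. geodesic_on M {0..1} \<gamma> \<and> \<gamma> 0 = x \<and>
        ((\<lambda>s. cmap c (\<gamma> s)) has_vector_derivative v) (at 0 within {0..1}) \<and> E v = \<gamma> 1" if "v \<in> D" for v
    using exp that unfolding exponential_on_def by blast
  obtain \<gamma> where \<gamma>: "geodesic_on M {0..1} \<gamma>" "\<gamma> 0 = x"
    "((\<lambda>s. cmap c (\<gamma> s)) has_vector_derivative v) (at 0 within {0..1})"
    using ex[OF v] by blast
  obtain u where u: "geodesic_velocity \<gamma> {0..1} u" by (rule geodesic_velocity_exists[OF \<gamma>(1)])
  have "((\<lambda>s. cmap c (\<gamma> s)) has_vector_derivative u c 0) (at 0 within {0..1})"
    using u c \<gamma> by (auto simp: geodesic_velocity_def)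
  then have "u c 0 = v"
    using \<gamma>(3) at_within_unit_interval[of 0] by (intro vector_derivative_unique_within) auto
  moreover have "\<gamma> t = E (t *\<^sub>R v)" if t: "t \<in> {0..1}" for t
  proof -
    have "t *\<^sub>R v \<in> D" using scaleR_in_D[OF v] t by auto
    then obtain \<eta> where \<eta>: "geodesic_on M {0..1} \<eta>" "\<eta> 0 = x"
      "((\<lambda>s. cmap c (\<eta> s)) has_vector_derivative t *\<^sub>R v) (at 0 within {0..1})" "E (t *\<^sub>R v) = \<eta> 1"
      using ex by blast
    have img: "(*) t ` {0..1} \<subseteq> {0..1}" using t by (auto simp: mult_le_one)
    have "((*) t has_vector_derivative t) (at 0 within {0..1})"
      by (auto intro!: derivative_eq_intros)
    moreover have "((\<lambda>s. cmap c (\<gamma> s)) has_vector_derivative v) (at (t * 0) within (*) t ` {0..1})"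
      using has_vector_derivative_within_subset[OF \<gamma>(3) img] by simp
    ultimately have "((\<lambda>s. cmap c (\<gamma> (t * s))) has_vector_derivative t *\<^sub>R v) (at 0 within {0..1})"
      using vector_diff_chain_within[of "(*) t" t 0 "{0..1}" "\<lambda>s. cmap c (\<gamma> s)" v] by (simp add: o_def)
    then have "\<gamma> (t * 1) = \<eta> 1"
      using geodesic_unique[of "\<lambda>s. \<gamma> (t * s)" \<eta> c "t *\<^sub>R v" 1] geodesic_on_rescale[OF \<gamma>(1), of t] \<eta> \<gamma>(2) c t
      by simp
    then show ?thesis using \<eta> by simp
  qed
  ultimately show ?thesis using that \<gamma> u by blast
qed

lemma E_zero: "E 0 = x"
proof -
  obtain \<gamma> u where "\<gamma> 0 = x" "\<And>t. t \<in> {0..1} \<Longrightarrow> \<gamma> t = E (t *\<^sub>R (0::real^'n))"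
    using radial_geodesic[OF zero_in_D] by metis
  from this(1) this(2)[of 0] show ?thesis by simp
qed

definition dE :: "('a, 'n) chart \<Rightarrow> real^'n \<Rightarrow> real^'n \<Rightarrow> real^'n" where
  "dE e u = frechet_derivative (\<lambda>u. cmap e (E u)) (at u)"

lemma Ck_on_E: "e \<in> atlas M \<Longrightarrow> Ck_on k {u\<in>D. E u \<in> cdom e} (\<lambda>u. cmap e (E u))"
  using diffeo unfolding diffeo_onto_image_def smooth_on_def by blast

lemma open_chart_preimage: "e \<in> atlas M \<Longrightarrow> open {u\<in>D. E u \<in> cdom e}"
proof -
  assume "e \<in> atlas M"
  moreover have "continuous_on D E" using diffeo by (simp add: diffeo_onto_image_def)
  moreover have "{u\<in>D. E u \<in> cdom e} = E -` cdom e \<inter> D" by auto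
  ultimately show ?thesis
    using open_D chart_open continuous_on_open_vimage by metis
qed

lemma dE: "e \<in> atlas M \<Longrightarrow> u \<in> D \<Longrightarrow> E u \<in> cdom e \<Longrightarrow>
  ((\<lambda>u. cmap e (E u)) has_derivative dE e u) (at u)"
  unfolding dE_def using Ck_on_has_derivative[OF Ck_on_E[of e "Suc 0"]] by blast

text \<open>The pullback of the Riemannian metric under \<open>E\<close>, computed in the chart \<open>e\<close>.\<close>

definition pullback :: "('a, 'n) chart \<Rightarrow> real^'n \<Rightarrow> real^'n \<Rightarrow> real^'n \<Rightarrow> real" where
  "pullback e u a b = dE e u a \<bullet> (gmat M e (cmap e (E u)) *v dE e u b)"

lemma pullback_change_chart:
  assumes e: "e \<in> atlas M" "E u \<in> cdom e" and d: "d \<in> atlas M" "E u \<in> cdom d" and u: "u \<in> D"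
  shows "pullback e u a b = pullback d u a b"
proof -
  let ?\<tau> = "\<lambda>y. cmap d (cinv e y)"
  have "cmap e (E u) \<in> cmap e ` (cdom e \<inter> cdom d)" using e d by auto
  from Ck_on_has_derivative[OF Ck_on_transition[OF e(1) d(1)] this]
  have "(?\<tau> has_derivative frechet_derivative ?\<tau> (at (cmap e (E u)))) (at (cmap e (E u)))" .
  from has_derivative_compose[OF dE[OF e(1) u e(2)] this]
  have "((\<lambda>v. ?\<tau> (cmap e (E v))) has_derivative (\<lambda>a. frechet_derivative ?\<tau> (at (cmap e (E u))) (dE e u a))) (at u)" .
  then have "((\<lambda>v. cmap d (E v)) has_derivative (\<lambda>a. frechet_derivative ?\<tau> (at (cmap e (E u))) (dE e u a))) (at u)"
    by (rule has_derivative_transform_within_open[OF _ open_chart_preimage[OF e(1)]]) (use e u in auto)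
  from has_derivative_unique[OF dE[OF d(1) u d(2)] this]
  have "dE d u = (\<lambda>a. frechet_derivative ?\<tau> (at (cmap e (E u))) (dE e u a))" .
  then show ?thesis
    unfolding pullback_def by (simp add: gmat_transition[OF e(1) d(1) e(2) d(2)])
qed

lemma radial_velocity:
  assumes \<gamma>: "geodesic_velocity \<gamma> {0..1} u" "\<And>t. t \<in> {0..1} \<Longrightarrow> \<gamma> t = E (t *\<^sub>R v)"
    and v: "v \<in> D" and t: "t \<in> {0..1}" and e: "e \<in> atlas M" "E (t *\<^sub>R v) \<in> cdom e"
  shows "u e t = dE e (t *\<^sub>R v) v"
proof (rule vector_derivative_unique_within[OF at_within_unit_interval[OF t]])
  show "((\<lambda>s. cmap e (\<gamma> s)) has_vector_derivative u e t) (at t within {0..1})"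
    using \<gamma> e t by (auto simp: geodesic_velocity_def)
  have tv: "t *\<^sub>R v \<in> D" using scaleR_in_D[OF v] t by auto
  have d: "((\<lambda>s. s *\<^sub>R v) has_derivative (\<lambda>h. h *\<^sub>R v)) (at t within {0..1})"
    by (auto intro!: derivative_eq_intros)
  from has_derivative_compose[OF d dE[OF e(1) tv e(2)]]
  have "((\<lambda>s. cmap e (E (s *\<^sub>R v))) has_vector_derivative dE e (t *\<^sub>R v) v) (at t within {0..1})"
    by (simp add: has_vector_derivative_def linear_scale[OF has_derivative_linear[OF dE[OF e(1) tv e(2)]]])
  then show "((\<lambda>s. cmap e (\<gamma> s)) has_vector_derivative dE e (t *\<^sub>R v) v) (at t within {0..1})"
    by (rule has_vector_derivative_transform[OF t, rotated]) (simp add: \<gamma>)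
qed

lemma pullback_radial_radial:
  assumes v: "v \<in> D" and t: "t \<in> {0..1}" and e: "e \<in> atlas M" "E (t *\<^sub>R v) \<in> cdom e"
  shows "pullback e (t *\<^sub>R v) v v = v \<bullet> (G *v v)"
proof -
  obtain \<gamma> u where \<gamma>: "geodesic_on M {0..1} \<gamma>" "geodesic_velocity \<gamma> {0..1} u"
    "\<gamma> 0 = x" "u c 0 = v" "\<And>t. t \<in> {0..1} \<Longrightarrow> \<gamma> t = E (t *\<^sub>R v)"
    by (rule radial_geodesic[OF v]) blast
  have "u e t \<bullet> (gmat M e (cmap e (\<gamma> t)) *v u e t) = u c 0 \<bullet> (gmat M c (cmap c (\<gamma> 0)) *v u c 0)"
    using geodesic_constant_speed[OF \<gamma>(1,2) c(1) _ e(1) _ t] \<gamma>(3) \<gamma>(5)[OF t] c e by simp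
  then show ?thesis
    using radial_velocity[OF \<gamma>(2,5) v t e] \<gamma>(3,4) \<gamma>(5)[OF t] by (simp add: pullback_def)
qed

text \<open>By \<open>pullback_radial_radial\<close>, the squared speed at time \<open>t\<close> of the radial geodesic with initial
  velocity \<open>v + s w\<close> is \<open>(v + s w) \<bullet> G (v + s w)\<close>. The assertion is half of the derivative of this
  identity at \<open>s = 0\<close>. Symmetry of the second derivative of \<open>E\<close> moves both of its arguments into the
  order that the proof of the Gauss lemma needs.\<close>

lemma pullback_radial_variation:
  assumes v: "v \<in> D" and t: "t \<in> {0..1}" and e: "e \<in> atlas M" "E (t *\<^sub>R v) \<in> cdom e"
  defines "F \<equiv> \<lambda>u. cmap e (E u)"
  shows "(1/2) * (dE e (t *\<^sub>R v) v \<bullet> (frechet_derivative (gmat M e) (at (F (t *\<^sub>R v))) (dE e (t *\<^sub>R v) (t *\<^sub>R w)) *v dE e (t *\<^sub>R v) v))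
     + (dE e (t *\<^sub>R v) w + t *\<^sub>R second_derivative F (t *\<^sub>R v) v w) \<bullet> (gmat M e (F (t *\<^sub>R v)) *v dE e (t *\<^sub>R v) v)
     = v \<bullet> (G *v w)"
proof -
  let ?O = "{u\<in>D. E u \<in> cdom e}"
  let ?p = "t *\<^sub>R v"
  have p: "?p \<in> D" using scaleR_in_D[OF v] t by auto
  have F: "Ck_on (Suc (Suc 0)) ?O F" unfolding F_def by (rule Ck_on_E[OF e(1)])
  have pO: "?p \<in> ?O" using p e by auto
  have lin: "linear (dE e ?p)" using has_derivative_linear[OF dE[OF e(1) p e(2)]] .
  define X where "X = (\<lambda>s::real. t *\<^sub>R (v + s *\<^sub>R w))"
  define V where "V = (\<lambda>s::real. v + s *\<^sub>R w)"
  define Q where "Q = dE e ?p w + t *\<^sub>R second_derivative F ?p v w"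
  have X0: "X 0 = ?p" "V 0 = v" by (simp_all add: X_def V_def)
  have dX: "(X has_derivative (\<lambda>h. h *\<^sub>R (t *\<^sub>R w))) (at 0)"
    unfolding X_def by (auto intro!: derivative_eq_intros simp: fun_eq_iff scaleR_add_right)
  have dV: "(V has_vector_derivative w) (at 0)"
    unfolding V_def by (auto intro!: derivative_eq_intros)
  have "((\<lambda>s. dE e (X s) (V s)) has_derivative
     (\<lambda>h. second_derivative F (X 0) (h *\<^sub>R (t *\<^sub>R w)) (V 0) + dE e (X 0) (h *\<^sub>R w))) (at 0)"
    unfolding dE_def F_def[symmetric]
    by (rule has_derivative_frechet_derivative[OF F open_chart_preimage[OF e(1)] dX _ dV[unfolded has_vector_derivative_def]])
      (use pO X0 in auto)
  then have dU: "((\<lambda>s. dE e (X s) (V s)) has_vector_derivative Q) (at 0)"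
    unfolding has_vector_derivative_def X0 Q_def
    by (simp add: second_derivative_scaleR[OF F pO] linear_scale[OF lin] scaleR_add_right add.commute
        second_derivative_symmetric[OF F open_chart_preimage[OF e(1)] pO, of w v])
  have "(F has_derivative dE e ?p) (at (X 0))"
    unfolding F_def X0 by (rule dE[OF e(1) p e(2)])
  from has_derivative_compose[OF dX this]
  have dFX: "((\<lambda>s. F (X s)) has_derivative (\<lambda>h. dE e ?p (h *\<^sub>R (t *\<^sub>R w)))) (at 0)" .
  have Fp: "F ?p \<in> cimg e" using e by (simp add: F_def cmap_in_cimg)
  have g: "(gmat M e has_derivative frechet_derivative (gmat M e) (at (F ?p))) (at (F (X 0)))"
    unfolding X0 using Ck_on_has_derivative[OF Ck_on_gmat[OF e(1), of "Suc 0"] Fp] .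
  let ?Dg = "frechet_derivative (gmat M e) (at (F ?p)) (dE e ?p (t *\<^sub>R w))"
  from has_derivative_compose[OF dFX g]
  have dg: "((\<lambda>s. gmat M e (F (X s))) has_vector_derivative ?Dg) (at 0)"
    by (simp add: has_vector_derivative_def linear_scale[OF lin] linear_scale[OF has_derivative_linear[OF g]])
  from bounded_bilinear.has_vector_derivative[OF bounded_bilinear_matrix_vector_mult dg dU]
  have dP: "((\<lambda>s. gmat M e (F (X s)) *v dE e (X s) (V s)) has_vector_derivative
      gmat M e (F ?p) *v Q + ?Dg *v dE e ?p v) (at 0)" by (simp add: X0)
  from bounded_bilinear.has_vector_derivative[OF bounded_bilinear_inner dU dP]
  have 1: "((\<lambda>s. pullback e (X s) (V s) (V s)) has_vector_derivative
      dE e ?p v \<bullet> (gmat M e (F ?p) *v Q + ?Dg *v dE e ?p v) + Q \<bullet> (gmat M e (F ?p) *v dE e ?p v)) (at 0)"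
    by (simp add: X0 pullback_def F_def)
  have 2: "((\<lambda>s. V s \<bullet> (G *v V s)) has_vector_derivative 2 * (v \<bullet> (G *v w))) (at 0)"
    using posdef_quadratic_derivative[OF posdef_G dV] by (simp add: X0 has_real_derivative_iff_has_vector_derivative)
  have "open (V -` D)"
    unfolding V_def by (intro open_vimage open_D continuous_intros)
  moreover have "open (X -` ?O)"
    unfolding X_def by (intro open_vimage open_chart_preimage[OF e(1)] continuous_intros)
  ultimately have W: "open (V -` D \<inter> X -` ?O)" by blast
  have "0 \<in> V -` D \<inter> X -` ?O" using X0 v pO by auto
  moreover have "pullback e (X s) (V s) (V s) = V s \<bullet> (G *v V s)" if "s \<in> V -` D \<inter> X -` ?O" for s
    using pullback_radial_radial[of "V s" t e] that t e(1) by (simp add: X_def V_def)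
  ultimately have "((\<lambda>s. V s \<bullet> (G *v V s)) has_vector_derivative
      dE e ?p v \<bullet> (gmat M e (F ?p) *v Q + ?Dg *v dE e ?p v) + Q \<bullet> (gmat M e (F ?p) *v dE e ?p v)) (at 0)"
    by (rule has_vector_derivative_transform_within_open[OF 1 W])
  from vector_derivative_unique_at[OF this 2]
  have "dE e ?p v \<bullet> (gmat M e (F ?p) *v Q + ?Dg *v dE e ?p v) + Q \<bullet> (gmat M e (F ?p) *v dE e ?p v)
     = 2 * (v \<bullet> (G *v w))" .
  moreover have "dE e ?p v \<bullet> (gmat M e (F ?p) *v Q) = Q \<bullet> (gmat M e (F ?p) *v dE e ?p v)"
    by (rule posdef_inner_swap[OF posdef_gmat[OF e(1) Fp]])
  ultimately show ?thesis
    by (simp add: inner_add_right Q_def)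
qed

text \<open>The function \<open>f t = t * pullback (t v) v w\<close> vanishes at \<open>0\<close>, and its value at \<open>1\<close> is the left-hand
  side. By the Euler-Lagrange equation for the radial geodesic its derivative is the left-hand side
  of \<open>pullback_radial_variation\<close>, so it has the constant value \<open>v \<bullet> G w\<close>.\<close>

lemma Gauss_lemma:
  assumes v: "v \<in> D" and e: "e \<in> atlas M" "E v \<in> cdom e"
  shows "pullback e v v w = v \<bullet> (G *v w)"
proof -
  obtain \<gamma> u where \<gamma>: "geodesic_on M {0..1} \<gamma>" "geodesic_velocity \<gamma> {0..1} u"
    "\<gamma> 0 = x" "u c 0 = v" "\<And>t. t \<in> {0..1} \<Longrightarrow> \<gamma> t = E (t *\<^sub>R v)"
    by (rule radial_geodesic[OF v]) blast
  have inD: "t *\<^sub>R v \<in> D" if "t \<in> {0..1}" for t using scaleR_in_D[OF v] that by auto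
  \<comment> \<open>The value does not depend on the chart, so \<open>f\<close> may be differentiated in any chart around the point.\<close>
  define f where "f = (\<lambda>t. t * pullback (chart_at M (E (t *\<^sub>R v))) (t *\<^sub>R v) v w)"
  have f: "f t = t * pullback d (t *\<^sub>R v) v w" if "t \<in> {0..1}" "d \<in> atlas M" "E (t *\<^sub>R v) \<in> cdom d" for t d
    unfolding f_def using pullback_change_chart[OF chart_at that(2,3) inD[OF that(1)]] by simp
  have "((\<lambda>t. f t - t * (v \<bullet> (G *v w))) has_vector_derivative 0) (at t within {0..1})" if t: "t \<in> {0..1}" for t
  proof -
    define d where "d = chart_at M (E (t *\<^sub>R v))"
    have d: "d \<in> atlas M" "E (t *\<^sub>R v) \<in> cdom d" by (auto simp: d_def chart_at)
    let ?O = "{u\<in>D. E u \<in> cdom d}"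
    let ?F = "\<lambda>u. cmap d (E u)"
    have F: "Ck_on (Suc (Suc 0)) ?O ?F" by (rule Ck_on_E[OF d(1)])
    have pO: "t *\<^sub>R v \<in> ?O" using inD[OF t] d by auto
    have lin: "linear (dE d (t *\<^sub>R v))" using has_derivative_linear[OF dE[OF d(1) inD[OF t] d(2)]] .
    let ?V = "u d t" and ?x = "cmap d (\<gamma> t)"
    have V: "?V = dE d (t *\<^sub>R v) v" by (rule radial_velocity[OF \<gamma>(2,5) v t d])
    have \<gamma>t: "\<gamma> t = E (t *\<^sub>R v)" by (rule \<gamma>(5)[OF t])
    have EL: "Euler_Lagrange (gmat M d) (\<lambda>s. cmap d (\<gamma> s)) (u d)
       (\<lambda>t. momentum_rate d (cmap d (\<gamma> t)) (u d t)) t {0..1}"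
      using geodesic_Euler_Lagrange[OF \<gamma>(2) d(1) t] d(2) \<gamma>t by simp
    let ?R = "momentum_rate d ?x ?V"
    have dP: "((\<lambda>s. gmat M d (cmap d (\<gamma> s)) *v u d s) has_vector_derivative ?R) (at t within {0..1})"
      using EL by (simp add: Euler_Lagrange_def)
    have R: "y \<bullet> ?R = (1/2) * (?V \<bullet> (frechet_derivative (gmat M d) (at ?x) y *v ?V))" for y
      using EL by (simp add: Euler_Lagrange_def)
    have X: "((\<lambda>s. s *\<^sub>R v) has_derivative (\<lambda>h. h *\<^sub>R v)) (at t within {0..1})"
      by (auto intro!: derivative_eq_intros)
    have "((\<lambda>s. dE d (s *\<^sub>R v) w) has_derivative
       (\<lambda>h. second_derivative ?F (t *\<^sub>R v) (h *\<^sub>R v) w + dE d (t *\<^sub>R v) 0)) (at t within {0..1})"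
      unfolding dE_def
      by (rule has_derivative_frechet_derivative[OF F open_chart_preimage[OF d(1)] X pO has_derivative_const t])
    then have "((\<lambda>s. dE d (s *\<^sub>R v) w) has_vector_derivative second_derivative ?F (t *\<^sub>R v) v w) (at t within {0..1})"
      by (simp add: has_vector_derivative_def second_derivative_scaleR[OF F pO] linear_0[OF lin])
    from bounded_bilinear.has_vector_derivative[OF bounded_bilinear_scaleR has_vector_derivative_id this]
    have dW: "((\<lambda>s. s *\<^sub>R dE d (s *\<^sub>R v) w) has_vector_derivative
        dE d (t *\<^sub>R v) w + t *\<^sub>R second_derivative ?F (t *\<^sub>R v) v w) (at t within {0..1})"
      by (simp add: add.commute)
    let ?Q = "dE d (t *\<^sub>R v) w + t *\<^sub>R second_derivative ?F (t *\<^sub>R v) v w"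
    have "((\<lambda>s. (s *\<^sub>R dE d (s *\<^sub>R v) w) \<bullet> (gmat M d (cmap d (\<gamma> s)) *v u d s)) has_vector_derivative
       (t *\<^sub>R dE d (t *\<^sub>R v) w) \<bullet> ?R + ?Q \<bullet> (gmat M d ?x *v ?V)) (at t within {0..1})"
      by (rule bounded_bilinear.has_vector_derivative[OF bounded_bilinear_inner dW dP])
    also have "(t *\<^sub>R dE d (t *\<^sub>R v) w) \<bullet> ?R + ?Q \<bullet> (gmat M d ?x *v ?V) = v \<bullet> (G *v w)"
      using pullback_radial_variation[OF v t d, of w] R[of "t *\<^sub>R dE d (t *\<^sub>R v) w"]
      unfolding V \<gamma>t linear_scale[OF lin] by simp
    finally have der: "((\<lambda>s. (s *\<^sub>R dE d (s *\<^sub>R v) w) \<bullet> (gmat M d (cmap d (\<gamma> s)) *v u d s)) has_vector_derivative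
       v \<bullet> (G *v w)) (at t within {0..1})" .
    have cont: "continuous (at t within {0..1}) \<gamma>"
      using \<gamma>(1) t by (auto simp: geodesic_on_def continuous_on_eq_continuous_within)
    have eq: "(s *\<^sub>R dE d (s *\<^sub>R v) w) \<bullet> (gmat M d (cmap d (\<gamma> s)) *v u d s) = f s"
      if s: "s \<in> {0..1}" "\<gamma> s \<in> cdom d" for s
    proof -
      have Es: "E (s *\<^sub>R v) \<in> cdom d" using s \<gamma>(5)[OF s(1)] by simp
      have "cmap d (\<gamma> s) \<in> cimg d" using s by (simp add: cmap_in_cimg)
      from posdef_inner_swap[OF posdef_gmat[OF d(1) this], of "dE d (s *\<^sub>R v) w" "u d s"]
      show ?thesis
        using f[OF s(1) d(1) Es] radial_velocity[OF \<gamma>(2,5) v s(1) d(1) Es] \<gamma>(5)[OF s(1)]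
        by (simp add: pullback_def)
    qed
    have "\<forall>\<^sub>F s in at t within {0..1}. s \<in> {0..1}" by (simp add: eventually_at_filter)
    moreover have "\<forall>\<^sub>F s in at t within {0..1}. \<gamma> s \<in> cdom d"
      by (rule eventually_in_chart[OF d(1) cont]) (use d(2) \<gamma>t in simp)
    ultimately have "\<forall>\<^sub>F s in at t within {0..1}. (s *\<^sub>R dE d (s *\<^sub>R v) w) \<bullet> (gmat M d (cmap d (\<gamma> s)) *v u d s) = f s"
      by (eventually_elim) (rule eq)
    with der have "(f has_vector_derivative v \<bullet> (G *v w)) (at t within {0..1})"
      unfolding has_vector_derivative_def
    proof (rule has_derivative_transform_eventually)
      show "(t *\<^sub>R dE d (t *\<^sub>R v) w) \<bullet> (gmat M d (cmap d (\<gamma> t)) *v u d t) = f t"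
        using d \<gamma>t by (intro eq[OF t]) simp
    qed (rule t)
    from has_vector_derivative_diff[OF this has_vector_derivative_mult_left[OF has_vector_derivative_id, of "v \<bullet> (G *v w)"]]
    show ?thesis by simp
  qed
  then obtain k where k: "\<And>t. t \<in> {0..1} \<Longrightarrow> f t - t * (v \<bullet> (G *v w)) = k"
    using has_vector_derivative_zero_constant[of "{0..1::real}" "\<lambda>t. f t - t * (v \<bullet> (G *v w))"] by blast
  have "f 0 = 0" by (simp add: f_def)
  with k[of 0] have "k = 0" by simp
  with k[of 1] have "f 1 = v \<bullet> (G *v w)" by simp
  then show ?thesis using f[of 1 e] e by simp
qed

text \<open>The Cauchy-Schwarz inequality at \<open>E v\<close>, with both sides computed by the Gauss lemma. This is the
  hypothesis of \<open>curve_length_exit\<close> in normal coordinates.\<close>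

lemma radial_part_le_speed:
  assumes v: "v \<in> D" and e: "e \<in> atlas M" "E v \<in> cdom e"
  shows "\<bar>v \<bullet> (G *v w)\<bar> \<le> sqrt (v \<bullet> (G *v v)) * gnorm M e (cmap e (E v)) (dE e v w)"
proof -
  have "posdef (gmat M e (cmap e (E v)))" using e by (intro posdef_gmat cmap_in_cimg)
  from posdef_Cauchy_Schwarz[OF this, of "dE e v v" "dE e v w"]
  show ?thesis
    using Gauss_lemma[OF v e, of w] Gauss_lemma[OF v e, of v] by (simp add: pullback_def gnorm_def)
qed

text \<open>A curve that starts at \<open>x\<close> and leaves the image of the closed \<open>\<rho>\<close>-ball has length at least
  \<open>\<rho>\<close>, by \<open>curve_length_exit\<close> for the inverse \<open>h\<close> of \<open>E\<close>.\<close>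

lemma gball_subset_compact:
  assumes \<rho>: "0 < \<rho>" "\<rho> < r"
  shows "\<exists>K. compact K \<and> gball M x \<rho> \<subseteq> K"
proof -
  define h where "h = inv_into D E"
  define U where "U = E ` D"
  have inj: "inj_on E D" and openU: "open U" and contE: "continuous_on D E"
    using diffeo by (auto simp: diffeo_onto_image_def U_def)
  have hE [simp]: "h (E v) = v" if "v \<in> D" for v
    using that inj by (simp add: h_def)
  have hU: "h y \<in> D" "E (h y) = y" if "y \<in> U" for y
    using that hE by (auto simp: U_def)
  have kCk: "Ck_on k (cmap e ` (cdom e \<inter> U)) (\<lambda>y. h (cinv e y))" if "e \<in> atlas M" for e k
    using diffeo that unfolding diffeo_onto_image_def smooth_on_def h_def U_def by blast
  have conth: "continuous_on U h"
  proof -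
    have "isCont h p" if p: "p \<in> U" for p
    proof -
      define e where "e = chart_at M p"
      have e: "e \<in> atlas M" "p \<in> cdom e" by (auto simp: e_def chart_at)
      have W: "open (cdom e \<inter> U)" using openU chart_open[OF e(1)] by blast
      have "continuous_on (cdom e \<inter> U) (\<lambda>q. h (cinv e (cmap e q)))"
        by (rule continuous_on_compose2[OF Ck_on_continuous[OF kCk[OF e(1), of 0]]
              continuous_on_subset[OF continuous_on_cmap[OF e(1)]]]) auto
      then have "continuous_on (cdom e \<inter> U) h"
        by (rule continuous_on_eq) (use e in auto)
      then show "isCont h p"
        using W e p by (simp add: continuous_on_eq_continuous_at)
    qed
    then show ?thesis using openU by (simp add: continuous_on_eq_continuous_at)
  qed
  define B where "B = {v. sqrt (v \<bullet> (G *v v)) \<le> \<rho>}"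
  have BD: "B \<subseteq> D" using \<rho> by (auto simp: B_def gnorm_def)
  have "compact B"
  proof -
    obtain l L where l: "0 < l" "\<And>y v. y \<in> {0::real} \<Longrightarrow> l * (norm v)\<^sup>2 \<le> v \<bullet> (G *v v)"
      by (rule posdef_compact_bounds[of "{0::real}" "\<lambda>_. G"]) (auto simp: posdef_G)
    have "norm v \<le> sqrt (\<rho>\<^sup>2 / l)" if "v \<in> B" for v
    proof (rule real_le_rsqrt)
      have "v \<bullet> (G *v v) \<le> \<rho>\<^sup>2"
        using that \<rho> posdef_nonneg[OF posdef_G, of v] by (auto simp: B_def intro: sqrt_le_D)
      then show "(norm v)\<^sup>2 \<le> \<rho>\<^sup>2 / l"
        using l(2)[of 0 v] l(1) by (simp add: field_simps)
    qed
    then have "bounded B" by (auto simp: bounded_iff)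
    moreover have "closed B"
      unfolding B_def by (intro closed_Collect_le continuous_intros)
    ultimately show ?thesis by (simp add: compact_eq_bounded_closed)
  qed
  then have K: "compact (E ` B)"
    using contE BD by (intro compact_continuous_image) (auto intro: continuous_on_subset)
  have KU: "{y \<in> U. sqrt (h y \<bullet> (G *v h y)) \<le> \<rho>} = E ` B"
    using BD hU by (force simp: B_def U_def)
  have "gball M x \<rho> \<subseteq> E ` B"
  proof (rule ccontr)
    assume "\<not> gball M x \<rho> \<subseteq> E ` B"
    then obtain y where y: "geodist M x y < \<rho>" "y \<notin> E ` B" by (auto simp: gball_def)
    then obtain \<gamma> where \<gamma>: "piecewise_C1_curve M \<gamma>" "\<gamma> 0 = x" "\<gamma> 1 = y" "curve_length M \<gamma> < \<rho>"
      by (auto simp: geodist_less_iff)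
    have "\<rho> \<le> curve_length M \<gamma>"
    proof (rule curve_length_exit[OF \<gamma>(1) openU _ conth _ posdef_G \<rho>(1)])
      show "\<gamma> 0 \<in> U" using zero_in_D E_zero \<gamma>(2) by (force simp: U_def)
      show "h (\<gamma> 0) = 0" using hE[OF zero_in_D] by (simp add: E_zero \<gamma>(2))
      show "closed {y \<in> U. sqrt (h y \<bullet> (G *v h y)) \<le> \<rho>}"
        unfolding KU using K by (rule compact_imp_closed)
      show "\<gamma> 1 \<notin> {y \<in> U. sqrt (h y \<bullet> (G *v h y)) < \<rho>}" using y \<gamma>(3) KU by auto
      fix t assume t: "regular_at \<gamma> t" "\<gamma> t \<in> U"
      define e where "e = chart_at M (\<gamma> t)"
      have e: "e \<in> atlas M" "\<gamma> t \<in> cdom e" by (auto simp: e_def chart_at)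
      have cont: "isCont \<gamma> t" using t by (simp add: regular_at_def)
      obtain z where z: "((\<lambda>s. cmap e (\<gamma> s)) has_vector_derivative z) (at t)"
        using t e by (auto simp: regular_at_def)
      let ?k = "\<lambda>y. h (cinv e y)"
      have "cmap e (\<gamma> t) \<in> cmap e ` (cdom e \<inter> U)" using e t by auto
      from Ck_on_has_derivative[OF kCk[OF e(1), of "Suc 0"] this]
      have k: "(?k has_derivative frechet_derivative ?k (at (cmap e (\<gamma> t)))) (at (cmap e (\<gamma> t)))" .
      define w where "w = frechet_derivative ?k (at (cmap e (\<gamma> t))) z"
      have near: "\<forall>\<^sub>F s in at t. \<gamma> s \<in> cdom e \<inter> U"
        using topological_tendstoD[OF isContD[OF cont], of "cdom e \<inter> U"] openU chart_open[OF e(1)] e t by auto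
      from has_derivative_compose[OF z[unfolded has_vector_derivative_def] k]
      have "((\<lambda>s. ?k (cmap e (\<gamma> s))) has_derivative (\<lambda>a. a *\<^sub>R w)) (at t)"
        by (simp add: w_def linear_scale[OF has_derivative_linear[OF k]])
      moreover have "\<forall>\<^sub>F s in at t. ?k (cmap e (\<gamma> s)) = h (\<gamma> s)"
        using near by eventually_elim (simp add: e)
      ultimately have "((\<lambda>s. h (\<gamma> s)) has_derivative (\<lambda>a. a *\<^sub>R w)) (at t)"
        by (rule has_derivative_transform_eventually) (use e in auto)
      then have dh: "((\<lambda>s. h (\<gamma> s)) has_vector_derivative w) (at t)"
        by (simp add: has_vector_derivative_def)
      have Et: "h (\<gamma> t) \<in> D" "E (h (\<gamma> t)) = \<gamma> t" "E (h (\<gamma> t)) \<in> cdom e" using hU[OF t(2)] e by auto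
      have dEk: "((\<lambda>u. cmap e (E u)) has_derivative dE e (h (\<gamma> t))) (at (h (\<gamma> t)))"
        by (rule dE[OF e(1) Et(1,3)])
      from has_derivative_compose[OF dh[unfolded has_vector_derivative_def] dEk]
      have "((\<lambda>s. cmap e (E (h (\<gamma> s)))) has_derivative (\<lambda>a. a *\<^sub>R dE e (h (\<gamma> t)) w)) (at t)"
        by (simp add: linear_scale[OF has_derivative_linear[OF dEk]])
      moreover have "\<forall>\<^sub>F s in at t. cmap e (E (h (\<gamma> s))) = cmap e (\<gamma> s)"
        using near by eventually_elim (simp add: hU)
      ultimately have "((\<lambda>s. cmap e (\<gamma> s)) has_derivative (\<lambda>a. a *\<^sub>R dE e (h (\<gamma> t)) w)) (at t)"
        by (rule has_derivative_transform_eventually) (use Et in auto)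
      then have "((\<lambda>s. cmap e (\<gamma> s)) has_vector_derivative dE e (h (\<gamma> t)) w) (at t)"
        by (simp add: has_vector_derivative_def)
      from speed_eq[OF e cont this]
      have speed: "speed M \<gamma> t = gnorm M e (cmap e (E (h (\<gamma> t)))) (dE e (h (\<gamma> t)) w)"
        by (simp add: Et)
      show "\<exists>w. ((\<lambda>s. h (\<gamma> s)) has_vector_derivative w) (at t) \<and>
          \<bar>h (\<gamma> t) \<bullet> (G *v w)\<bar> \<le> sqrt (h (\<gamma> t) \<bullet> (G *v h (\<gamma> t))) * speed M \<gamma> t"
        using dh radial_part_le_speed[OF Et(1) e(1) Et(3), of w] unfolding speed by blast
    qed
    with \<gamma>(4) show False by simp
  qed
  with K show ?thesis by blast
qed

end

context riemannian
begin

lemma gball_subset_compact_inj_radius: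
  assumes \<rho>: "0 < \<rho>" "ereal \<rho> < inj_radius M"
  shows "\<exists>K. compact K \<and> gball M x \<rho> \<subseteq> K"
proof -
  define c where "c = chart_at M x"
  have c: "c \<in> atlas M" "x \<in> cdom c" by (auto simp: c_def chart_at)
  have "ereal \<rho> < inj_radius_at M x"
    using \<rho>(2) unfolding inj_radius_def by (rule less_le_trans) (rule INF_lower, simp)
  then have "\<exists>z\<in>{ereal r | r. 0 < r \<and>
           (\<exists>E. exponential_on M c x {v. gnorm M c (cmap c x) v < r} E
              \<and> diffeo_onto_image M {v. gnorm M c (cmap c x) v < r} E)}. ereal \<rho> < z"
    unfolding inj_radius_at_def Let_def c_def[symmetric] less_Sup_iff .
  then obtain s E where s: "0 < s" "ereal \<rho> < ereal s"
    "exponential_on M c x {v. gnorm M c (cmap c x) v < s} E"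
    "diffeo_onto_image M {v. gnorm M c (cmap c x) v < s} E" by blast
  interpret exponential_ball M x c s E
    by unfold_locales (use c s in auto)
  show ?thesis using gball_subset_compact[OF \<rho>(1)] s(2) by simp
qed

end

section \<open>Volumes\<close>

context riemannian
begin

text \<open>The density \<open>sqrt (det g)\<close> lies between two positive constants on a compact coordinate ball. This
  gives positive volume to all balls and finite volume to small ones.\<close>

lemma compact_neighbourhood_volume:
  assumes \<mu>: "riemannian_volume M \<mu>" and W: "open W" "x \<in> W"
  obtains A where "compact A" "x \<in> interior A" "A \<subseteq> W" "0 < emeasure \<mu> A" "emeasure \<mu> A < \<infinity>"
proof -
  define c where "c = chart_at M x"
  have c: "c \<in> atlas M" "x \<in> cdom c" by (auto simp: c_def chart_at)
  have "open (cmap c ` (W \<inter> cdom c))" "cmap c x \<in> cmap c ` (W \<inter> cdom c)"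
    using c W chart_open[OF c(1)] by (auto intro!: open_cmap_image)
  then obtain r where r: "r > 0" "cball (cmap c x) r \<subseteq> cmap c ` (W \<inter> cdom c)"
    by (metis open_contains_cball)
  let ?C = "cball (cmap c x) r"
  have img: "?C \<subseteq> cimg c" using r by (auto simp: cimg_def)
  define A where "A = cinv c ` ?C"
  have A: "compact A"
    unfolding A_def using continuous_on_cinv[OF c(1)] img
    by (intro compact_continuous_image) (auto intro: continuous_on_subset)
  have AW: "A \<subseteq> W \<inter> cdom c"
  proof
    fix y assume "y \<in> A"
    then obtain z where z: "z \<in> ?C" "y = cinv c z" by (auto simp: A_def)
    then obtain w where "w \<in> W \<inter> cdom c" "z = cmap c w" using r by blast
    then show "y \<in> W \<inter> cdom c" using z c by auto
  qed
  have "cinv c ` ball (cmap c x) r \<subseteq> interior A"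
    using img ball_subset_cball[of "cmap c x" r] c unfolding A_def
    by (intro interior_maximal open_cinv_image image_mono) auto
  moreover have "x \<in> cinv c ` ball (cmap c x) r"
    using c r(1) by (intro image_eqI[of _ _ "cmap c x"]) auto
  ultimately have xA: "x \<in> interior A" by blast
  have cA: "cmap c ` A = ?C"
  proof -
    have "cmap c ` A = (\<lambda>z. z) ` ?C"
      unfolding A_def image_image using img c by (intro image_cong) auto
    then show ?thesis by simp
  qed
  have "A \<in> sets borel" using A by (intro borel_closed compact_imp_closed)
  then have em: "emeasure \<mu> A = (\<integral>\<^sup>+y. ennreal (sqrt (det (gmat M c y))) * indicator ?C y \<partial>lborel)"
    using \<mu> c AW unfolding riemannian_volume_def cA[symmetric] by blast
  have "continuous_on ?C (\<lambda>y. sqrt (det (gmat M c y)))"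
    unfolding det_def
    by (intro continuous_intros continuous_on_subset[OF continuous_on_gmat[OF c(1)] img])
  moreover have "?C \<noteq> {}" using r(1) by simp
  ultimately obtain a b where a: "a \<in> ?C" "\<And>y. y \<in> ?C \<Longrightarrow> sqrt (det (gmat M c a)) \<le> sqrt (det (gmat M c y))"
    and b: "b \<in> ?C" "\<And>y. y \<in> ?C \<Longrightarrow> sqrt (det (gmat M c y)) \<le> sqrt (det (gmat M c b))"
    using continuous_attains_inf[of ?C "\<lambda>y. sqrt (det (gmat M c y))"]
      continuous_attains_sup[of ?C "\<lambda>y. sqrt (det (gmat M c y))"] by (metis compact_cball)
  let ?l = "sqrt (det (gmat M c a))" and ?u = "sqrt (det (gmat M c b))"
  have "posdef (gmat M c a)" using a img c by (intro posdef_gmat) auto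
  then have l: "0 < ?l" by (simp add: posdef_det_pos)
  have "0 < emeasure lborel (ball (cmap c x) r)"
    using r(1) emeasure_ball[of r "cmap c x"] unit_ball_vol_pos[of "real CARD('n)"] by (simp add: ennreal_zero_less_mult_iff)
  also have "\<dots> \<le> emeasure lborel ?C" by (intro emeasure_mono ball_subset_cball) simp
  finally have "0 < ennreal ?l * emeasure lborel ?C" using l by (simp add: ennreal_zero_less_mult_iff)
  also have "\<dots> = (\<integral>\<^sup>+y. ennreal ?l * indicator ?C y \<partial>lborel)"
    by (simp add: nn_integral_cmult_indicator)
  also have "\<dots> \<le> emeasure \<mu> A"
    unfolding em using a by (intro nn_integral_mono) (auto simp: indicator_def intro: ennreal_leI)
  finally have pos: "0 < emeasure \<mu> A" .
  have "emeasure \<mu> A \<le> (\<integral>\<^sup>+y. ennreal ?u * indicator ?C y \<partial>lborel)"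
    unfolding em using b by (intro nn_integral_mono) (auto simp: indicator_def intro: ennreal_leI)
  also have "\<dots> = ennreal ?u * emeasure lborel ?C"
    by (simp add: nn_integral_cmult_indicator)
  also have "\<dots> < \<infinity>"
    using emeasure_bounded_finite[of ?C] by (simp add: ennreal_mult_less_top)
  finally show ?thesis using that[OF A xA _ pos] AW by blast
qed

end

section \<open>Doubling metric measure spaces\<close>

text \<open>Only finiteness of the volume of small balls is required; for large ones it follows from
  doubling.\<close>

locale doubling_space =
  fixes d :: "'a::t2_space \<Rightarrow> 'a \<Rightarrow> real" and \<mu> :: "'a measure" and A :: real
  assumes dist_refl: "d x x = 0" and dist_sym: "d x y = d y x"
    and dist_triangle: "d x z \<le> d x y + d y z"
    and open_ball: "open {y. d x y < r}"
    and sets_\<mu>: "sets \<mu> = sets borel"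
    and ball_pos: "0 < r \<Longrightarrow> 0 < emeasure \<mu> {y. d x y < r}"
    and small_ball_finite: "\<exists>r>0. emeasure \<mu> {y. d x y < r} < \<infinity>"
    and A_pos: "0 < A"
    and doubling: "0 < r \<Longrightarrow> emeasure \<mu> {y. d x y < 2 * r} \<le> ennreal A * emeasure \<mu> {y. d x y < r}"
begin

definition B :: "'a \<Rightarrow> real \<Rightarrow> 'a set" where "B x r = {y. d x y < r}"

lemma sets_B [measurable, simp]: "B x r \<in> sets \<mu>"
  unfolding B_def sets_\<mu> by (intro borel_open open_ball)

lemma B_mono: "r \<le> s \<Longrightarrow> B x r \<subseteq> B x s"
  by (auto simp: B_def)

lemma doubling_iterate: "0 < r \<Longrightarrow> emeasure \<mu> (B x (2 ^ k * r)) \<le> ennreal (A ^ k) * emeasure \<mu> (B x r)"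
proof (induction k)
  case (Suc k)
  have "emeasure \<mu> (B x (2 ^ Suc k * r)) \<le> ennreal A * emeasure \<mu> (B x (2 ^ k * r))"
    using doubling[of "2 ^ k * r" x] Suc.prems by (simp add: B_def mult.assoc)
  also have "\<dots> \<le> ennreal A * (ennreal (A ^ k) * emeasure \<mu> (B x r))"
    by (intro mult_left_mono Suc) auto
  also have "\<dots> = ennreal (A ^ Suc k) * emeasure \<mu> (B x r)"
    using A_pos by (simp add: ennreal_mult mult.assoc)
  finally show ?case .
qed simp

lemma finite_B: "emeasure \<mu> (B x r) < \<infinity>"
proof -
  obtain s where s: "0 < s" "emeasure \<mu> (B x s) < \<infinity>"
    using small_ball_finite[of x] by (auto simp: B_def)
  obtain k where "r / s < 2 ^ k" using real_arch_pow[of 2 "r / s"] by auto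
  then have "r \<le> 2 ^ k * s" using s by (simp add: field_simps)
  then have "emeasure \<mu> (B x r) \<le> emeasure \<mu> (B x (2 ^ k * s))"
    by (intro emeasure_mono B_mono) auto
  also have "\<dots> \<le> ennreal (A ^ k) * emeasure \<mu> (B x s)" by (rule doubling_iterate[OF s(1)])
  also have "\<dots> < \<infinity>" using s by (simp add: ennreal_mult_less_top)
  finally show ?thesis .
qed

definition V :: "'a \<Rightarrow> real \<Rightarrow> real" where "V x r = measure \<mu> (B x r)"

lemma emeasure_B: "emeasure \<mu> (B x r) = ennreal (V x r)"
  using finite_B[of x r] by (simp add: V_def emeasure_eq_ennreal_measure)

lemma V_pos: "0 < r \<Longrightarrow> 0 < V x r"
  using ball_pos[of r x] emeasure_B[of x r] by (simp add: B_def[symmetric])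

lemma V_nonneg: "0 \<le> V x r"
  by (simp add: V_def)

lemma V_mono: "B x r \<subseteq> B y s \<Longrightarrow> V x r \<le> V y s"
  using emeasure_mono[of "B x r" "B y s" \<mu>] by (simp add: emeasure_B V_nonneg)

lemma V_doubling: "0 < r \<Longrightarrow> V x (2 ^ k * r) \<le> A ^ k * V x r"
  using doubling_iterate[of r x k] A_pos by (simp add: emeasure_B V_nonneg flip: ennreal_mult)

lemma V_comparable:
  assumes r: "0 < r" and z: "z \<in> B x r" "z \<in> B y r"
  shows "V x r \<le> A\<^sup>2 * V y r"
proof -
  have "B x r \<subseteq> B y (2 ^ 2 * r)"
  proof
    fix w assume w: "w \<in> B x r"
    have "d y w \<le> d y z + d z x + d x w"
      using dist_triangle[of y w z] dist_triangle[of z w x] by simp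
    then show "w \<in> B y (2 ^ 2 * r)" using w z r dist_sym[of z x] by (simp add: B_def)
  qed
  from V_mono[OF this] V_doubling[OF r, of y 2] show ?thesis by simp
qed

text \<open>The balls of radius \<open>\<rho> / 2\<close> around a \<open>\<rho>\<close>-separated set are disjoint subsets of a ball of
  radius \<open>2 S\<close>, and by doubling each of them has at least a fixed proportion of its volume.\<close>

lemma separated_finite_bound:
  assumes \<rho>: "0 < \<rho>"
  obtains N :: nat where "\<And>F. finite F \<Longrightarrow> F \<subseteq> B x R \<Longrightarrow>
    (\<And>y z. y \<in> F \<Longrightarrow> z \<in> F \<Longrightarrow> y \<noteq> z \<Longrightarrow> \<rho> \<le> d y z) \<Longrightarrow> card F \<le> N"
proof -
  define S where "S = max R \<rho>"
  have S: "0 < S" "R \<le> S" "\<rho> \<le> S" using \<rho> by (auto simp: S_def)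
  \<comment> \<open>After \<open>k\<close> doublings, a ball of radius \<open>\<rho> / 2\<close> around a point of \<open>F\<close> contains \<open>B x (2 * S)\<close>.\<close>
  obtain k where "3 * S / (\<rho> / 2) < 2 ^ k" using real_arch_pow[of 2 "3 * S / (\<rho> / 2)"] by auto
  then have k: "3 * S \<le> 2 ^ k * (\<rho> / 2)" using \<rho> by (simp add: field_simps)
  show ?thesis
  proof (rule that[of "nat \<lceil>A ^ k\<rceil>"])
    fix F assume F: "finite F" "F \<subseteq> B x R" and sep: "\<And>y z. y \<in> F \<Longrightarrow> z \<in> F \<Longrightarrow> y \<noteq> z \<Longrightarrow> \<rho> \<le> d y z"
    have low: "V x (2 * S) \<le> A ^ k * V y (\<rho> / 2)" if y: "y \<in> F" for y
    proof -
      have "B x (2 * S) \<subseteq> B y (2 ^ k * (\<rho> / 2))"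
      proof
        fix w assume w: "w \<in> B x (2 * S)"
        have "d y x < S" using y F(2) S dist_sym[of x y] by (auto simp: B_def)
        then have "d y w < 3 * S" using w dist_triangle[of y w x] by (auto simp: B_def)
        then show "w \<in> B y (2 ^ k * (\<rho> / 2))" using k by (simp add: B_def)
      qed
      from V_mono[OF this] V_doubling[of "\<rho> / 2" y k] \<rho> show ?thesis by simp
    qed
    have "disjoint_family_on (\<lambda>y. B y (\<rho> / 2)) F"
      unfolding disjoint_family_on_def
    proof (intro ballI impI)
      fix y z assume yz: "y \<in> F" "z \<in> F" "y \<noteq> z"
      have "\<not> (w \<in> B y (\<rho> / 2) \<and> w \<in> B z (\<rho> / 2))" for w
        using sep[OF yz] dist_triangle[of y z w] dist_sym[of w z] by (auto simp: B_def)
      then show "B y (\<rho> / 2) \<inter> B z (\<rho> / 2) = {}" by blast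
    qed
    then have "(\<Sum>y\<in>F. V y (\<rho> / 2)) = measure \<mu> (\<Union>y\<in>F. B y (\<rho> / 2))"
      unfolding V_def using F(1) finite_B
      by (intro measure_finite_Union[symmetric]) (auto simp: less_top)
    also have "\<dots> \<le> V x (2 * S)"
      unfolding V_def
    proof (rule measure_mono_fmeasurable)
      show "(\<Union>y\<in>F. B y (\<rho> / 2)) \<subseteq> B x (2 * S)"
      proof
        fix w assume "w \<in> (\<Union>y\<in>F. B y (\<rho> / 2))"
        then obtain y where y: "y \<in> F" "d y w < \<rho> / 2" by (auto simp: B_def)
        moreover from y F(2) S have "d x y < S" by (auto simp: B_def)
        ultimately show "w \<in> B x (2 * S)" using dist_triangle[of x w y] S \<rho> by (simp add: B_def)
      qed
      show "(\<Union>y\<in>F. B y (\<rho> / 2)) \<in> sets \<mu>" using F(1) by auto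
      show "B x (2 * S) \<in> fmeasurable \<mu>" using finite_B by (simp add: fmeasurable_def)
    qed
    finally have sum: "(\<Sum>y\<in>F. V y (\<rho> / 2)) \<le> V x (2 * S)" .
    have "real (card F) * V x (2 * S) = (\<Sum>y\<in>F. V x (2 * S))" by simp
    also have "\<dots> \<le> (\<Sum>y\<in>F. A ^ k * V y (\<rho> / 2))" by (intro sum_mono low)
    also have "\<dots> \<le> A ^ k * V x (2 * S)"
      using sum A_pos by (simp add: sum_distrib_left[symmetric])
    finally have "real (card F) \<le> A ^ k" using V_pos[of "2 * S" x] S by simp
    then show "card F \<le> nat \<lceil>A ^ k\<rceil>" by linarith
  qed
qed

text \<open>A \<open>\<rho>\<close>-separated subset with the largest possible number of elements is a \<open>\<rho>\<close>-net.\<close>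

lemma totally_bounded_B:
  assumes \<rho>: "0 < \<rho>"
  obtains F where "finite F" "B x R \<subseteq> (\<Union>y\<in>F. B y \<rho>)"
proof -
  define sep where
    "sep F \<longleftrightarrow> finite F \<and> F \<subseteq> B x R \<and> (\<forall>y\<in>F. \<forall>z\<in>F. y \<noteq> z \<longrightarrow> \<rho> \<le> d y z)" for F
  obtain N where N: "\<And>F. sep F \<Longrightarrow> card F \<le> N"
    unfolding sep_def using separated_finite_bound[OF \<rho>, of x R] by metis
  have "sep {}" by (simp add: sep_def)
  then have "\<exists>F. sep F \<and> (\<forall>F'. sep F' \<longrightarrow> card F' \<le> card F)"
    by (rule Lattices_Big.ex_has_greatest_nat[where b="Suc N"]) (use N in \<open>simp add: less_Suc_eq_le\<close>)
  then obtain F where F: "sep F" "\<And>F'. sep F' \<Longrightarrow> card F' \<le> card F"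
    by blast
  have "B x R \<subseteq> (\<Union>y\<in>F. B y \<rho>)"
  proof
    fix w assume w: "w \<in> B x R"
    show "w \<in> (\<Union>y\<in>F. B y \<rho>)"
    proof (rule ccontr)
      assume "w \<notin> (\<Union>y\<in>F. B y \<rho>)"
      then have far: "\<rho> \<le> d y w" if "y \<in> F" for y using that by (simp add: B_def not_less)
      then have "w \<notin> F" using \<rho> dist_refl[of w] by (metis not_less)
      have "sep (insert w F)"
      proof -
        have "\<rho> \<le> d w y" if "y \<in> F" for y using far[OF that] dist_sym[of w y] by simp
        then show ?thesis using F(1) w far unfolding sep_def by blast
      qed
      from F(2)[OF this] show False using F(1) \<open>w \<notin> F\<close> by (simp add: sep_def)
    qed
  qed
  moreover have "finite F" using F(1) by (simp add: sep_def)
  ultimately show ?thesis by (intro that)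
qed

lemma compact_closure_B:
  assumes \<rho>: "0 < \<rho>" and loc: "\<And>y. \<exists>K. compact K \<and> B y \<rho> \<subseteq> K"
  shows "compact (closure (B x R))"
proof -
  obtain F where F: "finite F" "B x R \<subseteq> (\<Union>y\<in>F. B y \<rho>)" by (rule totally_bounded_B[OF \<rho>])
  obtain K where K: "\<And>y. compact (K y)" "\<And>y. B y \<rho> \<subseteq> K y" using loc by metis
  have c: "compact (\<Union>y\<in>F. K y)" using F K by (intro compact_UN) auto
  have "B x R \<subseteq> (\<Union>y\<in>F. K y)" using F K by blast
  then have "closure (B x R) \<subseteq> (\<Union>y\<in>F. K y)"
    using compact_imp_closed[OF c] by (rule closure_minimal)
  with c have "compact ((\<Union>y\<in>F. K y) \<inter> closure (B x R))" by (intro compact_Int_closed) auto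
  with \<open>closure (B x R) \<subseteq> _\<close> show ?thesis by (simp add: Int_absorb1)
qed

text \<open>Otherwise \<open>V(x, a + 2 k j) \<ge> q\<^sup>j V(x, a)\<close> for all \<open>j\<close>. For \<open>j = 2\<^sup>i\<close> the volume on the left is at most
  \<open>A\<^sup>i V(x, a + 2 k)\<close> by doubling, which is too small for large \<open>i\<close>.\<close>

lemma slow_growth:
  fixes k m :: nat and q :: real
  assumes q: "1 < q" and k: "0 < k"
  shows "\<exists>n\<ge>m. k < n \<and> V x (real n + real k) < q * V x (real n - real k)"
proof (rule ccontr)
  assume "\<not> ?thesis"
  then have grow: "q * V x (real n - real k) \<le> V x (real n + real k)" if "m \<le> n" "k < n" for n
    using that by (meson not_le)
  define a where "a = m + 1"
  have step: "q ^ j * V x a \<le> V x (a + 2 * k * j)" for j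
  proof (induction j)
    case (Suc j)
    have "q ^ Suc j * V x a \<le> q * V x (a + 2 * k * j)"
      using Suc q by (simp add: mult.assoc)
    also have "\<dots> \<le> V x (a + 2 * k * Suc j)"
      using grow[of "a + 2 * k * j + k"] by (simp add: a_def algebra_simps)
    finally show ?case .
  qed simp
  have a: "0 < V x a" by (rule V_pos) (simp add: a_def)
  have bound: "q ^ (2 ^ i) * V x a \<le> A ^ i * V x (a + 2 * k)" for i
  proof -
    have "q ^ (2 ^ i) * V x a \<le> V x (a + 2 * k * 2 ^ i)" using step[of "2 ^ i"] by simp
    also have "\<dots> \<le> V x (2 ^ i * real (a + 2 * k))"
    proof (intro V_mono B_mono)
      have "real a * 1 \<le> real a * 2 ^ i" by (intro mult_left_mono) auto
      then show "real (a + 2 * k * 2 ^ i) \<le> 2 ^ i * real (a + 2 * k)" by (simp add: algebra_simps)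
    qed
    also have "\<dots> \<le> A ^ i * V x (a + 2 * k)"
      by (rule V_doubling) (simp add: a_def)
    finally show ?thesis .
  qed
  \<comment> \<open>Taking logarithms, a linear function of \<open>i\<close> would dominate \<open>2\<^sup>i\<close>.\<close>
  define W U where "W = V x (a + 2 * k)" and "U = V x a"
  have W: "0 < W" unfolding W_def by (rule V_pos) (simp add: a_def)
  have U: "0 < U" unfolding U_def by (rule a)
  define l where "l = ln q"
  have l: "l > 0" using q by (simp add: l_def)
  have ln: "2 ^ i * l \<le> real i * ln A + (ln W - ln U)" for i :: nat
  proof -
    have "q ^ (2 ^ i) * U \<le> A ^ i * W" using bound[of i] by (simp only: W_def U_def)
    moreover have "0 < q ^ (2 ^ i) * U" using q U by simp
    ultimately have "ln (q ^ (2 ^ i) * U) \<le> ln (A ^ i * W)" by (simp add: ln_mono)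
    then show ?thesis
      using q U W A_pos by (simp add: ln_mult ln_realpow l_def)
  qed
  define C where "C = \<bar>ln A\<bar>"
  define D where "D = ln W - ln U"
  have "filterlim (\<lambda>i::nat. 2 ^ i * l - (real i * C + D)) at_top at_top"
    using l by real_asymp
  then have "\<forall>\<^sub>F i::nat in at_top. 2 ^ i * l - (real i * C + D) > 0"
    unfolding filterlim_at_top_dense by blast
  then obtain i :: nat where "2 ^ i * l - (real i * C + D) > 0"
    by (auto simp: eventually_at_top_linorder)
  moreover have "real i * ln A \<le> real i * C" by (intro mult_left_mono) (auto simp: C_def)
  ultimately show False using ln[of i] by (simp add: D_def)
qed

lemma closure_B_subset: "y \<in> closure (B x r) \<Longrightarrow> d x y \<le> r"
proof (rule field_le_epsilon)
  fix e :: real assume y: "y \<in> closure (B x r)" and e: "e > 0"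
  have "open (B y e)" "y \<in> B y e" using open_ball e by (auto simp: B_def dist_refl)
  then obtain z where "z \<in> B x r" "z \<in> B y e"
    using y by (metis IntE closure_iff_nhds_not_empty disjoint_iff subset_refl)
  then show "d x y \<le> r + e" using dist_triangle[of x y z] dist_sym[of y z] by (simp add: B_def)
qed

lemma slow_growth_sequence:
  obtains n :: "nat \<Rightarrow> nat" where "strict_mono n" "\<And>k. Suc k < n k"
    "\<And>k. V x (real (n k) + real (Suc k)) < (1 + 1 / real (Suc k)) * V x (real (n k) - real (Suc k))"
proof -
  let ?P = "\<lambda>k n. Suc k < n \<and> V x (real n + real (Suc k)) < (1 + 1 / real (Suc k)) * V x (real n - real (Suc k))"
  have ex: "\<exists>n\<ge>m. ?P k n" for k m
    using slow_growth[of "1 + 1 / real (Suc k)" "Suc k" m x] by simp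
  have "\<exists>n. \<forall>k. ?P k (n k) \<and> n k < n (Suc k)"
  proof (rule dependent_nat_choice)
    show "\<exists>n. ?P 0 n" using ex by blast
    show "\<exists>y. ?P (Suc k) y \<and> n < y" for n k
      using ex[of "Suc n" "Suc k"] by (metis Suc_le_eq)
  qed
  then obtain n where "\<And>k. ?P k (n k)" "\<And>k. n k < n (Suc k)" by blast
  then show ?thesis using that[of n] by (simp add: strict_mono_Suc_iff)
qed

end

section \<open>Regular exhaustions by balls\<close>

context riemannian
begin

text \<open>Expresses the infimum in \<open>ereal\<close> by real distances; for empty \<open>K\<close> both sides are false.\<close>

lemma Pen_plus_iff: "y \<in> Pen_plus M K r \<longleftrightarrow> (\<forall>s>r. \<exists>z\<in>K. geodist M y z < s)"
proof -
  have "y \<in> Pen_plus M K r \<longleftrightarrow> (\<forall>s>r. (INF z\<in>K. ereal (geodist M y z)) < ereal s)"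
  proof
    assume "y \<in> Pen_plus M K r"
    then show "\<forall>s>r. (INF z\<in>K. ereal (geodist M y z)) < ereal s"
      by (auto simp: Pen_plus_def intro: le_less_trans)
  next
    assume *: "\<forall>s>r. (INF z\<in>K. ereal (geodist M y z)) < ereal s"
    have "(INF z\<in>K. ereal (geodist M y z)) \<le> ereal r"
      by (rule dense_ge, metis "*" ereal_dense2 less_eq_real_def less_ereal.simps(1) less_imp_le less_trans)
    then show "y \<in> Pen_plus M K r" by (simp add: Pen_plus_def)
  qed
  then show ?thesis by (simp add: INF_less_iff)
qed

lemma closed_Pen_plus: "closed (Pen_plus M K r)"
proof -
  have "open (- Pen_plus M K r)"
  proof (subst open_subopen, intro ballI)
    fix y assume "y \<in> - Pen_plus M K r"
    then obtain s where s: "s > r" "\<And>z. z \<in> K \<Longrightarrow> s \<le> geodist M y z"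
      by (auto simp: Pen_plus_iff not_less)
    define e where "e = (s - r) / 2"
    have "gball M y e \<subseteq> - Pen_plus M K r"
    proof
      fix w assume w: "w \<in> gball M y e"
      have "s - e \<le> geodist M w z" if "z \<in> K" for z
        using s(2)[OF that] w geodist_triangle[of y z w] by (simp add: gball_def)
      moreover have "s - e > r" using s(1) by (simp add: e_def field_simps)
      ultimately show "w \<in> - Pen_plus M K r" by (auto simp: Pen_plus_iff not_less)
    qed
    moreover have "y \<in> gball M y e" using s(1) by (simp add: gball_def e_def)
    ultimately show "\<exists>T. open T \<and> y \<in> T \<and> T \<subseteq> - Pen_plus M K r" using open_gball by blast
  qed
  then show ?thesis by (simp add: closed_def)
qed

lemma subset_Pen_plus: "0 \<le> r \<Longrightarrow> K \<subseteq> Pen_plus M K r"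
  unfolding subset_iff Pen_plus_iff by (metis geodist_refl le_less_trans)

lemma Pen_minus_subset: "closed K \<Longrightarrow> 0 \<le> r \<Longrightarrow> Pen_minus M K r \<subseteq> K"
  unfolding Pen_minus_def using subset_Pen_plus[of r "- K"] by (intro closure_minimal) auto

lemma doubling_space_geodist:
  assumes \<mu>: "riemannian_volume M \<mu>" and A: "0 < A"
    and doubling: "\<And>x r. 0 < r \<Longrightarrow> ball_volume M \<mu> x (2 * r) \<le> ennreal A * ball_volume M \<mu> x r"
  shows "doubling_space (geodist M) \<mu> A"
proof
  have sets: "sets \<mu> = sets borel" using \<mu> by (simp add: riemannian_volume_def)
  show "sets \<mu> = sets borel" by (rule sets)
  show "open {y. geodist M x y < r}" for x r
    using open_gball by (simp add: gball_def)
  show "0 < emeasure \<mu> {y. geodist M x y < r}" if "0 < r" for x r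
  proof -
    have x: "x \<in> gball M x r" using that by (simp add: gball_def)
    obtain K where "K \<subseteq> gball M x r" "0 < emeasure \<mu> K"
      by (rule compact_neighbourhood_volume[OF \<mu> open_gball x]) blast
    moreover have "gball M x r \<in> sets \<mu>" unfolding sets by (intro borel_open open_gball)
    ultimately show ?thesis
      using emeasure_mono[of K "gball M x r" \<mu>] by (auto simp: gball_def)
  qed
  show "\<exists>r>0. emeasure \<mu> {y. geodist M x y < r} < \<infinity>" for x
  proof -
    obtain K where K: "compact K" "x \<in> interior K" "emeasure \<mu> K < \<infinity>"
      by (rule compact_neighbourhood_volume[OF \<mu> open_UNIV UNIV_I[of x]]) blast
    obtain e where e: "0 < e" "gball M x e \<subseteq> interior K"
      by (rule gball_subset_open[OF open_interior K(2)]) blast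
    have "K \<in> sets \<mu>" unfolding sets using K(1) by (intro borel_closed compact_imp_closed)
    then have "emeasure \<mu> (gball M x e) \<le> emeasure \<mu> K"
      using e(2) interior_subset by (intro emeasure_mono) blast+
    with K e show ?thesis by (auto simp: gball_def intro!: exI[of _ e])
  qed
  show "emeasure \<mu> {y. geodist M x y < 2 * r} \<le> ennreal A * emeasure \<mu> {y. geodist M x y < r}" if "0 < r" for x r
    using doubling[OF that, of x] by (simp add: ball_volume_def gball_def)
qed (auto intro: geodist_sym geodist_triangle A)

text \<open>With \<open>K\<close> the closed ball of radius \<open>n k\<close>, and \<open>k \<ge> r\<close>, the outer set lies in the ball of radius
  \<open>n k + (k + 1)\<close>, and the inner set contains the ball of radius \<open>n k - (k + 1)\<close>. The quotient of
  the volumes is therefore between \<open>1\<close> and \<open>1 + 1/(k + 1)\<close>.\<close>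

lemma ball_exhaustion:
  assumes dm: "doubling_space (geodist M) \<mu> A"
    and \<rho>: "0 < \<rho>" "\<And>y. \<exists>K. compact K \<and> gball M y \<rho> \<subseteq> K"
  shows "\<exists>n::nat \<Rightarrow> nat. regular_exhaustion M \<mu> (\<lambda>k. closure (gball M x (real (n k))))"
proof -
  interpret doubling_space "geodist M" \<mu> A by (rule dm)
  have B: "gball M = B" by (simp add: fun_eq_iff gball_def B_def)
  obtain n where n: "strict_mono n" "\<And>k. Suc k < n k"
    "\<And>k. V x (real (n k) + real (Suc k)) < (1 + 1 / real (Suc k)) * V x (real (n k) - real (Suc k))"
    by (rule slow_growth_sequence[of x]) blast
  let ?K = "\<lambda>k. closure (B x (real (n k)))"
  have "regular_exhaustion M \<mu> ?K"
    unfolding regular_exhaustion_def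
  proof (intro conjI allI impI)
    show "compact (?K k)" for k
      using \<rho> by (intro compact_closure_B[of \<rho>]) (auto simp: B)
    show "incseq ?K"
      unfolding incseq_def using n(1) by (auto intro!: closure_mono B_mono subsetD simp: strict_mono_less_eq)
    show "(\<Union>k. ?K k) = UNIV"
    proof (intro equalityI subsetI UNIV_I)
      fix y :: 'a
      obtain k where "geodist M x y < real k" using reals_Archimedean2 by blast
      then have "y \<in> B x (real (n k))" using n(2)[of k] by (simp add: B_def)
      then show "y \<in> (\<Union>k. ?K k)" using closure_subset by blast
    qed
    fix r :: real assume r: "0 < r"
    let ?ratio = "\<lambda>k. emeasure \<mu> (Pen_plus M (?K k) r) / emeasure \<mu> (Pen_minus M (?K k) r)"
    have bounds: "1 \<le> ?ratio k \<and> ?ratio k \<le> ennreal (1 + 1 / real (Suc k))" if k: "r \<le> real k" for k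
    proof -
      have plus: "Pen_plus M (?K k) r \<subseteq> B x (real (n k) + real (Suc k))"
      proof
        fix y assume "y \<in> Pen_plus M (?K k) r"
        then obtain z where z: "z \<in> ?K k" "geodist M y z < r + 1"
          unfolding Pen_plus_iff by (metis less_add_one)
        then show "y \<in> B x (real (n k) + real (Suc k))"
          using closure_B_subset[OF z(1)] dist_triangle[of x y z] dist_sym[of z y] k by (simp add: B_def)
      qed
      have minus: "B x (real (n k) - real (Suc k)) \<subseteq> Pen_minus M (?K k) r"
      proof
        fix y assume y: "y \<in> B x (real (n k) - real (Suc k))"
        have "r + 1 \<le> geodist M y z" if "z \<in> - ?K k" for z
        proof -
          have "z \<notin> B x (real (n k))" using that closure_subset by blast
          then show ?thesis using y dist_triangle[of x z y] k by (simp add: B_def)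
        qed
        then have "y \<notin> Pen_plus M (- ?K k) r"
          unfolding Pen_plus_iff by (metis less_add_one not_less)
        then show "y \<in> Pen_minus M (?K k) r"
          unfolding Pen_minus_def using closure_subset by blast
      qed
      have le: "Pen_minus M (?K k) r \<subseteq> Pen_plus M (?K k) r"
        using Pen_minus_subset[of "?K k" r] subset_Pen_plus[of r "?K k"] r by auto
      have meas: "Pen_plus M (?K k) r \<in> sets \<mu>" "Pen_minus M (?K k) r \<in> sets \<mu>"
        unfolding sets_\<mu> Pen_minus_def by (intro borel_closed closed_Pen_plus closed_closure)+
      define a b where "a = V x (real (n k) - real (Suc k))" and "b = V x (real (n k) + real (Suc k))"
      have a: "0 < a" unfolding a_def using n(2)[of k] by (intro V_pos) simp
      have ba: "b < (1 + 1 / real (Suc k)) * a" unfolding a_def b_def by (rule n(3))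
      have e1: "ennreal a \<le> emeasure \<mu> (Pen_minus M (?K k) r)"
        unfolding a_def emeasure_B[symmetric] by (rule emeasure_mono[OF minus meas(2)])
      have e2: "emeasure \<mu> (Pen_minus M (?K k) r) \<le> emeasure \<mu> (Pen_plus M (?K k) r)"
        by (rule emeasure_mono[OF le meas(1)])
      have e3: "emeasure \<mu> (Pen_plus M (?K k) r) \<le> ennreal b"
        unfolding b_def emeasure_B[symmetric] by (rule emeasure_mono[OF plus sets_B])
      obtain p where p: "emeasure \<mu> (Pen_plus M (?K k) r) = ennreal p" "0 \<le> p"
        using e3 by (cases "emeasure \<mu> (Pen_plus M (?K k) r)") (auto simp: top_unique)
      obtain q where q: "emeasure \<mu> (Pen_minus M (?K k) r) = ennreal q" "0 \<le> q"
        using e2 p by (cases "emeasure \<mu> (Pen_minus M (?K k) r)") (auto simp: top_unique)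
      have aq: "a \<le> q" "q \<le> p" "p \<le> b"
        using e1 e2 e3 a p q by (auto simp: ennreal_le_iff2)
      have "p \<le> (1 + 1 / real (Suc k)) * q"
        using aq ba mult_left_mono[OF aq(1), of "1 + 1 / real (Suc k)"] by simp
      then have "1 \<le> p / q" "p / q \<le> 1 + 1 / real (Suc k)" using a aq by (auto simp: pos_divide_le_eq)
      then have "ennreal 1 \<le> ennreal (p / q)" "ennreal (p / q) \<le> ennreal (1 + 1 / real (Suc k))"
        using ennreal_leI by blast+
      moreover have "?ratio k = ennreal (p / q)"
        using p q a aq by (simp add: divide_ennreal)
      ultimately show ?thesis by (simp only: ennreal_1)
    qed
    have ev: "\<forall>\<^sub>F k in sequentially. r \<le> real k"
      by (rule eventually_sequentiallyI[of "nat \<lceil>r\<rceil>"]) linarith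
    show "?ratio \<longlonglongrightarrow> 1"
    proof (rule tendsto_sandwich)
      show "\<forall>\<^sub>F k in sequentially. 1 \<le> ?ratio k"
        using ev by eventually_elim (use bounds in blast)
      show "\<forall>\<^sub>F k in sequentially. ?ratio k \<le> ennreal (1 + 1 / real (Suc k))"
        using ev by eventually_elim (use bounds in blast)
      have "(\<lambda>k. 1 + 1 / real (Suc k)) \<longlonglongrightarrow> 1 + 0"
        by (intro tendsto_intros LIMSEQ_Suc[OF lim_1_over_n])
      then show "(\<lambda>k. ennreal (1 + 1 / real (Suc k))) \<longlonglongrightarrow> 1"
        using tendsto_ennrealI by fastforce
    qed simp
  qed
  then show ?thesis unfolding B by blast
qed

lemma ball_volume_ratio:
  assumes dm: "doubling_space (geodist M) \<mu> A"
    and r: "0 < r" and meet: "gball M x r \<inter> gball M y r \<noteq> {}"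
  shows "ennreal (1 / A\<^sup>2) \<le> ball_volume M \<mu> x r / ball_volume M \<mu> y r"
    and "ball_volume M \<mu> x r / ball_volume M \<mu> y r \<le> ennreal (A\<^sup>2)"
proof -
  interpret doubling_space "geodist M" \<mu> A by (rule dm)
  have B: "gball M = B" by (simp add: fun_eq_iff gball_def B_def)
  obtain z where z: "z \<in> B x r" "z \<in> B y r" using meet by (auto simp: B)
  have V: "0 < V x r" "0 < V y r" using V_pos[OF r] by auto
  have "ball_volume M \<mu> x r / ball_volume M \<mu> y r = ennreal (V x r / V y r)"
    using V by (simp add: ball_volume_def B emeasure_B divide_ennreal)
  moreover have "1 / A\<^sup>2 \<le> V x r / V y r" "V x r / V y r \<le> A\<^sup>2"
    using V_comparable[OF r z] V_comparable[OF r z(2,1)] V A_pos by (auto simp: field_simps)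
  ultimately show "ennreal (1 / A\<^sup>2) \<le> ball_volume M \<mu> x r / ball_volume M \<mu> y r"
    "ball_volume M \<mu> x r / ball_volume M \<mu> y r \<le> ennreal (A\<^sup>2)"
    by (simp_all add: ennreal_leI)
qed

end

theorem proposition3p7:
  fixes M :: "('a::{t2_space,second_countable_topology}, 'n::finite) riem"
    and \<mu> :: "'a measure"
    and p :: "real \<Rightarrow> 'a \<Rightarrow> 'a \<Rightarrow> real"
    and A C C' :: real
  assumes "riemannian_manifold M"
    and "\<not> compact (UNIV :: 'a set)"
    and "bounded_geometry M"
    and "riemannian_volume M \<mu>"
    and "heat_kernel M \<mu> p"
    and "0 < A" "0 < C" "0 < C'"
    and "\<And>x r. 0 < r \<Longrightarrow> ball_volume M \<mu> x (2 * r) \<le> ennreal A * ball_volume M \<mu> x r"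
    and "\<And>x r. 0 < r \<Longrightarrow> ennreal C / ball_volume M \<mu> x (sqrt r) \<le> ennreal (p r x x)"
    and "\<And>x r. 0 < r \<Longrightarrow> ennreal (p r x x) \<le> ennreal C' / ball_volume M \<mu> x (sqrt r)"
  shows "(\<exists>\<gamma>::real. 0 < \<gamma> \<and>
            (\<forall>x y r. 0 < r \<and> gball M x r \<inter> gball M y r \<noteq> {} \<longrightarrow>
               ennreal (1 / \<gamma>) \<le> ball_volume M \<mu> x r / ball_volume M \<mu> y r \<and>
               ball_volume M \<mu> x r / ball_volume M \<mu> y r \<le> ennreal \<gamma>)) \<and>
         (\<forall>x. \<exists>n::nat \<Rightarrow> nat. regular_exhaustion M \<mu> (\<lambda>k. closure (gball M x (real (n k)))))"
proof -
  interpret riemannian M by unfold_locales (rule assms(1))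
  have dm: "doubling_space (geodist M) \<mu> A"
    by (rule doubling_space_geodist[OF assms(4,6,9)])
  have "0 < inj_radius M" using assms(3) by (simp add: bounded_geometry_def)
  then obtain \<rho> where \<rho>: "0 < \<rho>" "ereal \<rho> < inj_radius M"
    by (metis ereal_dense2 ereal_less(2))
  show ?thesis
  proof (intro conjI allI)
    show "\<exists>\<gamma>::real. 0 < \<gamma> \<and>
            (\<forall>x y r. 0 < r \<and> gball M x r \<inter> gball M y r \<noteq> {} \<longrightarrow>
               ennreal (1 / \<gamma>) \<le> ball_volume M \<mu> x r / ball_volume M \<mu> y r \<and>
               ball_volume M \<mu> x r / ball_volume M \<mu> y r \<le> ennreal \<gamma>)"
      using ball_volume_ratio[OF dm] assms(6) by (intro exI[of _ "A\<^sup>2"]) auto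
    show "\<exists>n::nat \<Rightarrow> nat. regular_exhaustion M \<mu> (\<lambda>k. closure (gball M x (real (n k))))" for x
      by (rule ball_exhaustion[OF dm \<rho>(1) gball_subset_compact_inj_radius[OF \<rho>]])
  qed
qed

end
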